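(* Let $n\ge 2$, let $\Omega\subset\mathbb R^n$ be a domain, and let $f\in L^p_{\rm loc}(\mathbb R)$ be a real-valued function, for some $p>1$. Let $u_1,u_2\in C^1(\Omega)$ be real-valued functions whose gradients do not vanish anywhere in $\Omega$, and suppose that $$\Delta u_1+f(u_1)\ge 0\quad\text{and}\quad \Delta u_2+f(u_2)\le 0\qquad\text{in }\Omega$$ in the weak sense. If $u_1\le u_2$ in $\Omega$ and $u_1(x_0)=u_2(x_0)$ for some $x_0\in\Omega$, then $u_1=u_2$ in the whole of $\Omega$.
   Context: A domain is a nonempty connected open set. Since $u\in C^1(\Omega)$ and $\nabla u\neq0$ in $\Omega$, the composition $f(u)$ is a well-defined measurable function in $L^p_{\rm loc}(\Omega)$ (independent, up to null sets, of the representative of $f$). The inequality $\Delta u+f(u)\ge0$ (respectively $\le 0$) in the weak sense means $$\int_\Omega\bigl(-\nabla u\cdot\nabla\varphi+f(u)\varphi\bigr)\,dx\ge0\quad(\text{respectively }\le0)$$ for every nonnegative $\varphi\in C_c^\infty(\Omega)$. *)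

theory Defs
  imports "HOL-Analysis.Analysis"
begin

definition gradient :: "('a::euclidean_space \<Rightarrow> real) \<Rightarrow> 'a \<Rightarrow> 'a" where
  "gradient u x = (THE D. GDERIV u x :> D)"

lemma gradient_eq:
  assumes D: "GDERIV u x :> D"
  shows "gradient u x = D"
  unfolding gradient_def
proof (rule the_equality)
  show "GDERIV u x :> D" by (rule D)
next
  fix D' assume D': "GDERIV u x :> D'"
  have "(\<lambda>h. h \<bullet> D') = (\<lambda>h. h \<bullet> D)"
    by (rule has_derivative_unique[OF D'[unfolded gderiv_def] D[unfolded gderiv_def]])
  then have "\<forall>h. h \<bullet> D' = h \<bullet> D" by (rule fun_cong[THEN allI])
  then show "D' = D" by (simp only: vector_eq_ldot)
qed

text \<open>The class \<open>C\<^sup>k(S)\<close>, intended for open \<open>S\<close>; values of \<open>u\<close> outside \<open>S\<close> are then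
  irrelevant. Continuity of the derivative is required direction by direction, which in
  finite dimension is the same as continuity of \<open>x \<mapsto> Du(x)\<close>.\<close>

primrec Ck_on :: "nat \<Rightarrow> 'a::euclidean_space set \<Rightarrow> ('a \<Rightarrow> real) \<Rightarrow> bool" where
  "Ck_on 0 S u \<longleftrightarrow> continuous_on S u"
| "Ck_on (Suc k) S u \<longleftrightarrow> (\<forall>x\<in>S. u differentiable (at x)) \<and>
     (\<forall>v. Ck_on k S (\<lambda>x. frechet_derivative u (at x) v))"

text \<open>\<open>C\<^sub>c\<^sup>\<infinity>(\<Omega>)\<close>, its elements being extended by zero to the whole space.\<close>

definition test_functions :: "'a::euclidean_space set \<Rightarrow> ('a \<Rightarrow> real) set" where
  "test_functions \<Omega> = {\<phi>. (\<forall>k. Ck_on k UNIV \<phi>) \<and>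
     compact (closure {x. \<phi> x \<noteq> 0}) \<and> closure {x. \<phi> x \<noteq> 0} \<subseteq> \<Omega>}"

text \<open>\<open>L\<^sup>p\<^sub>l\<^sub>o\<^sub>c\<close> on the real line. Its elements are functions rather than classes modulo null
  sets, measurable in the sense of Lebesgue (not necessarily Borel).\<close>

definition Lp_loc :: "real \<Rightarrow> (real \<Rightarrow> real) set" where
  "Lp_loc p = {f. f \<in> borel_measurable lebesgue \<and>
     (\<forall>K. compact K \<longrightarrow> set_integrable lebesgue K (\<lambda>t. \<bar>f t\<bar> powr p))}"

text \<open>The weak inequalities \<open>\<Delta>u + f(u) \<ge> 0\<close> and \<open>\<Delta>u + f(u) \<le> 0\<close> in \<open>\<Omega>\<close>. The Bochner
  integral of a non-integrable function is 0, but this convention plays no role when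
  \<open>u\<close> is \<open>C\<^sup>1\<close> with nowhere vanishing gradient on the open set \<open>\<Omega>\<close> and \<open>f\<close> is locally
  in \<open>L\<^sup>p\<close> (\<open>p \<ge> 1\<close>): then \<open>f \<circ> u\<close> is locally integrable in \<open>\<Omega>\<close>. It need only
  be Lebesgue measurable, whence the completed measure.\<close>

definition weak_ge :: "'a::euclidean_space set \<Rightarrow> (real \<Rightarrow> real) \<Rightarrow> ('a \<Rightarrow> real) \<Rightarrow> bool" where
  "weak_ge \<Omega> f u \<longleftrightarrow> (\<forall>\<phi>\<in>test_functions \<Omega>. (\<forall>x. \<phi> x \<ge> 0) \<longrightarrow>
     (LINT x:\<Omega>|lebesgue. - (gradient u x \<bullet> gradient \<phi> x) + f (u x) * \<phi> x) \<ge> 0)"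

definition weak_le :: "'a::euclidean_space set \<Rightarrow> (real \<Rightarrow> real) \<Rightarrow> ('a \<Rightarrow> real) \<Rightarrow> bool" where
  "weak_le \<Omega> f u \<longleftrightarrow> (\<forall>\<phi>\<in>test_functions \<Omega>. (\<forall>x. \<phi> x \<ge> 0) \<longrightarrow>
     (LINT x:\<Omega>|lebesgue. - (gradient u x \<bullet> gradient \<phi> x) + f (u x) * \<phi> x) \<le> 0)"

end

theory Submission
  imports Defs
begin

text \<open>Testing the inequality for \<open>u\<close> with \<open>\<psi> \<partial>\<^sub>eu\<close> instead of \<open>\<psi>\<close> turns the
  nonlinearity into \<open>f(u) \<partial>\<^sub>eu\<close>. After the partial hodograph transform \<open>T\<close>, which replaces the
  coordinate along \<open>e\<close> by the value of \<open>u\<close>, this term becomes \<open>\<integral> f(y \<bullet> e) \<Psi>(y) dy\<close>: it no longer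
  depends on \<open>u\<close>, so it cancels when the inequalities for \<open>u\<^sub>1\<close> and \<open>u\<^sub>2\<close> are subtracted and
  no regularity of \<open>f\<close> is needed.

  The heights \<open>v\<^sub>i\<close> of the level sets thus satisfy \<open>-div (M(\<nabla>v\<^sub>1) - M(\<nabla>v\<^sub>2)) \<ge> 0\<close>
  with \<open>w = v\<^sub>1 - v\<^sub>2 \<ge> 0\<close>, and with \<open>e = \<nabla>u(x\<^sub>0)/|\<nabla>u(x\<^sub>0)|\<close> the flux differs from \<open>\<nabla>w\<close>
  by at most \<open>\<delta>|\<nabla>w|\<close> near the contact point \<open>y\<^sub>0\<close>. Testing with \<open>\<psi>/(2 sqrt w)\<close> the good
  term coming from the concavity of the square root absorbs this error:
  \<open>\<integral> sqrt w (\<Delta>\<psi> - \<delta>\<^sup>2|\<nabla>\<psi>|\<^sup>2/(2\<psi>)) \<le> 0\<close> for all \<open>\<psi> \<ge> 0\<close>.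
  For \<open>\<psi>\<close> take a truncated power \<open>|y - y\<^sub>0|\<^sup>-\<^sup>a\<close> with \<open>a\<close> slightly larger than
  \<open>n - 2\<close>, smoothed at scale \<open>sqrt \<sigma>\<close>. The bracket is then positive away from \<open>y\<^sub>0\<close>, and since
  \<open>w = O(|y - y\<^sub>0|)\<close> the contribution of the core tends to \<open>0\<close> with \<open>\<sigma>\<close>; hence \<open>w = 0\<close>.\<close>

section \<open>Compactly supported test functions of class \<open>C\<^sup>1\<close>\<close>

text \<open>Since \<open>f\<close> is only locally integrable, \<open>f(u2) - f(u1)\<close> is not
  controlled by \<open>u2 - u1\<close>, and no direct comparison argument starts. The other obstacle
  is regularity: \<open>\<partial>_e u\<close> is merely continuous, hence no admissible test
  function. It is replaced by difference quotients, and only an inequality survives the limit; this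
  suffices, because sub- and supersolution are each used in one direction only. What is obtained is
  a one-sided form of the conservation law belonging to translations along \<open>e\<close>. After
  the transform \<open>w\<close> is again only C^1, so all second derivatives have to fall on an
  explicit radial test function, and the operator is the Laplacian up to a small first order error.
  The excess of \<open>a\<close> over \<open>n - 2\<close> is \<open>1/4\<close>. It has to be
  positive, since the Laplacian of the power is proportional to \<open>a (a + 2 - n)\<close> and
  must dominate the error in \<open>\<delta>\<close>. It has to stay below \<open>1/2\<close>,
  because \<open>sqrt w = O(|y - y0|^(1/2))\<close> is all that tames the core: there the integrand
  times the volume is of order \<open>\<sigma>^(1/4 - 1/8) = \<sigma>^(1/8)\<close>.\<close>

definition C1_supp :: "'a::euclidean_space set \<Rightarrow> ('a \<Rightarrow> real) \<Rightarrow> ('a \<Rightarrow> 'a) \<Rightarrow> bool" where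
  "C1_supp K \<psi> g \<longleftrightarrow> compact K \<and> (\<forall>x. GDERIV \<psi> x :> g x) \<and> continuous_on UNIV g \<and>
     (\<forall>x. x \<notin> K \<longrightarrow> \<psi> x = 0)"

lemma GDERIV_continuous_on:
  assumes "\<And>x. x \<in> S \<Longrightarrow> GDERIV u x :> g x"
  shows "continuous_on S u"
  using assms unfolding gderiv_def
  by (intro continuous_at_imp_continuous_on ballI) (blast intro: has_derivative_continuous)

lemma GDERIV_zero_open:
  assumes "open S" "x \<in> S" "\<And>y. y \<in> S \<Longrightarrow> \<psi> y = 0"
  shows "GDERIV \<psi> x :> 0"
  unfolding gderiv_def
  by (rule has_derivative_transform_within_open[where f="\<lambda>_. 0" and s=S]) (use assms in auto)

lemma C1_supp_grad_zero:
  assumes "C1_supp K \<psi> g" "x \<notin> K"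
  shows "g x = 0"
proof -
  have K: "compact K" "GDERIV \<psi> x :> g x" "\<And>x. x \<notin> K \<Longrightarrow> \<psi> x = 0"
    using assms by (auto simp: C1_supp_def)
  have "GDERIV \<psi> x :> 0"
    by (rule GDERIV_zero_open[of "- K"]) (use K assms in \<open>auto simp: compact_imp_closed\<close>)
  then show ?thesis using gradient_eq[of \<psi> x 0] gradient_eq[OF K(2)] by simp
qed

lemma continuous_on_extend_zero:
  fixes f :: "'a::t2_space \<Rightarrow> 'b::{topological_space, zero}"
  assumes "open S" "continuous_on S f" "compact K" "K \<subseteq> S" "\<And>x. x \<notin> K \<Longrightarrow> f x = 0"
  shows "continuous_on UNIV f"
proof -
  have o: "open (- K)" using assms(3) by (simp add: compact_imp_closed open_Compl)
  have "continuous_on (- K) (\<lambda>x. 0 :: 'b)" by (rule continuous_on_const)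
  then have "continuous_on (- K) f" by (rule continuous_on_eq) (simp add: assms(5))
  then have "continuous_on (S \<union> - K) f"
    using assms(1,2) o by (intro continuous_on_open_Un) auto
  moreover have "S \<union> - K = UNIV" using assms(4) by auto
  ultimately show ?thesis by simp
qed

text \<open>Test functions built from \<open>u\<close>, its difference quotients or the transform
  are regular only on an open \<open>S\<close>. Vanishing off a compact \<open>K\<close> inside
  \<open>S\<close> glues them to zero, because \<open>S\<close> and the complement of
  \<open>K\<close> form an open cover.\<close>

lemma C1_supp_extend:
  assumes "open S" "compact K" "K \<subseteq> S" "\<And>x. x \<in> S \<Longrightarrow> GDERIV \<psi> x :> g x" "continuous_on S g"
    "\<And>x. x \<notin> K \<Longrightarrow> \<psi> x = 0" "\<And>x. x \<notin> K \<Longrightarrow> g x = 0"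
  shows "C1_supp K \<psi> g"
  unfolding C1_supp_def
proof (intro conjI allI)
  show "compact K" by fact
  have o: "open (- K)" using assms(2) by (simp add: compact_imp_closed open_Compl)
  show "GDERIV \<psi> x :> g x" for x
  proof (cases "x \<in> S")
    case False
    then have x: "x \<notin> K" using assms(3) by auto
    have "GDERIV \<psi> x :> 0"
      by (rule GDERIV_zero_open[OF o]) (use x assms(6) in auto)
    then show ?thesis using assms(7)[OF x] by simp
  qed (use assms(4) in simp)
  show "continuous_on UNIV g" by (rule continuous_on_extend_zero[OF assms(1,5,2,3,7)])
  show "x \<notin> K \<longrightarrow> \<psi> x = 0" for x using assms by auto
qed

lemma C1_supp_continuous: "C1_supp K \<psi> g \<Longrightarrow> continuous_on A \<psi>"
  unfolding C1_supp_def gderiv_def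
  by (blast intro: continuous_at_imp_continuous_on has_derivative_continuous)

lemma bounded_on_compact:
  fixes f :: "'a::topological_space \<Rightarrow> 'b::real_normed_vector"
  assumes "compact K" "continuous_on K f"
  obtains C where "C \<ge> 0" "\<And>x. x \<in> K \<Longrightarrow> norm (f x) \<le> C"
proof -
  have "compact (f ` K)" by (rule compact_continuous_image[OF assms(2,1)])
  then obtain C where "\<forall>y\<in>f ` K. norm y \<le> C" using compact_imp_bounded bounded_iff by blast
  then show ?thesis using that[of "max C 0"] by fastforce
qed

section \<open>Smooth bump functions and convolution\<close>

lemma Ck_on_coinduct:
  assumes "P f"
    and "\<And>f. P f \<Longrightarrow> (\<forall>x. f differentiable (at x)) \<and> (\<forall>v. P (\<lambda>x. frechet_derivative f (at x) v))"
  shows "Ck_on k UNIV f"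
  using assms(1)
proof (induction k arbitrary: f)
  case 0
  then have "\<forall>x. f differentiable (at x)" using assms(2) by blast
  then show ?case
    by (auto intro!: continuous_at_imp_continuous_on differentiable_imp_continuous_within)
next
  case (Suc k)
  then show ?case using assms(2) by simp
qed

text \<open>The classical function \<open>exp (-1/t)\<close> extended by zero, divided by all powers
  of \<open>t\<close>: differentiation produces such quotients, so the whole family is needed for
  closure under derivatives.\<close>

definition flat :: "nat \<Rightarrow> real \<Rightarrow> real" where
  "flat j t = (if t > 0 then exp (- 1 / t) / t ^ j else 0)"

lemma pow_le_fact_exp:
  assumes "s \<ge> (0::real)"
  shows "s ^ n \<le> fact n * exp s"
proof -
  have "s ^ n / fact n = (\<Sum>k\<in>{n}. s ^ k / fact k)" by simp
  also have "\<dots> \<le> (\<Sum>k. s ^ k / fact k)"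
    using summable_exp_generic[of s] assms
    by (intro sum_le_suminf) (auto simp: divide_inverse mult.commute)
  also have "\<dots> = exp s" by (simp add: exp_def divide_inverse mult.commute)
  finally show ?thesis by (simp add: field_simps)
qed

text \<open>A quadratic bound at the origin is enough for differentiability there; it is
  \<open>s^n \<le> n! exp s\<close> at \<open>s = 1/t\<close> with \<open>n = j + 2\<close>.\<close>

lemma flat_le: "\<bar>flat j t\<bar> \<le> fact (j + 2) * t ^ 2"
proof (cases "t > 0")
  case True
  have "(1/t) ^ (j+2) \<le> fact (j+2) * exp (1/t)"
    using True by (intro pow_le_fact_exp) auto
  then show ?thesis using True
    by (simp add: flat_def exp_minus field_simps power_add power2_eq_square)
qed (simp add: flat_def)

lemma flat_deriv: "(flat j has_real_derivative (flat (j+2) t - real j * flat (j+1) t)) (at t)"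
proof -
  consider "t > 0" | "t < 0" | "t = 0" by linarith
  then show ?thesis
  proof cases
    case 1
    have j: "real j * t ^ (j - 1) = real j * t ^ j / t"
      using 1 by (cases j) auto
    have "((\<lambda>t. exp (- 1 / t) / t ^ j) has_real_derivative
        ((exp (- 1 / t) * (1 / t^2)) * t ^ j - exp (- 1 / t) * (real j * t ^ (j - 1))) / (t ^ j * t ^ j)) (at t)"
      using 1 by (auto intro!: derivative_eq_intros simp: power2_eq_square)
    also have "((exp (- 1 / t) * (1 / t^2)) * t ^ j - exp (- 1 / t) * (real j * t ^ (j - 1))) / (t ^ j * t ^ j)
        = flat (j+2) t - real j * flat (j+1) t"
      unfolding j using 1 by (simp add: flat_def field_simps power2_eq_square)
    finally have "((\<lambda>t. exp (- 1 / t) / t ^ j) has_real_derivative (flat (j+2) t - real j * flat (j+1) t)) (at t)" .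
    then show ?thesis
      by (rule has_field_derivative_transform_within_open[where S="{0<..}"]) (use 1 in \<open>auto simp: flat_def\<close>)
  next
    case 2
    have "((\<lambda>t. 0) has_real_derivative (flat (j+2) t - real j * flat (j+1) t)) (at t)"
      using 2 by (simp add: flat_def)
    then show ?thesis
      by (rule has_field_derivative_transform_within_open[where S="{..<0}"]) (use 2 in \<open>auto simp: flat_def\<close>)
  next
    case 3
    have "((\<lambda>y. flat j y / y) \<longlongrightarrow> 0) (at 0)"
    proof (rule Lim_null_comparison)
      show "\<forall>\<^sub>F y in at 0. norm (flat j y / y) \<le> fact (j+2) * \<bar>y\<bar>"
      proof (rule eventually_mono[OF eventually_neq_at_within[of 0]])
        fix y :: real assume "y \<noteq> 0"
        then have "norm (flat j y / y) \<le> (fact (j+2) * y ^ 2) / \<bar>y\<bar>"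
          using flat_le[of j y] by (simp add: divide_right_mono)
        also have "\<dots> = fact (j+2) * \<bar>y\<bar>" using \<open>y \<noteq> 0\<close>
          by (auto simp: power2_eq_square abs_if)
        finally show "norm (flat j y / y) \<le> fact (j+2) * \<bar>y\<bar>" .
      qed
      show "((\<lambda>y::real. fact (j+2) * \<bar>y\<bar>) \<longlongrightarrow> 0) (at 0)"
        by (auto intro!: tendsto_eq_intros)
    qed
    then show ?thesis using 3 by (simp add: DERIV_def flat_def)
  qed
qed

text \<open>The algebra generated by the derivatives of \<open>x \<mapsto> flat 0 (c - x \<bullet> x)\<close>; being closed under
  directional derivatives, it consists of smooth functions.\<close>

inductive bumpy :: "real \<Rightarrow> ('a::euclidean_space \<Rightarrow> real) \<Rightarrow> bool" for c where
  base: "bumpy c (\<lambda>x. flat j (c - x \<bullet> x))"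
| inner: "bumpy c f \<Longrightarrow> bumpy c (\<lambda>x. (x \<bullet> v) * f x)"
| scale: "bumpy c f \<Longrightarrow> bumpy c (\<lambda>x. a * f x)"
| add: "bumpy c f \<Longrightarrow> bumpy c g \<Longrightarrow> bumpy c (\<lambda>x. f x + g x)"

lemma bumpy_deriv:
  "bumpy c f \<Longrightarrow> \<exists>f'. (\<forall>x. (f has_derivative f' x) (at x)) \<and> (\<forall>v. bumpy c (\<lambda>x. f' x v))"
proof (induction rule: bumpy.induct)
  case (base j)
  \<comment> \<open>The constants are placed so that the derivative is literally of the form
    produced by the introduction rules of \<open>bumpy\<close>.\<close>
  let ?f' = "\<lambda>x h. (- 2) * ((x \<bullet> h) * (flat (j+2) (c - x \<bullet> x) + (- real j) * flat (j+1) (c - x \<bullet> x)))"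
  have "((\<lambda>x. flat j (c - x \<bullet> x)) has_derivative ?f' x) (at x)" for x :: 'a
  proof -
    have "((\<lambda>x::'a. c - x \<bullet> x) has_derivative (\<lambda>h. - (2 * (x \<bullet> h)))) (at x)"
      by (auto intro!: derivative_eq_intros simp: inner_commute)
    from has_derivative_compose[OF this, of "flat j"] flat_deriv[of j "c - x \<bullet> x"]
    show ?thesis unfolding has_field_derivative_def by (force simp: algebra_simps)
  qed
  moreover have "bumpy c (\<lambda>x. ?f' x v)" for v :: 'a
    by (intro bumpy.scale bumpy.inner bumpy.add bumpy.base)
  ultimately show ?case by (intro exI[of _ ?f'] conjI allI) auto
next
  case (inner f v)
  then obtain f' where f': "\<And>x. (f has_derivative f' x) (at x)" "\<And>v. bumpy c (\<lambda>x. f' x v)" by blast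
  have "((\<lambda>x. (x \<bullet> v) * f x) has_derivative (\<lambda>h. (v \<bullet> h) * f x + (x \<bullet> v) * f' x h)) (at x)" for x
    by (auto intro!: derivative_eq_intros f' simp: inner_commute)
  moreover have "bumpy c (\<lambda>x. (v \<bullet> h) * f x + (x \<bullet> v) * f' x h)" for h
    by (intro bumpy.add bumpy.scale bumpy.inner f' inner)
  ultimately show ?case by (intro exI[of _ "\<lambda>x h. (v \<bullet> h) * f x + (x \<bullet> v) * f' x h"] conjI allI)
next
  case (scale f a)
  then obtain f' where f': "\<And>x. (f has_derivative f' x) (at x)" "\<And>v. bumpy c (\<lambda>x. f' x v)" by blast
  show ?case
    by (intro exI[of _ "\<lambda>x h. a * f' x h"] conjI allI has_derivative_mult_right bumpy.scale f')
next
  case (add f g)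
  then obtain f' g' where f': "\<And>x. (f has_derivative f' x) (at x)" "\<And>v. bumpy c (\<lambda>x. f' x v)"
    "\<And>x. (g has_derivative g' x) (at x)" "\<And>v. bumpy c (\<lambda>x. g' x v)" by blast
  show ?case
    by (intro exI[of _ "\<lambda>x h. f' x h + g' x h"] conjI allI has_derivative_add bumpy.add f')
qed

lemma bumpy_cont:
  assumes "bumpy c f"
  shows "continuous_on S f"
proof -
  obtain f' where "\<And>x. (f has_derivative f' x) (at x)"
    using bumpy_deriv[OF assms] by blast
  then show ?thesis
    by (intro continuous_at_imp_continuous_on ballI) (rule has_derivative_continuous)
qed

lemma bumpy_grad:
  fixes f :: "'a::euclidean_space \<Rightarrow> real"
  assumes "bumpy c f"
  obtains g where "\<And>x. GDERIV f x :> g x" "continuous_on UNIV g" "\<And>v. bumpy c (\<lambda>x. v \<bullet> g x)"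
proof -
  obtain f' where f': "\<And>x. (f has_derivative f' x) (at x)" "\<And>v. bumpy c (\<lambda>x. f' x v)"
    using bumpy_deriv[OF assms] by blast
  define g where "g x = (\<Sum>b\<in>Basis. f' x b *\<^sub>R b)" for x
  have g: "v \<bullet> g x = f' x v" for x v
  proof -
    have "linear (f' x)" using f'(1) has_derivative_linear by blast
    then have "f' x (\<Sum>b\<in>Basis. (v \<bullet> b) *\<^sub>R b) = (\<Sum>b\<in>Basis. (v \<bullet> b) * f' x b)"
      by (simp only: linear_sum linear_scale real_scaleR_def)
    then have "f' x v = (\<Sum>b\<in>Basis. (v \<bullet> b) * f' x b)"
      by (simp only: euclidean_representation)
    then show ?thesis by (simp add: g_def inner_sum_right mult.commute)
  qed
  show ?thesis
  proof
    show "GDERIV f x :> g x" for x unfolding gderiv_def g by (rule f'(1))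
    show "continuous_on UNIV g" unfolding g_def
      by (intro continuous_intros bumpy_cont[OF f'(2)])
    show "bumpy c (\<lambda>x. v \<bullet> g x)" for v unfolding g by (rule f'(2))
  qed
qed

text \<open>The derivative falls on \<open>\<rho>\<close> alone, so \<open>m\<close> need only be
  continuous. Both readings of a convolution are used: with a bump as \<open>\<rho>\<close> it gives
  smoothness, with a bump as \<open>m\<close> it shows that the gradient of a mollified function is
  the mollified gradient.\<close>

lemma conv_grad:
  fixes \<rho> :: "'a::euclidean_space \<Rightarrow> real"
  assumes m: "continuous_on (cbox a b) m"
    and \<rho>: "\<And>x. GDERIV \<rho> x :> g x" "continuous_on UNIV g"
  shows "GDERIV (\<lambda>x. integral (cbox a b) (\<lambda>z. m z * \<rho> (x - z))) x :> integral (cbox a b) (\<lambda>z. m z *\<^sub>R g (x - z))"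
proof -
  have gc: "continuous_on A (\<lambda>z. g (h z))" if "continuous_on A h" for A and h :: "_ \<Rightarrow> 'a"
    using continuous_on_compose2[OF \<rho>(2) that] by simp
  have rc: "continuous_on UNIV \<rho>" using \<rho>(1) unfolding gderiv_def
    by (meson continuous_at_imp_continuous_on has_derivative_continuous)
  have rc': "continuous_on A (\<lambda>z. \<rho> (h z))" if "continuous_on A h" for A and h :: "'a \<Rightarrow> 'a"
    using continuous_on_compose2[OF rc that] by simp
  have mc: "continuous_on (UNIV \<times> cbox a b) (\<lambda>z. m (snd z))"
    by (rule continuous_on_compose2[OF m continuous_on_snd[OF continuous_on_id]]) auto
  let ?f = "\<lambda>x z. m z *\<^sub>R blinfun_inner_left (g (x - z))"
  have "((\<lambda>x. integral (cbox a b) (\<lambda>z. m z * \<rho> (x - z))) has_derivative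
        blinfun_apply (integral (cbox a b) (?f x))) (at x within UNIV)"
  proof (rule leibniz_rule)
    show "((\<lambda>x. m t * \<rho> (x - t)) has_derivative blinfun_apply (m t *\<^sub>R blinfun_inner_left (g (x - t)))) (at x within UNIV)" for x t
    proof -
      have "((\<lambda>x. \<rho> (x - t)) has_derivative (\<lambda>h. h \<bullet> g (x - t))) (at x)"
        by (rule has_derivative_compose[of "\<lambda>x. x - t" "\<lambda>h. h" x UNIV \<rho> "\<lambda>h. h \<bullet> g (x - t)"])
           (auto intro!: derivative_eq_intros \<rho>(1)[unfolded gderiv_def])
      then show ?thesis
        by (auto intro!: derivative_eq_intros simp: blinfun.scaleR_left)
    qed
    show "(\<lambda>z. m z * \<rho> (x - z)) integrable_on cbox a b" for x
      by (intro integrable_continuous continuous_intros m rc')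
    show "continuous_on (UNIV \<times> cbox a b) (\<lambda>(x, t). ?f x t)"
      unfolding split_beta by (intro continuous_intros mc gc bounded_linear.continuous_on[OF bounded_linear_blinfun_inner_left])
  qed auto
  moreover have "blinfun_apply (integral (cbox a b) (?f x)) = (\<lambda>h. h \<bullet> integral (cbox a b) (\<lambda>z. m z *\<^sub>R g (x - z)))"
  proof
    fix h
    have i: "(\<lambda>z. m z *\<^sub>R g (x - z)) integrable_on cbox a b"
      by (intro integrable_continuous continuous_intros m gc)
    have "?f x integrable_on cbox a b"
      by (intro integrable_continuous continuous_intros m gc bounded_linear.continuous_on[OF bounded_linear_blinfun_inner_left])
    then have "blinfun_apply (integral (cbox a b) (?f x)) h = integral (cbox a b) (\<lambda>z. ?f x z h)"
      by (rule blinfun_apply_integral)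
    also have "\<dots> = integral (cbox a b) (\<lambda>z. h \<bullet> (m z *\<^sub>R g (x - z)))"
      by (simp add: blinfun.scaleR_left)
    also have "\<dots> = h \<bullet> integral (cbox a b) (\<lambda>z. m z *\<^sub>R g (x - z))"
      using integral_linear[OF i bounded_linear_inner_right[of h]] by (simp add: o_def)
    finally show "blinfun_apply (integral (cbox a b) (?f x)) h = h \<bullet> integral (cbox a b) (\<lambda>z. m z *\<^sub>R g (x - z))" .
  qed
  ultimately show ?thesis by (simp add: gderiv_def)
qed

text \<open>Convolutions of \<open>m\<close> with members of \<open>bumpy\<close> form a class
  closed under directional derivatives, since these act on the kernel and lead back to
  \<open>bumpy\<close>.\<close>

lemma conv_smooth:
  fixes \<eta> :: "'a::euclidean_space \<Rightarrow> real"
  assumes m: "continuous_on (cbox a b) m" and "bumpy c \<eta>"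
  shows "Ck_on k UNIV (\<lambda>x. integral (cbox a b) (\<lambda>z. m z * \<eta> (x - z)))"
proof -
  define P where "P f \<longleftrightarrow> (\<exists>\<eta>. bumpy c \<eta> \<and> f = (\<lambda>x. integral (cbox a b) (\<lambda>z. m z * \<eta> (x - z))))" for f
  have main: "(\<forall>x. f differentiable (at x)) \<and> (\<forall>v. P (\<lambda>x. frechet_derivative f (at x) v))" if "P f" for f :: "'a \<Rightarrow> real"
  proof -
    from that[unfolded P_def] obtain \<eta>
      where "bumpy c \<eta> \<and> f = (\<lambda>x. integral (cbox a b) (\<lambda>z. m z * \<eta> (x - z)))"
      by (rule exE)
    note \<eta> = conjunct1[OF this] conjunct2[OF this]
    obtain g where g: "\<And>x. GDERIV \<eta> x :> g x" "continuous_on UNIV g" "\<And>v. bumpy c (\<lambda>x. v \<bullet> g x)"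
      using bumpy_grad[OF \<eta>(1)] by blast
    have d: "(f has_derivative (\<lambda>h. h \<bullet> integral (cbox a b) (\<lambda>z. m z *\<^sub>R g (x - z)))) (at x)" for x
      using conv_grad[OF m g(1,2)] unfolding \<eta>(2) gderiv_def .
    have "frechet_derivative f (at x) v = integral (cbox a b) (\<lambda>z. m z * (v \<bullet> g (x - z)))" for x v
    proof -
      have "continuous_on (cbox a b) (\<lambda>z. g (x - z))"
        by (rule continuous_on_compose2[OF g(2)]) (auto intro!: continuous_intros)
      then have i: "(\<lambda>z. m z *\<^sub>R g (x - z)) integrable_on cbox a b"
        by (intro integrable_continuous continuous_intros m)
      have "frechet_derivative f (at x) v = v \<bullet> integral (cbox a b) (\<lambda>z. m z *\<^sub>R g (x - z))"
        by (rule fun_cong[OF frechet_derivative_at[OF d[of x]], symmetric])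
      then show ?thesis
        using integral_linear[OF i bounded_linear_inner_right[of v]] by (simp add: o_def)
    qed
    then have "P (\<lambda>x. frechet_derivative f (at x) v)" for v
      using g(3)[of v] unfolding P_def by blast
    then show ?thesis using d unfolding differentiable_def by blast
  qed
  show ?thesis
  proof (rule Ck_on_coinduct[where P="P"])
    show "P (\<lambda>x. integral (cbox a b) (\<lambda>z. m z * \<eta> (x - z)))"
      using assms(2) unfolding P_def by blast
  qed (rule main)
qed

lemma lebesgue_integral_affine:
  fixes f :: "'a::euclidean_space \<Rightarrow> real"
  assumes f: "f \<in> borel_measurable lebesgue" and s: "\<bar>s\<bar> = 1"
  shows "(LINT x|lebesgue. f (t + s *\<^sub>R x)) = (LINT x|lebesgue. f x)"
proof -
  have eq: "(\<lambda>x::'a. t + (\<Sum>j\<in>Basis. (s * (x \<bullet> j)) *\<^sub>R j)) = (\<lambda>x. t + s *\<^sub>R x)"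
    by (rule ext) (simp add: scaleR_sum_right[symmetric] euclidean_representation flip: scaleR_scaleR)
  have m: "(\<lambda>x::'a. t + s *\<^sub>R x) \<in> lebesgue \<rightarrow>\<^sub>M lebesgue"
    using lebesgue_affine_measurable[of "\<lambda>_. s" t] s unfolding eq by auto
  have "lebesgue = density (distr lebesgue lebesgue (\<lambda>x::'a. t + s *\<^sub>R x)) (\<lambda>_. (\<Prod>j\<in>(Basis::'a set). \<bar>s\<bar>))"
    using lebesgue_affine_euclidean[of "\<lambda>_. s" t] s unfolding eq by force
  then have "distr lebesgue lebesgue (\<lambda>x::'a. t + s *\<^sub>R x) = lebesgue"
    using s by (simp add: density_1)
  then show ?thesis using integral_distr[OF m f] by simp
qed

lemma compact_thicken:
  fixes K :: "'a::euclidean_space set"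
  assumes "compact K" "open S" "K \<subseteq> S"
  obtains r K' where "r > 0" "compact K'" "K' \<subseteq> S" "\<And>x y. x \<in> K \<Longrightarrow> norm y \<le> r \<Longrightarrow> x + y \<in> K'" "K \<subseteq> K'"
proof -
  obtain r where r: "r > 0" "(\<Union>x\<in>K. cball x r) \<subseteq> S"
    using compact_subset_open_imp_cball_epsilon_subset[OF assms] by blast
  let ?K = "{x + y |x y. x \<in> K \<and> y \<in> cball 0 r}"
  have "compact ?K" by (intro compact_sums assms compact_cball)
  moreover have "?K \<subseteq> S"
  proof safe
    fix x y :: 'a assume "x \<in> K" "y \<in> cball 0 r"
    then have "x + y \<in> cball x r" by (simp add: dist_norm)
    then show "x + y \<in> S" using r(2) \<open>x \<in> K\<close> by blast
  qed
  moreover have "x + y \<in> ?K" if "x \<in> K" "norm y \<le> r" for x y :: 'a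
    using that by auto
  moreover have "K \<subseteq> ?K" using r(1) by force
  ultimately show ?thesis using that[of r ?K] r(1) by blast
qed

lemma lebesgue_measurable_on_compact:
  fixes h :: "'a::euclidean_space \<Rightarrow> 'b::{second_countable_topology, real_normed_vector}"
  assumes "compact K" "continuous_on K h"
  shows "(\<lambda>x. indicator K x *\<^sub>R h x) \<in> borel_measurable lebesgue"
  using borel_measurable_continuous_on_indicator[OF borel_compact[OF assms(1)] assms(2)]
  by (simp add: measurable_completion)

text \<open>Dominated convergence, with a majorant that allows for a factor \<open>F\<close> that is
  merely integrable on \<open>K\<close>. Weak inequalities are passed to the limit through this
  form.\<close>

lemma nonneg_integral_limit:
  fixes s :: "nat \<Rightarrow> 'a::euclidean_space \<Rightarrow> real"
  assumes K: "compact K" and F: "set_integrable lebesgue K F"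
    and meas: "\<And>n. s n \<in> borel_measurable lebesgue"
    and bound: "\<And>n x. x \<in> K \<Longrightarrow> \<bar>s n x\<bar> \<le> C * (1 + \<bar>F x\<bar>)"
    and zero: "\<And>n x. x \<notin> K \<Longrightarrow> s n x = 0"
    and lim: "\<And>x. (\<lambda>n. s n x) \<longlonglongrightarrow> t x"
    and nn: "\<And>n. 0 \<le> (LINT x|lebesgue. s n x)"
  shows "0 \<le> (LINT x|lebesgue. t x)"
proof (rule LIMSEQ_le_const)
  have "set_integrable lebesgue K (\<lambda>x. 1 + \<bar>F x\<bar>)"
  proof (intro set_integral_add set_integrable_abs F)
    have "K \<in> sets lebesgue" "emeasure lebesgue K < \<infinity>"
      using emeasure_compact_finite[OF K] borel_compact[OF K] by auto
    then show "set_integrable lebesgue K (\<lambda>x. 1::real)"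
      unfolding set_integrable_def by (simp add: integrable_indicator_iff less_top)
  qed
  then have I: "integrable lebesgue (\<lambda>x. C * (indicator K x *\<^sub>R (1 + \<bar>F x\<bar>)))"
    unfolding set_integrable_def by (rule integrable_mult_right)
  show "(\<lambda>n. LINT x|lebesgue. s n x) \<longlonglongrightarrow> (LINT x|lebesgue. t x)"
  proof (rule integral_dominated_convergence[where w="\<lambda>x. C * (indicator K x *\<^sub>R (1 + \<bar>F x\<bar>))"])
    show "t \<in> borel_measurable lebesgue"
      by (rule borel_measurable_LIMSEQ_metric[OF meas lim])
    show "AE x in lebesgue. norm (s n x) \<le> C * (indicator K x *\<^sub>R (1 + \<bar>F x\<bar>))" for n
      using bound zero by (intro always_eventually allI) (auto simp: indicator_def)
  qed (use meas lim I in auto)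
  show "\<exists>N. \<forall>n\<ge>N. 0 \<le> (LINT x|lebesgue. s n x)" using nn by blast
qed

lemma integrable_compact_support:
  fixes h :: "'a::euclidean_space \<Rightarrow> real"
  assumes "continuous_on UNIV h" "compact K" "\<And>x. x \<notin> K \<Longrightarrow> h x = 0"
  shows "integrable lebesgue h"
proof -
  have "integrable lborel (\<lambda>x. indicator K x *\<^sub>R h x)"
    by (rule borel_integrable_compact) (use assms in \<open>auto intro: continuous_on_subset\<close>)
  also have "(\<lambda>x. indicator K x *\<^sub>R h x) = h"
  proof
    show "indicator K x *\<^sub>R h x = h x" for x using assms(3)[of x] by (cases "x \<in> K") auto
  qed
  finally show ?thesis
    using assms(1) by (simp add: integrable_completion borel_measurable_continuous_onI)
qed

lemma integral_cbox_eq_lebesgue: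
  fixes h :: "'a::euclidean_space \<Rightarrow> real"
  assumes "continuous_on UNIV h" "\<And>x. x \<notin> cbox a b \<Longrightarrow> h x = 0"
  shows "integral (cbox a b) h = (LINT x|lebesgue. h x)"
proof -
  have "integrable lebesgue h"
    by (rule integrable_compact_support[OF assms(1) compact_cbox assms(2)])
  then have "(h has_integral (LINT x|lebesgue. h x)) UNIV"
    by (rule has_integral_integral_lebesgue)
  then have "(h has_integral (LINT x|lebesgue. h x)) (cbox a b)"
    by (subst has_integral_restrict_UNIV[symmetric])
       (metis (mono_tags, lifting) assms(2) has_integral_cong)
  then show ?thesis by blast
qed

section \<open>Mollification and the weak inequality for C^1 test functions\<close>

lemma mollifier_exists:
  assumes "r > 0"
  shows "\<exists>(\<eta> :: 'a::euclidean_space \<Rightarrow> real) c. bumpy c \<eta> \<and> (\<forall>x. \<eta> x \<ge> 0) \<and>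
    (\<forall>x. norm x \<ge> r \<longrightarrow> \<eta> x = 0) \<and> (LINT x|lebesgue. \<eta> x) = 1"
proof -
  let ?\<zeta> = "\<lambda>x::'a. flat 0 (r ^ 2 - x \<bullet> x)"
  have b: "bumpy (r^2) ?\<zeta>" by (rule bumpy.base)
  have z: "?\<zeta> x = 0" if "norm x \<ge> r" for x
  proof -
    have "r ^ 2 \<le> (norm x) ^ 2" using that assms by (intro power_mono) auto
    then show ?thesis by (simp add: flat_def power2_norm_eq_inner)
  qed
  have nn: "?\<zeta> x \<ge> 0" for x by (simp add: flat_def)
  obtain a where a: "cball (0::'a) r \<subseteq> cbox (- a) a"
    using bounded_subset_cbox_symmetric[OF bounded_cball] by blast
  have out: "?\<zeta> x = 0" if "x \<notin> cbox (- a) a" for x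
    using z[of x] that subsetD[OF a, of x] by (cases "norm x \<ge> r") (simp, simp add: mem_cball_0)
  let ?I = "LINT x|lebesgue. ?\<zeta> x"
  have I: "integral (cbox (-a) a) ?\<zeta> = ?I"
    by (rule integral_cbox_eq_lebesgue[OF bumpy_cont[OF b] out])
  have "?I \<ge> 0" using nn by (intro integral_nonneg_AE always_eventually) auto
  \<comment> \<open>A continuous nonnegative function with integral 0 over a box vanishes on it,
    whereas the bump equals \<open>exp (-1/r^2)\<close> at the origin.\<close>
  moreover have "?I \<noteq> 0"
  proof
    assume "?I = 0"
    have "(?\<zeta> has_integral 0) (cbox (-a) a)"
      using I \<open>?I = 0\<close> integrable_continuous[OF bumpy_cont[OF b, of "cbox (-a) a"]]
      by (metis integrable_integral)
    moreover have "ball 0 r \<subseteq> box (-a) a"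
      using interior_maximal[OF order_trans[OF ball_subset_cball a] open_ball] by simp
    then have "0 \<in> box (-a) a" using assms by (simp add: subset_iff)
    ultimately have "?\<zeta> 0 = 0"
      using has_integral_0_cbox_imp_0[OF bumpy_cont[OF b] nn, of "-a" a 0] box_subset_cbox by fastforce
    then show False using assms by (simp add: flat_def)
  qed
  ultimately have pos: "?I > 0" by simp
  show ?thesis
  proof (intro exI[of _ "\<lambda>x. inverse ?I * ?\<zeta> x"] exI[of _ "r^2"] conjI allI impI)
    show "bumpy (r^2) (\<lambda>x. inverse ?I * ?\<zeta> x)" by (rule bumpy.scale[OF b])
    show "inverse ?I * ?\<zeta> x \<ge> 0" for x using nn[of x] pos by simp
    show "inverse ?I * ?\<zeta> x = 0" if "norm x \<ge> r" for x using z[OF that] by simp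
    show "(LINT x|lebesgue. inverse ?I * ?\<zeta> x) = 1"
      using pos by (simp only: integral_mult_right_zero) simp
  qed
qed

text \<open>An average of vectors within distance \<open>C\<close> of \<open>v\<close> is itself
  within \<open>C\<close> of \<open>v\<close>. Different choices of \<open>h\<close>,
  \<open>v\<close> and \<open>C\<close> give the uniform bounds, the convergence, the control of
  supports and the continuity of the mollified gradient.\<close>

lemma mollify_bound:
  fixes h :: "'a::euclidean_space \<Rightarrow> 'b::euclidean_space"
  assumes \<eta>: "bumpy c \<eta>" "\<And>z. \<eta> z \<ge> 0" "\<And>z. norm z \<ge> r \<Longrightarrow> \<eta> z = 0" "integral Q \<eta> = 1"
    and Q: "Q = cbox a b"
    and h: "continuous_on UNIV h" and C: "\<And>z. norm z \<le> r \<Longrightarrow> norm (h (x - z) - v) \<le> C"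
  shows "norm (integral Q (\<lambda>z. \<eta> z *\<^sub>R h (x - z)) - v) \<le> C"
proof -
  have hc: "continuous_on A (\<lambda>z. h (x - z))" for A
    by (rule continuous_on_compose2[OF h]) (auto intro!: continuous_intros)
  have e: "(\<lambda>z. \<eta> z *\<^sub>R v) integrable_on Q" "(\<lambda>z. \<eta> z *\<^sub>R h (x - z)) integrable_on Q" "(\<lambda>z. \<eta> z * C) integrable_on Q"
    "(\<lambda>z. \<eta> z *\<^sub>R (h (x - z) - v)) integrable_on Q" "\<eta> integrable_on Q"
    unfolding Q by (intro integrable_continuous continuous_intros bumpy_cont[OF \<eta>(1)] hc)+
  have "integral Q (\<lambda>z. \<eta> z *\<^sub>R h (x - z)) - v = integral Q (\<lambda>z. \<eta> z *\<^sub>R h (x - z)) - integral Q (\<lambda>z. \<eta> z *\<^sub>R v)"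
    using integral_linear[OF e(5) bounded_linear_scaleR_left[of v]] \<eta>(4) by (simp add: o_def)
  also have "\<dots> = integral Q (\<lambda>z. \<eta> z *\<^sub>R (h (x - z) - v))"
    using integral_diff[OF e(2,1)] by (simp add: algebra_simps)
  finally have eq: "integral Q (\<lambda>z. \<eta> z *\<^sub>R h (x - z)) - v = integral Q (\<lambda>z. \<eta> z *\<^sub>R (h (x - z) - v))" .
  have "norm (integral Q (\<lambda>z. \<eta> z *\<^sub>R (h (x - z) - v))) \<le> integral Q (\<lambda>z. \<eta> z * C)"
  proof (rule integral_norm_bound_integral[OF e(4,3)])
    fix z assume "z \<in> Q"
    show "norm (\<eta> z *\<^sub>R (h (x - z) - v)) \<le> \<eta> z * C"
    proof (cases "norm z \<le> r")
      case True
      then show ?thesis using C[OF True] \<eta>(2)[of z] by (simp add: mult_left_mono)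
    next
      case False then show ?thesis using \<eta>(3)[of z] by simp
    qed
  qed
  also have "integral Q (\<lambda>z. \<eta> z * C) = C" using \<eta>(4) by simp
  finally show ?thesis unfolding eq .
qed

text \<open>\<open>G\<close> stands for \<open>\<nabla>u\<close> and \<open>F\<close> for \<open>f \<circ> u\<close>; a supersolution is encoded as a
  subsolution with \<open>-G\<close> and \<open>-F\<close>.\<close>

definition weak_subsol :: "'a::euclidean_space set \<Rightarrow> ('a \<Rightarrow> 'a) \<Rightarrow> ('a \<Rightarrow> real) \<Rightarrow> bool" where
  "weak_subsol \<Omega> G F \<longleftrightarrow> (\<forall>\<phi>\<in>test_functions \<Omega>. (\<forall>x. \<phi> x \<ge> 0) \<longrightarrow>
     (LINT x:\<Omega>|lebesgue. - (G x \<bullet> gradient \<phi> x) + F x * \<phi> x) \<ge> 0)"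

text \<open>The last two clauses record that values at \<open>x\<close> average values within
  distance \<open>r\<close>. With \<open>v = 0\<close> they bound the approximants uniformly, with
  \<open>v\<close> the original value at \<open>x\<close> they give pointwise convergence.\<close>

lemma mollify_C1_supp:
  fixes \<phi> :: "'a::euclidean_space \<Rightarrow> real"
  assumes \<phi>: "C1_supp K \<phi> g" and nn: "\<And>x. \<phi> x \<ge> 0" and "r > 0"
    and K': "compact K'" "\<And>x y. x \<in> K \<Longrightarrow> norm y \<le> r \<Longrightarrow> x + y \<in> K'"
  shows "\<exists>\<phi>' g'. (\<forall>k. Ck_on k UNIV \<phi>') \<and> (\<forall>x. \<phi>' x \<ge> 0) \<and> C1_supp K' \<phi>' g' \<and>
    (\<forall>x v C. (\<forall>z. norm z \<le> r \<longrightarrow> norm (g (x - z) - v) \<le> C) \<longrightarrow> norm (g' x - v) \<le> C) \<and>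
    (\<forall>x v C. (\<forall>z. norm z \<le> r \<longrightarrow> \<bar>\<phi> (x - z) - v\<bar> \<le> C) \<longrightarrow> \<bar>\<phi>' x - v\<bar> \<le> C)"
proof -
  have K: "compact K" and g: "\<And>x. GDERIV \<phi> x :> g x" "continuous_on UNIV g"
    and out: "\<And>x. x \<notin> K \<Longrightarrow> \<phi> x = 0"
    using \<phi> by (auto simp: C1_supp_def)
  note \<phi>c = C1_supp_continuous[OF \<phi>]
  obtain \<eta> :: "'a \<Rightarrow> real" and c where \<eta>: "bumpy c \<eta>" "\<And>x. \<eta> x \<ge> 0"
    "\<And>x. norm x \<ge> r \<Longrightarrow> \<eta> x = 0" "(LINT x|lebesgue. \<eta> x) = 1"
    using mollifier_exists[OF \<open>r > 0\<close>] by blast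
  obtain q where q: "cball (0::'a) r \<subseteq> cbox (-q) q"
    using bounded_subset_cbox_symmetric[OF bounded_cball] by blast
  define Q where "Q = cbox (-q) q"
  obtain a where a: "K \<subseteq> cbox (-a) a"
    using bounded_subset_cbox_symmetric[OF compact_imp_bounded[OF K]] by blast
  have \<eta>out: "\<eta> x = 0" if "x \<notin> Q" for x
    using \<eta>(3)[of x] that subsetD[OF q, of x] unfolding Q_def by (cases "norm x \<ge> r") (simp, simp add: mem_cball_0)
  have \<eta>1: "integral Q \<eta> = 1"
    unfolding Q_def \<eta>(4)[symmetric]
    by (rule integral_cbox_eq_lebesgue[OF bumpy_cont[OF \<eta>(1)]]) (rule \<eta>out[unfolded Q_def])
  define \<phi>' where "\<phi>' x = integral Q (\<lambda>z. \<eta> z * \<phi> (x - z))" for x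
  define g' where "g' x = integral Q (\<lambda>z. \<eta> z *\<^sub>R g (x - z))" for x
  \<comment> \<open>Commuting the convolution puts the bump in the moving position. This form yields
    smoothness, the original one yields the gradient \<open>g'\<close>.\<close>
  have flip: "\<phi>' x = integral (cbox (-a) a) (\<lambda>z. \<phi> z * \<eta> (x - z))" for x
  proof -
    have c1: "continuous_on UNIV (\<lambda>z. \<phi> (x - z))"
      by (rule continuous_on_compose2[OF \<phi>c]) (auto intro!: continuous_intros)
    have c2: "continuous_on UNIV (\<lambda>z. \<eta> (x - z))"
      by (rule continuous_on_compose2[OF bumpy_cont[OF \<eta>(1)]]) (auto intro!: continuous_intros)
    have c3: "continuous_on UNIV (\<lambda>z. \<phi> z * \<eta> (x - z))"
      by (intro continuous_intros \<phi>c c2)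
    have "\<phi>' x = (LINT z|lebesgue. \<eta> z * \<phi> (x - z))"
      unfolding \<phi>'_def Q_def
      by (rule integral_cbox_eq_lebesgue) (use \<eta>out in \<open>auto simp: Q_def intro!: continuous_intros bumpy_cont[OF \<eta>(1)] c1\<close>)
    also have "\<dots> = (LINT z|lebesgue. (\<lambda>z. \<phi> z * \<eta> (x - z)) (x + (-1) *\<^sub>R z))"
      by (simp add: mult.commute)
    also have "\<dots> = (LINT z|lebesgue. \<phi> z * \<eta> (x - z))"
      by (rule lebesgue_integral_affine)
         (use borel_measurable_continuous_onI[OF c3] in \<open>auto intro: measurable_completion\<close>)
    also have "\<dots> = integral (cbox (-a) a) (\<lambda>z. \<phi> z * \<eta> (x - z))"
      by (rule integral_cbox_eq_lebesgue[symmetric, OF c3]) (use out a in auto)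
    finally show ?thesis .
  qed
  show ?thesis
  proof (rule exI[of _ \<phi>'], rule exI[of _ g'], intro conjI allI impI)
    show "Ck_on k UNIV \<phi>'" for k
    proof -
      have "Ck_on k UNIV (\<lambda>x. integral (cbox (-a) a) (\<lambda>z. \<phi> z * \<eta> (x - z)))"
        by (rule conv_smooth[OF \<phi>c \<eta>(1)])
      then show ?thesis using flip by presburger
    qed
    show "\<phi>' x \<ge> 0" for x unfolding \<phi>'_def Q_def
    proof (rule integral_nonneg)
      show "(\<lambda>z. \<eta> z * \<phi> (x - z)) integrable_on cbox (- q) q"
        by (intro integrable_continuous continuous_intros bumpy_cont[OF \<eta>(1)] continuous_on_compose2[OF \<phi>c[of UNIV]]) auto
    qed (simp add: \<eta>(2) nn)
    have gd: "GDERIV \<phi>' x :> g' x" for x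
      unfolding \<phi>'_def[abs_def] g'_def Q_def by (rule conv_grad[OF bumpy_cont[OF \<eta>(1)] g])
    show grad: "norm (g' x - v) \<le> C" if "\<forall>z. norm z \<le> r \<longrightarrow> norm (g (x - z) - v) \<le> C" for x v C
      using mollify_bound[OF \<eta>(1-3) \<eta>1 Q_def g(2), where x=x and v=v and C=C] that by (simp add: g'_def)
    show fn: "\<bar>\<phi>' x - v\<bar> \<le> C" if "\<forall>z. norm z \<le> r \<longrightarrow> \<bar>\<phi> (x - z) - v\<bar> \<le> C" for x v C
      using mollify_bound[OF \<eta>(1-3) \<eta>1 Q_def \<phi>c[of UNIV], where x=x and v=v and C=C] that by (simp add: \<phi>'_def)
    show "C1_supp K' \<phi>' g'"
      unfolding C1_supp_def
    proof (intro conjI allI impI)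
      show "compact K'" by fact
      show "GDERIV \<phi>' x :> g' x" for x by (rule gd)
      show "\<phi>' x = 0" if "x \<notin> K'" for x
      proof -
        \<comment> \<open>Degenerate case \<open>v = 0\<close>, \<open>C = 0\<close> of the
          averaging bound: all averaged values vanish.\<close>
        have "\<bar>\<phi>' x - 0\<bar> \<le> 0"
        proof (rule fn, intro allI impI)
          fix z :: 'a assume "norm z \<le> r"
          have "x - z \<notin> K" using K'(2)[of "x - z" z] \<open>norm z \<le> r\<close> that by auto
          then show "\<bar>\<phi> (x - z) - 0\<bar> \<le> 0" using out by simp
        qed
        then show ?thesis by simp
      qed
      show "continuous_on UNIV g'"
        unfolding continuous_on_iff
      proof (intro ballI allI impI)
        fix x :: 'a and e :: real assume "e > 0"
        have "uniformly_continuous_on (cball x (r+1)) g"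
          by (rule compact_uniformly_continuous[OF continuous_on_subset[OF g(2)]]) auto
        then obtain d where d: "d > 0" "\<And>y z. y \<in> cball x (r+1) \<Longrightarrow> z \<in> cball x (r+1) \<Longrightarrow> dist z y < d \<Longrightarrow> dist (g z) (g y) < e/2"
          unfolding uniformly_continuous_on_def using half_gt_zero[OF \<open>e > 0\<close>] by blast
        have "dist (g' y) (g' x) < e" if y: "dist y x < min d 1" for y
        proof -
          have gi: "(\<lambda>z. \<eta> z *\<^sub>R g (w - z)) integrable_on Q" for w
            unfolding Q_def by (intro integrable_continuous continuous_intros bumpy_cont[OF \<eta>(1)] continuous_on_compose2[OF g(2)]) auto
          have "integral Q (\<lambda>z. \<eta> z *\<^sub>R (g ((y - z)) - g (x - z))) = g' y - g' x"
            unfolding g'_def using integral_diff[OF gi gi, of y x] by (simp add: algebra_simps)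
          \<comment> \<open>The averaging bound for the difference between \<open>g\<close> and its
            translate, which is small by uniform continuity on the ball of radius
            \<open>r + 1\<close>.\<close>
          moreover have "norm (integral Q (\<lambda>z. \<eta> z *\<^sub>R (\<lambda>w. g (w + (y - x)) - g w) (x - z)) - 0) \<le> e/2"
          proof (rule mollify_bound[OF \<eta>(1-3) \<eta>1 Q_def])
            show "continuous_on UNIV (\<lambda>w. g (w + (y - x)) - g w)"
              by (intro continuous_intros g(2) continuous_on_compose2[OF g(2)]) auto
            fix z :: 'a assume z: "norm z \<le> r"
            have "norm (y - x) < min d 1" using y by (simp add: dist_norm)
            moreover have "norm (x - (x - z + (y - x))) \<le> norm z + norm (y - x)"
              using norm_triangle_ineq4[of z "y - x"] by (simp add: algebra_simps)
            ultimately have "dist (g (x - z + (y - x))) (g (x - z)) < e/2"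
              using z by (intro d(2)) (auto simp: dist_norm)
            then show "norm (g (x - z + (y - x)) - g (x - z) - 0) \<le> e/2" by (simp add: dist_norm)
          qed
          moreover have "(\<lambda>z. \<eta> z *\<^sub>R (\<lambda>w. g (w + (y - x)) - g w) (x - z)) = (\<lambda>z. \<eta> z *\<^sub>R (g (y - z) - g (x - z)))"
            by (rule ext) simp
          ultimately have "norm (g' y - g' x) \<le> e/2" by simp
          then show ?thesis using \<open>e > 0\<close> by (simp add: dist_norm)
        qed
        then show "\<exists>d>0. \<forall>x'\<in>UNIV. dist x' x < d \<longrightarrow> dist (g' x') (g' x) < e"
          using d(1) by (intro exI[of _ "min d 1"]) auto
      qed
    qed
  qed
qed

text \<open>Mollification at radii tending to zero: the supports stay in one compact
  \<open>K'\<close>, and functions and gradients are bounded uniformly, so the limit can be taken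
  although \<open>F\<close> is only locally integrable.\<close>

lemma weak_subsol_C1:
  fixes \<phi> :: "'a::euclidean_space \<Rightarrow> real"
  assumes "open \<Omega>" and G: "continuous_on \<Omega> G"
    and F: "\<And>K. compact K \<Longrightarrow> K \<subseteq> \<Omega> \<Longrightarrow> set_integrable lebesgue K F"
    and W: "weak_subsol \<Omega> G F"
    and \<phi>: "C1_supp K \<phi> g" "K \<subseteq> \<Omega>" and nn: "\<And>x. \<phi> x \<ge> 0"
  shows "0 \<le> (LINT x|lebesgue. - (G x \<bullet> g x) + F x * \<phi> x)"
proof -
  have K: "compact K" and g: "\<And>x. GDERIV \<phi> x :> g x" "continuous_on UNIV g"
    and out: "\<And>x. x \<notin> K \<Longrightarrow> \<phi> x = 0"
    using \<phi> by (auto simp: C1_supp_def)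
  note \<phi>c = C1_supp_continuous[OF \<phi>(1)]
  obtain r K' where r: "r > 0" "compact K'" "K' \<subseteq> \<Omega>" "\<And>x y. x \<in> K \<Longrightarrow> norm y \<le> r \<Longrightarrow> x + y \<in> K'" "K \<subseteq> K'"
    using compact_thicken[OF K assms(1) \<phi>(2)] by blast
  define rn where "rn n = r / real (Suc n)" for n
  have rn: "rn n > 0" "rn n \<le> r" for n using r(1) by (auto simp: rn_def field_simps)
  have "\<exists>\<phi>' g'. (\<forall>k. Ck_on k UNIV \<phi>') \<and> (\<forall>x. \<phi>' x \<ge> 0) \<and> C1_supp K' \<phi>' g' \<and>
    (\<forall>x v C. (\<forall>z. norm z \<le> rn n \<longrightarrow> norm (g (x - z) - v) \<le> C) \<longrightarrow> norm (g' x - v) \<le> C) \<and>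
    (\<forall>x v C. (\<forall>z. norm z \<le> rn n \<longrightarrow> \<bar>\<phi> (x - z) - v\<bar> \<le> C) \<longrightarrow> \<bar>\<phi>' x - v\<bar> \<le> C)" for n
  proof -
    have "x + y \<in> K'" if "x \<in> K" "norm y \<le> rn n" for x y
      using r(4)[OF that(1), of y] that(2) rn(2)[of n] by linarith
    then show ?thesis by (rule mollify_C1_supp[OF \<phi>(1) nn rn(1) r(2)])
  qed
  from choice[OF allI[OF this]] obtain \<phi>' where "\<forall>n. \<exists>g'. (\<forall>k. Ck_on k UNIV (\<phi>' n)) \<and> (\<forall>x. \<phi>' n x \<ge> 0) \<and> C1_supp K' (\<phi>' n) g' \<and>
    (\<forall>x v C. (\<forall>z. norm z \<le> rn n \<longrightarrow> norm (g (x - z) - v) \<le> C) \<longrightarrow> norm (g' x - v) \<le> C) \<and>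
    (\<forall>x v C. (\<forall>z. norm z \<le> rn n \<longrightarrow> \<bar>\<phi> (x - z) - v\<bar> \<le> C) \<longrightarrow> \<bar>\<phi>' n x - v\<bar> \<le> C)" ..
  from choice[OF this] obtain g' where R: "\<forall>n. (\<forall>k. Ck_on k UNIV (\<phi>' n)) \<and> (\<forall>x. \<phi>' n x \<ge> 0) \<and> C1_supp K' (\<phi>' n) (g' n) \<and>
    (\<forall>x v C. (\<forall>z. norm z \<le> rn n \<longrightarrow> norm (g (x - z) - v) \<le> C) \<longrightarrow> norm (g' n x - v) \<le> C) \<and>
    (\<forall>x v C. (\<forall>z. norm z \<le> rn n \<longrightarrow> \<bar>\<phi> (x - z) - v\<bar> \<le> C) \<longrightarrow> \<bar>\<phi>' n x - v\<bar> \<le> C)" ..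
  have m: "\<And>n k. Ck_on k UNIV (\<phi>' n)" "\<And>n x. \<phi>' n x \<ge> 0" "\<And>n. C1_supp K' (\<phi>' n) (g' n)"
    using R by simp_all
  have mg: "norm (g' n x - v) \<le> C" if "\<And>z. norm z \<le> rn n \<Longrightarrow> norm (g (x - z) - v) \<le> C" for n x v C
    using spec[OF R, of n] that by blast
  have mf: "\<bar>\<phi>' n x - v\<bar> \<le> C" if "\<And>z. norm z \<le> rn n \<Longrightarrow> \<bar>\<phi> (x - z) - v\<bar> \<le> C" for n x v C
    using spec[OF R, of n] that by blast
  obtain Cg where "Cg \<ge> 0" "\<And>x. x \<in> K \<Longrightarrow> norm (g x) \<le> Cg"
    using bounded_on_compact[OF K continuous_on_subset[OF g(2)]] by blast
  then have Cg: "norm (g x) \<le> Cg" "Cg \<ge> 0" for x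
    using C1_supp_grad_zero[OF \<phi>(1), of x] by (cases "x \<in> K"; simp)+
  obtain Cf where "Cf \<ge> 0" "\<And>x. x \<in> K \<Longrightarrow> norm (\<phi> x) \<le> Cf"
    using bounded_on_compact[OF K \<phi>c] by blast
  then have Cf: "\<bar>\<phi> x\<bar> \<le> Cf" "Cf \<ge> 0" for x
    using out[of x] by (cases "x \<in> K"; simp)+
  obtain CG where CG: "CG \<ge> 0" "\<And>x. x \<in> K' \<Longrightarrow> norm (G x) \<le> CG"
    using bounded_on_compact[OF r(2) continuous_on_subset[OF G r(3)]] by blast
  show ?thesis
  proof (rule nonneg_integral_limit[where s="\<lambda>n x. - (G x \<bullet> g' n x) + F x * \<phi>' n x" and C="CG * Cg + Cf", OF r(2) F[OF r(2,3)]])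
    show "(\<lambda>x. - (G x \<bullet> g' n x) + F x * \<phi>' n x) \<in> borel_measurable lebesgue" for n
    proof -
      have "continuous_on UNIV (g' n)" using m(3)[of n] by (simp add: C1_supp_def)
      then have "(\<lambda>x. indicator K' x *\<^sub>R (- (G x \<bullet> g' n x))) \<in> borel_measurable lebesgue"
        by (intro lebesgue_measurable_on_compact r(2) continuous_intros continuous_on_subset[OF G r(3)])
           (auto intro: continuous_on_subset)
      moreover have "(\<lambda>x. (indicator K' x *\<^sub>R F x) * \<phi>' n x) \<in> borel_measurable lebesgue"
      proof (rule borel_measurable_times)
        show "(\<lambda>x. indicator K' x *\<^sub>R F x) \<in> borel_measurable lebesgue"
          using F[OF r(2,3)] unfolding set_integrable_def by (rule borel_measurable_integrable)
        show "\<phi>' n \<in> borel_measurable lebesgue"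
          using borel_measurable_continuous_onI[OF C1_supp_continuous[OF m(3)]]
          by (simp add: measurable_completion)
      qed
      ultimately have "(\<lambda>x. indicator K' x *\<^sub>R (- (G x \<bullet> g' n x)) + (indicator K' x *\<^sub>R F x) * \<phi>' n x) \<in> borel_measurable lebesgue"
        by (rule borel_measurable_add)
      also have "(\<lambda>x. indicator K' x *\<^sub>R (- (G x \<bullet> g' n x)) + (indicator K' x *\<^sub>R F x) * \<phi>' n x) = (\<lambda>x. - (G x \<bullet> g' n x) + F x * \<phi>' n x)"
      proof
        show "indicator K' x *\<^sub>R (- (G x \<bullet> g' n x)) + (indicator K' x *\<^sub>R F x) * \<phi>' n x = - (G x \<bullet> g' n x) + F x * \<phi>' n x" for x
          using C1_supp_grad_zero[OF m(3), of x n] m(3)[of n] by (cases "x \<in> K'") (auto simp: C1_supp_def)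
      qed
      finally show ?thesis .
    qed
    have b1: "norm (g' n x) \<le> Cg" for n x using mg[of n x 0 Cg] Cg by simp
    have b2: "\<bar>\<phi>' n x\<bar> \<le> Cf" for n x using mf[of n x 0 Cf] Cf by simp
    show "\<bar>- (G x \<bullet> g' n x) + F x * \<phi>' n x\<bar> \<le> (CG * Cg + Cf) * (1 + \<bar>F x\<bar>)" if "x \<in> K'" for n x
    proof -
      have "\<bar>G x \<bullet> g' n x\<bar> \<le> CG * Cg"
        by (rule order_trans[OF Cauchy_Schwarz_ineq2]) (intro mult_mono CG that b1 norm_ge_zero)
      moreover have "\<bar>F x * \<phi>' n x\<bar> \<le> \<bar>F x\<bar> * Cf" unfolding abs_mult by (intro mult_left_mono b2) simp
      moreover have "0 \<le> CG * Cg * \<bar>F x\<bar>" using CG(1) Cg(2) by simp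
      moreover have "(CG * Cg + Cf) * (1 + \<bar>F x\<bar>) = CG * Cg + Cf + CG * Cg * \<bar>F x\<bar> + \<bar>F x\<bar> * Cf" by (simp add: algebra_simps)
      ultimately show ?thesis using Cf(2) by linarith
    qed
    show "- (G x \<bullet> g' n x) + F x * \<phi>' n x = 0" if "x \<notin> K'" for n x
      using C1_supp_grad_zero[OF m(3) that] m(3)[of n] that by (simp add: C1_supp_def)
    have rn0: "rn \<longlonglongrightarrow> 0" unfolding rn_def
      using tendsto_mult_right_zero[OF LIMSEQ_inverse_real_of_nat, of r] by (simp add: divide_inverse)
    show "(\<lambda>n. - (G x \<bullet> g' n x) + F x * \<phi>' n x) \<longlonglongrightarrow> - (G x \<bullet> g x) + F x * \<phi> x" for x
    proof (intro tendsto_intros)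
      show "(\<lambda>n. g' n x) \<longlonglongrightarrow> g x"
      proof (rule metric_LIMSEQ_I)
        fix e :: real assume "e > 0"
        then have "\<exists>d>0. \<forall>y. dist y x < d \<longrightarrow> dist (g y) (g x) < e/2"
          using g(2) unfolding continuous_on_iff using half_gt_zero[OF \<open>e > 0\<close>] by blast
        then obtain d where d: "d > 0" "\<And>y. dist y x < d \<Longrightarrow> dist (g y) (g x) < e/2"
          by auto
        obtain N where N: "\<And>n. n \<ge> N \<Longrightarrow> rn n < d"
          using order_tendstoD(2)[OF rn0 d(1)] by (auto simp: eventually_sequentially)
        have "norm (g' n x - g x) \<le> e/2" if "n \<ge> N" for n
        proof (rule mg)
          fix z :: 'a assume "norm z \<le> rn n"
          then have "dist (x - z) x < d" using N[OF that] by (simp add: dist_norm)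
          from d(2)[OF this] show "norm (g (x - z) - g x) \<le> e/2" by (simp add: dist_norm)
        qed
        then show "\<exists>N. \<forall>n\<ge>N. dist (g' n x) (g x) < e"
          using \<open>e > 0\<close> by (intro exI[of _ N]) (force simp: dist_norm)
      qed
      show "(\<lambda>n. \<phi>' n x) \<longlonglongrightarrow> \<phi> x"
      proof (rule metric_LIMSEQ_I)
        fix e :: real assume "e > 0"
        then have "\<exists>d>0. \<forall>y. dist y x < d \<longrightarrow> dist (\<phi> y) (\<phi> x) < e/2"
          using \<phi>c[of UNIV] unfolding continuous_on_iff using half_gt_zero[OF \<open>e > 0\<close>] by blast
        then obtain d where d: "d > 0" "\<And>y. dist y x < d \<Longrightarrow> dist (\<phi> y) (\<phi> x) < e/2"
          by auto
        obtain N where N: "\<And>n. n \<ge> N \<Longrightarrow> rn n < d"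
          using order_tendstoD(2)[OF rn0 d(1)] by (auto simp: eventually_sequentially)
        have "\<bar>\<phi>' n x - \<phi> x\<bar> \<le> e/2" if "n \<ge> N" for n
        proof (rule mf)
          fix z :: 'a assume "norm z \<le> rn n"
          then have "dist (x - z) x < d" using N[OF that] by (simp add: dist_norm)
          from d(2)[OF this] show "\<bar>\<phi> (x - z) - \<phi> x\<bar> \<le> e/2" by (simp add: dist_norm)
        qed
        then show "\<exists>N. \<forall>n\<ge>N. dist (\<phi>' n x) (\<phi> x) < e"
          using \<open>e > 0\<close> by (intro exI[of _ N]) (force simp: dist_norm)
      qed
    qed
    show "0 \<le> (LINT x|lebesgue. - (G x \<bullet> g' n x) + F x * \<phi>' n x)" for n
    proof -
      have o: "\<phi>' n x = 0" if "x \<notin> K'" for x using m(3)[of n] that by (simp add: C1_supp_def)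
      have cl: "closure {x. \<phi>' n x \<noteq> 0} \<subseteq> K'"
        by (rule closure_minimal) (use o compact_imp_closed[OF r(2)] in auto)
      then have "compact (closure {x. \<phi>' n x \<noteq> 0})"
        using bounded_subset[OF compact_imp_bounded[OF r(2)] cl] by (simp add: compact_eq_bounded_closed)
      then have "\<phi>' n \<in> test_functions \<Omega>"
        unfolding test_functions_def using m(1) order_trans[OF cl r(3)] by simp
      then have "0 \<le> (LINT x:\<Omega>|lebesgue. - (G x \<bullet> gradient (\<phi>' n) x) + F x * \<phi>' n x)"
        using W m(2) unfolding weak_subsol_def by blast
      also have "\<dots> = (LINT x|lebesgue. - (G x \<bullet> g' n x) + F x * \<phi>' n x)"
        unfolding set_lebesgue_integral_def
      proof (rule Bochner_Integration.integral_cong[OF refl])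
        fix x
        have "gradient (\<phi>' n) x = g' n x" using m(3)[of n] by (auto simp: C1_supp_def intro: gradient_eq)
        then show "indicat_real \<Omega> x *\<^sub>R (- (G x \<bullet> gradient (\<phi>' n) x) + F x * \<phi>' n x) = - (G x \<bullet> g' n x) + F x * \<phi>' n x"
          using o[of x] C1_supp_grad_zero[OF m(3), of x n] r(3) by (cases "x \<in> K'") auto
      qed
      finally show ?thesis .
    qed
  qed
qed

section \<open>Testing with a directional derivative of the solution\<close>

lemma integrable_extend_zero:
  fixes f :: "'a::euclidean_space \<Rightarrow> real"
  assumes "open S" "continuous_on S f" "compact K" "K \<subseteq> S" "\<And>x. x \<notin> K \<Longrightarrow> f x = 0"
  shows "integrable lebesgue f"
  using integrable_compact_support[OF continuous_on_extend_zero[OF assms] assms(3,5)] by simp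

lemma integrable_mult_compact_support:
  fixes \<phi> :: "'a::euclidean_space \<Rightarrow> real"
  assumes F: "set_integrable lebesgue K F" and K: "compact K"
    and \<phi>: "continuous_on UNIV \<phi>" "\<And>x. x \<notin> K \<Longrightarrow> \<phi> x = 0"
  shows "integrable lebesgue (\<lambda>x. F x * \<phi> x)"
proof -
  obtain C where C: "C \<ge> 0" "\<And>x. x \<in> K \<Longrightarrow> norm (\<phi> x) \<le> C"
    using bounded_on_compact[OF K continuous_on_subset[OF \<phi>(1)]] by blast
  have FK: "integrable lebesgue (\<lambda>x. indicator K x *\<^sub>R F x)" using F by (simp add: set_integrable_def)
  have eq: "(\<lambda>x. (indicator K x *\<^sub>R F x) * \<phi> x) = (\<lambda>x. F x * \<phi> x)"
  proof
    show "(indicator K x *\<^sub>R F x) * \<phi> x = F x * \<phi> x" for x using \<phi>(2)[of x] by (cases "x \<in> K") auto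
  qed
  have "integrable lebesgue (\<lambda>x. (indicator K x *\<^sub>R F x) * \<phi> x)"
  proof (rule Bochner_Integration.integrable_bound)
    show "integrable lebesgue (\<lambda>x. C * (indicator K x *\<^sub>R F x))" by (rule integrable_mult_right[OF FK])
    show "(\<lambda>x. (indicator K x *\<^sub>R F x) * \<phi> x) \<in> borel_measurable lebesgue"
      using borel_measurable_continuous_onI[OF \<phi>(1)]
      by (intro borel_measurable_times borel_measurable_integrable[OF FK]) (simp add: measurable_completion)
    show "AE x in lebesgue. norm (indicat_real K x *\<^sub>R F x * \<phi> x) \<le> norm (C * (indicat_real K x *\<^sub>R F x))"
    proof (intro always_eventually allI)
      fix x show "norm (indicat_real K x *\<^sub>R F x * \<phi> x) \<le> norm (C * (indicat_real K x *\<^sub>R F x))"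
        using mult_left_mono[OF C(2)[of x], of "\<bar>F x\<bar>"] C(1)
        by (cases "x \<in> K") (auto simp: abs_mult mult.commute)
    qed
  qed
  then show ?thesis unfolding eq .
qed

lemma difference_quotient:
  fixes u :: "'a::euclidean_space \<Rightarrow> real"
  assumes "h > 0" and D: "\<And>t. 0 \<le> t \<Longrightarrow> t \<le> h \<Longrightarrow> GDERIV u (x + t *\<^sub>R e) :> g (x + t *\<^sub>R e)"
  shows "\<exists>t. 0 < t \<and> t < h \<and> (u (x + h *\<^sub>R e) - u x) / h = e \<bullet> g (x + t *\<^sub>R e)"
proof -
  have "((\<lambda>t. u (x + t *\<^sub>R e)) has_real_derivative e \<bullet> g (x + t *\<^sub>R e)) (at t)" if "0 \<le> t" "t \<le> h" for t
  proof -
    have "((\<lambda>t. x + t *\<^sub>R e) has_derivative (\<lambda>s. s *\<^sub>R e)) (at t)"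
      by (auto intro!: derivative_eq_intros)
    from has_derivative_compose[OF this D[OF that, unfolded gderiv_def]]
    moreover have "(\<lambda>s. (s *\<^sub>R e) \<bullet> g (x + t *\<^sub>R e)) = (*) (e \<bullet> g (x + t *\<^sub>R e))"
      by (simp add: fun_eq_iff mult.commute)
    ultimately show ?thesis unfolding has_field_derivative_def by simp
  qed
  from MVT2[OF \<open>h > 0\<close> this] obtain t where "0 < t" "t < h" "u (x + h *\<^sub>R e) - u x = h * (e \<bullet> g (x + t *\<^sub>R e))"
    by auto
  then show ?thesis using \<open>h > 0\<close> by (intro exI[of _ t]) auto
qed

lemma difference_quotient_tendsto:
  fixes u :: "'a::euclidean_space \<Rightarrow> real"
  assumes D: "GDERIV u x :> g" and h: "h \<longlonglongrightarrow> 0" "\<And>n. h n \<noteq> 0"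
  shows "(\<lambda>n. (u (x + h n *\<^sub>R v) - u x) / h n) \<longlonglongrightarrow> g \<bullet> v"
proof -
  have 1: "((\<lambda>t. x + t *\<^sub>R v) has_derivative (\<lambda>s. s *\<^sub>R v)) (at 0)"
    by (auto intro!: derivative_eq_intros)
  have 2: "(u has_derivative (\<lambda>h. h \<bullet> g)) (at (x + 0 *\<^sub>R v))" using D by (simp add: gderiv_def)
  have 3: "(\<lambda>s. (s *\<^sub>R v) \<bullet> g) = (*) (g \<bullet> v)" by (simp add: fun_eq_iff mult.commute inner_commute)
  have "((\<lambda>t. u (x + t *\<^sub>R v)) has_real_derivative g \<bullet> v) (at 0)"
    using has_derivative_compose[OF 1 2] unfolding 3 has_field_derivative_def .
  then have "((\<lambda>t. (u (x + t *\<^sub>R v) - u x) / t) \<longlongrightarrow> g \<bullet> v) (at 0)"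
    by (simp add: DERIV_def)
  moreover have "filterlim h (at 0) sequentially"
    using h by (simp add: filterlim_at)
  ultimately show ?thesis by (rule filterlim_compose)
qed

lemma C1_supp_difference_quotient_bound:
  assumes p: "C1_supp K p g" and C: "\<And>x. norm (g x) \<le> C" and "norm v = 1" "h > 0"
  shows "\<bar>(p (x + h *\<^sub>R v) - p x) / h\<bar> \<le> C"
proof -
  obtain t where "(p (x + h *\<^sub>R v) - p x) / h = v \<bullet> g (x + t *\<^sub>R v)"
    using difference_quotient[OF \<open>h > 0\<close>, of p x v g] p by (auto simp: C1_supp_def)
  then show ?thesis
    using Cauchy_Schwarz_ineq2[of v "g (x + t *\<^sub>R v)"] C[of "x + t *\<^sub>R v"] assms(3) by simp
qed

text \<open>The test function is \<open>\<psi>\<close> times the \<^emph>\<open>backward\<close> difference quotient of \<open>U\<close>: with this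
  choice the second order error \<open>|G(x) - G(x - h e)|\<^sup>2\<close> has the favourable sign.\<close>

lemma noether_step:
  fixes U :: "'a::euclidean_space \<Rightarrow> real"
  assumes B: "open B" and U: "\<And>x. x \<in> B \<Longrightarrow> GDERIV U x :> G x" and G: "continuous_on B G"
    and F: "\<And>K. compact K \<Longrightarrow> K \<subseteq> B \<Longrightarrow> set_integrable lebesgue K F"
    and W: "weak_subsol B G F"
    and \<psi>: "C1_supp K \<psi> g" and nn: "\<And>x. \<psi> x \<ge> 0"
    and K': "compact K'" "K' \<subseteq> B" "K \<subseteq> K'" "\<And>x. x \<in> K \<Longrightarrow> x - h *\<^sub>R e \<in> K'"
    and h: "h > 0" and \<delta>: "\<And>x. \<delta> x = (U x - U (x - h *\<^sub>R e)) / h" "\<And>x. x \<in> K \<Longrightarrow> \<delta> x \<ge> 0"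
  defines "I \<equiv> \<lambda>x. - (\<delta> x * (G x \<bullet> g x)) + (norm (G x))\<^sup>2 / 2 * ((\<psi> (x + h *\<^sub>R e) - \<psi> x) / h)
            + F x * (\<delta> x * \<psi> x)"
  shows "0 \<le> (LINT x|lebesgue. I x)" and "I \<in> borel_measurable lebesgue"
proof -
  have K: "compact K" and g: "\<And>x. GDERIV \<psi> x :> g x" "continuous_on UNIV g"
    and out: "\<And>x. x \<notin> K \<Longrightarrow> \<psi> x = 0"
    using \<psi> by (auto simp: C1_supp_def)
  note gout = C1_supp_grad_zero[OF \<psi>] and \<psi>c = C1_supp_continuous[OF \<psi>]
  define S where "S = B \<inter> (\<lambda>x. x - h *\<^sub>R e) -` B"
  have S: "open S" unfolding S_def using B
    by (intro open_Int open_vimage) (auto intro!: continuous_intros)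
  have KS: "K \<subseteq> S" unfolding S_def using K' by auto
  have Gs: "continuous_on S G" "continuous_on S (\<lambda>x. G (x - h *\<^sub>R e))"
    unfolding S_def by (auto intro: continuous_on_subset[OF G] intro!: continuous_on_compose2[OF G] continuous_intros)
  have Uc: "continuous_on B U"
    by (rule GDERIV_continuous_on[OF U])
  have \<delta>c: "continuous_on S \<delta>"
    unfolding \<delta>(1) S_def
    by (intro continuous_intros continuous_on_compose2[OF Uc]) (use h in auto)
  define gp where "gp x = \<delta> x *\<^sub>R g x + (\<psi> x / h) *\<^sub>R (G x - G (x - h *\<^sub>R e))" for x
  have \<phi>: "C1_supp K (\<lambda>x. \<delta> x * \<psi> x) gp"
  proof (rule C1_supp_extend[OF S K KS])
    fix x assume "x \<in> S"
    then have x: "x \<in> B" "x - h *\<^sub>R e \<in> B" by (auto simp: S_def)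
    have "((\<lambda>x. U (x - h *\<^sub>R e)) has_derivative (\<lambda>k. k \<bullet> G (x - h *\<^sub>R e))) (at x)"
      by (rule has_derivative_compose[of "\<lambda>x. x - h *\<^sub>R e" "\<lambda>h. h" x UNIV U "\<lambda>k. k \<bullet> G (x - h *\<^sub>R e)"])
         (auto intro!: derivative_eq_intros U[OF x(2), unfolded gderiv_def])
    then show "GDERIV (\<lambda>x. \<delta> x * \<psi> x) x :> gp x"
      unfolding \<delta>(1) gderiv_def gp_def
      using h by (auto intro!: derivative_eq_intros U[OF x(1), unfolded gderiv_def] g(1)[unfolded gderiv_def]
          simp: inner_add_right inner_diff_right field_simps)
  next
    show "continuous_on S gp" unfolding gp_def
      by (intro continuous_intros \<delta>c Gs \<psi>c continuous_on_subset[OF g(2)]) (use h in auto)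
  qed (use out gout in \<open>auto simp: gp_def\<close>)
  have w: "0 \<le> (LINT x|lebesgue. - (G x \<bullet> gp x) + F x * (\<delta> x * \<psi> x))"
  proof (rule weak_subsol_C1[OF B G F W \<phi> order_trans[OF K'(3,2)]])
    show "\<delta> x * \<psi> x \<ge> 0" for x
      using \<delta>(2)[of x] nn[of x] out[of x] by (cases "x \<in> K") auto
  qed
  define p where "p x = (norm (G x))\<^sup>2 * \<psi> (x + h *\<^sub>R e)" for x
  have pout: "p x = 0" if "x \<notin> K'" for x
  proof -
    have "x + h *\<^sub>R e \<notin> K" using K'(4)[of "x + h *\<^sub>R e"] that by auto
    then show ?thesis by (simp add: p_def out)
  qed
  have pB: "continuous_on B p" unfolding p_def
    by (intro continuous_intros G continuous_on_compose2[OF \<psi>c[of UNIV]]) auto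
  have pc: "continuous_on UNIV p" by (rule continuous_on_extend_zero[OF B pB K'(1,2) pout])
  have pi: "integrable lebesgue p" by (rule integrable_extend_zero[OF B pB K'(1,2) pout])
  have pm: "p \<in> borel_measurable lebesgue" by (rule borel_measurable_integrable[OF pi])
  \<comment> \<open>Discrete integration by parts: translating by \<open>h e\<close> moves the
    difference from \<open>|G|^2\<close> onto \<open>\<psi>\<close>, whose quotient converges as
    \<open>h\<close> tends to 0.\<close>
  have shift: "(LINT x|lebesgue. p (x - h *\<^sub>R e)) = (LINT x|lebesgue. p x)"
    using lebesgue_integral_affine[OF pm, of 1 "- h *\<^sub>R e"] by (simp add: algebra_simps)
  have psi: "integrable lebesgue (\<lambda>x. p (x - h *\<^sub>R e))"
  proof (rule integrable_extend_zero[OF S _ K KS])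
    show "continuous_on S (\<lambda>x. p (x - h *\<^sub>R e))"
      by (rule continuous_on_compose2[OF pc]) (auto intro!: continuous_intros)
    show "p (x - h *\<^sub>R e) = 0" if "x \<notin> K" for x using out[OF that] by (simp add: p_def)
  qed
  define q where "q x = (norm (G x))\<^sup>2 * \<psi> x" for x
  have qi: "integrable lebesgue q"
    by (rule integrable_extend_zero[OF B _ K order_trans[OF K'(3,2)]])
       (auto simp: q_def out intro!: continuous_intros G \<psi>c)
  have Xi: "integrable lebesgue (\<lambda>x. \<delta> x * (G x \<bullet> g x))"
    by (rule integrable_extend_zero[OF S _ K KS])
       (auto simp: gout intro!: continuous_intros Gs \<delta>c continuous_on_subset[OF g(2)])
  have Li: "integrable lebesgue (\<lambda>x. G x \<bullet> gp x)"
  proof (rule integrable_extend_zero[OF S _ K KS])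
    show "continuous_on S (\<lambda>x. G x \<bullet> gp x)" using \<phi>
      by (intro continuous_intros Gs continuous_on_subset[of UNIV gp S]) (auto simp: C1_supp_def)
  qed (simp add: C1_supp_grad_zero[OF \<phi>])
  have Yi: "integrable lebesgue (\<lambda>x. F x * (\<delta> x * \<psi> x))"
    by (rule integrable_mult_compact_support[OF F[OF K order_trans[OF K'(3,2)]] K])
       (auto simp: out C1_supp_continuous[OF \<phi>])
  have eq: "I =
       (\<lambda>x. - (\<delta> x * (G x \<bullet> g x)) + (1 / (2*h)) * (p x - q x) + F x * (\<delta> x * \<psi> x))"
    using h by (auto simp: I_def p_def q_def field_simps)
  show "I \<in> borel_measurable lebesgue"
    unfolding eq by (intro borel_measurable_integrable Bochner_Integration.integrable_add Bochner_Integration.integrable_diff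
        Bochner_Integration.integrable_minus integrable_mult_right Xi pi qi Yi)
  have "0 \<le> (LINT x|lebesgue. - (G x \<bullet> gp x) + F x * (\<delta> x * \<psi> x))" by (rule w)
  also have "\<dots> \<le> (LINT x|lebesgue. - (\<delta> x * (G x \<bullet> g x)) + (1 / (2*h)) * (p (x - h *\<^sub>R e) - q x) + F x * (\<delta> x * \<psi> x))"
  proof (rule integral_mono)
    fix x
    \<comment> \<open>This is \<open>|G(x) - G(x - h e)|^2 \<ge> 0\<close>. It replaces the product
      of \<open>G\<close> with its increment by the increment of \<open>|G|^2 / 2\<close>, to which
      the translation applies.\<close>
    have "(norm (G x))\<^sup>2 - (norm (G (x - h *\<^sub>R e)))\<^sup>2 \<le> 2 * (G x \<bullet> (G x - G (x - h *\<^sub>R e)))"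
      using zero_le_power2[of "norm (G x - G (x - h *\<^sub>R e))"]
      by (simp add: power2_norm_eq_inner inner_diff_left inner_diff_right inner_commute)
    then have le: "(\<psi> x / (2*h)) * ((norm (G x))\<^sup>2 - (norm (G (x - h *\<^sub>R e)))\<^sup>2) \<le> (\<psi> x / (2*h)) * (2 * (G x \<bullet> (G x - G (x - h *\<^sub>R e))))"
      using nn[of x] h by (intro mult_left_mono) auto
    show "- (G x \<bullet> gp x) + F x * (\<delta> x * \<psi> x) \<le> - (\<delta> x * (G x \<bullet> g x)) + (1 / (2*h)) * (p (x - h *\<^sub>R e) - q x) + F x * (\<delta> x * \<psi> x)"
    proof -
      have "G x \<bullet> gp x = \<delta> x * (G x \<bullet> g x) + (\<psi> x / h) * (G x \<bullet> (G x - G (x - h *\<^sub>R e)))"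
        by (simp add: gp_def inner_add_right)
      moreover have "(1 / (2*h)) * (p (x - h *\<^sub>R e) - q x) = - ((\<psi> x / (2*h)) * ((norm (G x))\<^sup>2 - (norm (G (x - h *\<^sub>R e)))\<^sup>2))"
      proof -
        have "(1 / (2*h)) * (A * \<psi> x - B * \<psi> x) = - ((\<psi> x / (2*h)) * (B - A))" for A B :: real
          using h by (simp add: field_simps)
        then show ?thesis unfolding p_def q_def diff_add_cancel .
      qed
      moreover have "(\<psi> x / (2*h)) * (2 * (G x \<bullet> (G x - G (x - h *\<^sub>R e)))) = (\<psi> x / h) * (G x \<bullet> (G x - G (x - h *\<^sub>R e)))"
        by simp
      ultimately show ?thesis using le by linarith
    qed
  qed (intro Bochner_Integration.integrable_add Bochner_Integration.integrable_diff
        Bochner_Integration.integrable_minus integrable_mult_right Xi psi qi Yi Li)+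
  also have "\<dots> = - (LINT x|lebesgue. \<delta> x * (G x \<bullet> g x)) + (1 / (2*h)) * ((LINT x|lebesgue. p (x - h *\<^sub>R e)) - (LINT x|lebesgue. q x))
       + (LINT x|lebesgue. F x * (\<delta> x * \<psi> x))"
    by (simp add: Bochner_Integration.integral_add Bochner_Integration.integral_diff Xi psi qi Yi
        Bochner_Integration.integrable_add Bochner_Integration.integrable_diff
        Bochner_Integration.integrable_minus integrable_mult_right del: integral_mult_right_zero add: integral_mult_right)
  also have "\<dots> = (LINT x|lebesgue. - (\<delta> x * (G x \<bullet> g x)) + (1 / (2*h)) * (p x - q x) + F x * (\<delta> x * \<psi> x))"
    unfolding shift
    by (simp add: Bochner_Integration.integral_add Bochner_Integration.integral_diff Xi pi qi Yi
        Bochner_Integration.integrable_add Bochner_Integration.integrable_diff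
        Bochner_Integration.integrable_minus integrable_mult_right)
  finally show "0 \<le> (LINT x|lebesgue. I x)"
    unfolding eq .
qed

text \<open>Formally the test function is \<open>\<psi> \<partial>_e U\<close>, and \<open>G
  \<bullet> \<nabla>(\<partial>_e U) = \<partial>_e (|G|^2 / 2)\<close> is integrated by parts, so
  that no second derivative of \<open>U\<close> remains. The sign of \<open>G x \<bullet> e\<close>
  makes the test function nonnegative.\<close>

lemma noether_inequality:
  fixes U :: "'a::euclidean_space \<Rightarrow> real"
  assumes B: "open B" and U: "\<And>x. x \<in> B \<Longrightarrow> GDERIV U x :> G x" and G: "continuous_on B G"
    and F: "\<And>K. compact K \<Longrightarrow> K \<subseteq> B \<Longrightarrow> set_integrable lebesgue K F"
    and W: "weak_subsol B G F" and pos: "\<And>x. x \<in> B \<Longrightarrow> G x \<bullet> e \<ge> 0"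
    and \<psi>: "C1_supp K \<psi> g" "K \<subseteq> B" and nn: "\<And>x. \<psi> x \<ge> 0" and e: "norm e = 1"
  shows "0 \<le> (LINT x|lebesgue. - ((G x \<bullet> e) * (G x \<bullet> g x)) + (norm (G x))\<^sup>2 / 2 * (g x \<bullet> e)
            + F x * ((G x \<bullet> e) * \<psi> x))"
proof -
  have K: "compact K" and g: "\<And>x. GDERIV \<psi> x :> g x" "continuous_on UNIV g"
    and out: "\<And>x. x \<notin> K \<Longrightarrow> \<psi> x = 0"
    using \<psi> by (auto simp: C1_supp_def)
  note gout = C1_supp_grad_zero[OF \<psi>(1)] and \<psi>c = C1_supp_continuous[OF \<psi>(1)]
  obtain r K' where r: "r > 0" "compact K'" "K' \<subseteq> B" "\<And>x y. x \<in> K \<Longrightarrow> norm y \<le> r \<Longrightarrow> x + y \<in> K'" "K \<subseteq> K'"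
    using compact_thicken[OF K B \<psi>(2)] by blast
  define h where "h n = r / real (Suc n)" for n
  have h: "h n > 0" "h n \<le> r" "h n \<noteq> 0" for n using r(1) by (auto simp: h_def field_simps)
  have h0: "h \<longlonglongrightarrow> 0" unfolding h_def
    using tendsto_mult_right_zero[OF LIMSEQ_inverse_real_of_nat, of r] by (simp add: divide_inverse)
  define \<delta> where "\<delta> n x = (U x - U (x - h n *\<^sub>R e)) / h n" for n x
  define I where "I n x = - (\<delta> n x * (G x \<bullet> g x)) + (norm (G x))\<^sup>2 / 2 * ((\<psi> (x + h n *\<^sub>R e) - \<psi> x) / h n)
            + F x * (\<delta> n x * \<psi> x)" for n x
  have seg: "x + t *\<^sub>R (- e) \<in> K'" if "x \<in> K" "0 \<le> t" "t \<le> h n" for x t n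
    using r(4)[OF that(1), of "t *\<^sub>R (- e)"] that(2,3) h(2)[of n] e by auto
  \<comment> \<open>The mean value theorem turns \<open>\<delta> n\<close> on \<open>K\<close> into
    a value of \<open>G \<bullet> e\<close> on \<open>K'\<close>; this gives both the nonnegativity
    and a bound uniform in \<open>n\<close>.\<close>
  have \<delta>_mvt: "\<exists>y\<in>K'. \<delta> n x = G y \<bullet> e" if "x \<in> K" for n x
  proof -
    have "GDERIV U (x + t *\<^sub>R (- e)) :> G (x + t *\<^sub>R (- e))" if "0 \<le> t" "t \<le> h n" for t
      using seg[OF \<open>x \<in> K\<close> that] r(3) by (intro U) blast
    from difference_quotient[OF h(1) this] obtain t where
      t: "0 < t" "t < h n" "(U (x + h n *\<^sub>R - e) - U x) / h n = - e \<bullet> G (x + t *\<^sub>R - e)" by blast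
    show ?thesis
    proof (rule bexI)
      show "\<delta> n x = G (x + t *\<^sub>R - e) \<bullet> e"
        using t(3) by (simp add: \<delta>_def inner_commute diff_divide_distrib)
      show "x + t *\<^sub>R - e \<in> K'" using seg[OF that, of t n] t by simp
    qed
  qed
  have step: "0 \<le> (LINT x|lebesgue. I n x)" "I n \<in> borel_measurable lebesgue" for n
  proof -
    have k: "x - h n *\<^sub>R e \<in> K'" if "x \<in> K" for x using seg[OF that, of "h n" n] h(1)[of n] by simp
    have d: "\<delta> n x \<ge> 0" if "x \<in> K" for x using \<delta>_mvt[OF that, of n] r(3) pos by force
    note st = noether_step[OF B U G F W \<psi>(1) nn r(2,3,5) k h(1) \<delta>_def d]
    show "0 \<le> (LINT x|lebesgue. I n x)" unfolding I_def by (rule st(1)) auto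
    show "I n \<in> borel_measurable lebesgue" unfolding I_def[abs_def] by (rule st(2)) auto
  qed
  obtain CG where CG: "CG \<ge> 0" "\<And>x. x \<in> K' \<Longrightarrow> norm (G x) \<le> CG"
    using bounded_on_compact[OF r(2) continuous_on_subset[OF G r(3)]] by blast
  obtain C1 where C1: "C1 \<ge> 0" "\<And>x. x \<in> K \<Longrightarrow> norm (g x) \<le> C1"
    using bounded_on_compact[OF K continuous_on_subset[OF g(2)]] by blast
  have C1': "norm (g x) \<le> C1" for x using C1 gout[of x] by (cases "x \<in> K") auto
  obtain C0 where C0: "C0 \<ge> 0" "\<And>x. x \<in> K \<Longrightarrow> norm (\<psi> x) \<le> C0"
    using bounded_on_compact[OF K \<psi>c] by blast
  have \<delta>_le: "\<bar>\<delta> n x\<bar> \<le> CG" if "x \<in> K" for n x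
  proof -
    obtain y where "y \<in> K'" "\<delta> n x = G y \<bullet> e" using \<delta>_mvt[OF \<open>x \<in> K\<close>] by blast
    then show ?thesis using Cauchy_Schwarz_ineq2[of "G y" e] CG(2)[of y] e by simp
  qed
  show ?thesis
  proof (rule nonneg_integral_limit[OF r(2) F[OF r(2,3)] step(2) _ _ _ step(1)])
    fix n x assume x: "x \<in> K'"
    have a: "\<bar>\<delta> n x * (G x \<bullet> g x)\<bar> \<le> CG * (CG * C1)"
    proof (cases "x \<in> K")
      case True
      have "\<bar>G x \<bullet> g x\<bar> \<le> CG * C1"
        by (rule order_trans[OF Cauchy_Schwarz_ineq2]) (intro mult_mono CG x C1' norm_ge_zero)
      then show ?thesis unfolding abs_mult by (intro mult_mono CG \<delta>_le[OF True]) auto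
    qed (use CG C1 gout in auto)
    have b: "\<bar>(norm (G x))\<^sup>2 / 2 * ((\<psi> (x + h n *\<^sub>R e) - \<psi> x) / h n)\<bar> \<le> CG\<^sup>2 * C1"
    proof -
      have "(norm (G x))\<^sup>2 / 2 \<le> CG\<^sup>2"
        using power_mono[OF CG(2)[OF x] norm_ge_zero, of 2] zero_le_power2[of CG] by linarith
      then show ?thesis unfolding abs_mult
        by (intro mult_mono C1_supp_difference_quotient_bound[OF \<psi>(1) C1' e h(1)]) auto
    qed
    have c: "\<bar>F x * (\<delta> n x * \<psi> x)\<bar> \<le> \<bar>F x\<bar> * (CG * C0)"
    proof (cases "x \<in> K")
      case True
      then show ?thesis unfolding abs_mult using C0(2)[OF True] CG
        by (intro mult_left_mono mult_mono \<delta>_le) auto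
    qed (use CG C0 out in auto)
    have "0 \<le> (CG * (CG * C1) + CG\<^sup>2 * C1) * \<bar>F x\<bar>" "0 \<le> CG * C0" using CG(1) C1(1) C0(1) by auto
    moreover have "(CG * (CG * C1) + CG\<^sup>2 * C1 + CG * C0) * (1 + \<bar>F x\<bar>) =
      CG * (CG * C1) + CG\<^sup>2 * C1 + CG * C0 + (CG * (CG * C1) + CG\<^sup>2 * C1) * \<bar>F x\<bar> + \<bar>F x\<bar> * (CG * C0)"
      by (simp add: algebra_simps)
    ultimately show "\<bar>I n x\<bar> \<le> (CG * (CG * C1) + CG\<^sup>2 * C1 + CG * C0) * (1 + \<bar>F x\<bar>)"
      using a b c unfolding I_def by linarith
  next
    fix n x assume x: "x \<notin> K'"
    then have "x \<notin> K" using r(5) by auto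
    moreover have "x + h n *\<^sub>R e \<notin> K" using r(4)[of "x + h n *\<^sub>R e" "- (h n *\<^sub>R e)"] h[of n] e x by auto
    ultimately show "I n x = 0" using out gout by (simp add: I_def)
  next
    fix x
    note \<psi>_lim = difference_quotient_tendsto[OF g(1)[of x] h0 h(3), of e]
    show "(\<lambda>n. I n x) \<longlonglongrightarrow> - ((G x \<bullet> e) * (G x \<bullet> g x)) + (norm (G x))\<^sup>2 / 2 * (g x \<bullet> e)
            + F x * ((G x \<bullet> e) * \<psi> x)"
    proof (cases "x \<in> K")
      case True
      then have "(\<lambda>n. - ((U (x + h n *\<^sub>R - e) - U x) / h n)) \<longlonglongrightarrow> - (G x \<bullet> - e)"
        using \<psi>(2) by (intro tendsto_minus difference_quotient_tendsto U h0 h(3)) blast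
      moreover have "- ((U (x + h n *\<^sub>R - e) - U x) / h n) = \<delta> n x" for n
        by (simp add: \<delta>_def minus_divide_left)
      ultimately have "(\<lambda>n. \<delta> n x) \<longlonglongrightarrow> G x \<bullet> e" by simp
      then show ?thesis unfolding I_def by (intro tendsto_intros \<psi>_lim)
    next
      \<comment> \<open>Such a point may lie outside \<open>B\<close>, where nothing is known about
        \<open>U\<close>. Since \<open>\<psi>\<close> and \<open>g\<close> vanish there, only the
        quotient of \<open>\<psi>\<close> survives: \<open>x + h n *\<^sub>R e\<close> may still
        belong to \<open>K\<close>.\<close>
      case False
      have "I n x = (norm (G x))\<^sup>2 / 2 * ((\<psi> (x + h n *\<^sub>R e) - \<psi> x) / h n)" for n
        unfolding I_def out[OF False] gout[OF False] by simp
      moreover have "- ((G x \<bullet> e) * (G x \<bullet> g x)) + (norm (G x))\<^sup>2 / 2 * (g x \<bullet> e)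
            + F x * ((G x \<bullet> e) * \<psi> x) = (norm (G x))\<^sup>2 / 2 * (g x \<bullet> e)"
        unfolding out[OF False] gout[OF False] by simp
      moreover have "(\<lambda>n. (norm (G x))\<^sup>2 / 2 * ((\<psi> (x + h n *\<^sub>R e) - \<psi> x) / h n)) \<longlonglongrightarrow> (norm (G x))\<^sup>2 / 2 * (g x \<bullet> e)"
        by (intro tendsto_intros \<psi>_lim)
      ultimately show ?thesis by (simp only:)
    qed
  qed
qed

section \<open>The partial hodograph transform\<close>

text \<open>The change of variables theorem of the library is only available for wellordered index
  types. A copy of the index type is therefore wellordered by an enumeration.\<close>

typedef 'a windex = "UNIV :: 'a set" by simp

instance windex :: (finite) finite
proof
  have "(UNIV :: 'a windex set) = Abs_windex ` UNIV"
    by (rule type_definition.Abs_image[OF type_definition_windex, symmetric])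
  then show "finite (UNIV :: 'a windex set)" by (metis finite_imageI finite)
qed

instantiation windex :: (finite) wellorder
begin

definition less_eq_windex :: "'a windex \<Rightarrow> 'a windex \<Rightarrow> bool" where
  "less_eq_windex x y \<longleftrightarrow> to_nat (Rep_windex x) \<le> to_nat (Rep_windex y)"

definition less_windex :: "'a windex \<Rightarrow> 'a windex \<Rightarrow> bool" where
  "less_windex x y \<longleftrightarrow> to_nat (Rep_windex x) < to_nat (Rep_windex y)"

instance
proof
  fix P :: "'a windex \<Rightarrow> bool" and a
  assume "\<And>x. (\<And>y. y < x \<Longrightarrow> P y) \<Longrightarrow> P x"
  then show "P a"
    unfolding less_windex_def by (rule measure_induct_rule[of "\<lambda>x. to_nat (Rep_windex x)"])
qed (auto simp: less_eq_windex_def less_windex_def Rep_windex_inject)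

end

definition to_windex :: "real ^ 'n \<Rightarrow> real ^ ('n windex)" where
  "to_windex x = (\<chi> i. x $ Rep_windex i)"

definition of_windex :: "real ^ ('n windex) \<Rightarrow> real ^ 'n" where
  "of_windex x = (\<chi> i. x $ Abs_windex i)"

lemma of_to_windex [simp]: "of_windex (to_windex x) = x" "to_windex (of_windex y) = y"
  by (simp_all add: to_windex_def of_windex_def vec_eq_iff Abs_windex_inverse Rep_windex_inverse)

lemma windex_linear: "linear to_windex" "linear of_windex"
  by (auto intro!: linearI simp: to_windex_def of_windex_def vec_eq_iff)

lemma bij_Rep_windex: "bij Rep_windex"
  by (metis Abs_windex_inverse Rep_windex_inverse UNIV_I bij_betw_byWitness bij_def bij_iff)

lemma to_windex_inner: "to_windex x \<bullet> to_windex y = x \<bullet> (y :: real ^ 'n::finite)"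
proof -
  have "(\<Sum>i\<in>UNIV. x $ Rep_windex i * y $ Rep_windex i) = (\<Sum>i\<in>UNIV. x $ i * y $ i)"
    by (rule sum.reindex_bij_betw[OF bij_Rep_windex])
  then show ?thesis by (simp add: inner_vec_def to_windex_def)
qed

lemma prod_Basis_cart: "(\<Prod>b\<in>Basis. (x :: real ^ 'n::finite) \<bullet> b) = (\<Prod>i\<in>UNIV. x $ i)"
proof -
  have B: "(Basis :: (real ^ 'n) set) = (\<lambda>i. axis i 1) ` UNIV"
    by (auto simp: Basis_vec_def)
  have "inj (\<lambda>i. axis i (1::real) :: real ^ 'n)" by (auto simp: inj_def axis_eq_axis)
  then show ?thesis unfolding B by (subst prod.reindex) (auto simp: inner_axis)
qed

lemma box_windex: "to_windex -` box l u = box (of_windex l) (of_windex (u :: real ^ ('n::finite windex)))"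
proof -
  have "(\<forall>i. l $ i < x $ Rep_windex i \<and> x $ Rep_windex i < u $ i) \<longleftrightarrow>
    (\<forall>i. l $ Abs_windex i < x $ i \<and> x $ i < u $ Abs_windex i)" for x :: "real ^ 'n"
    by (metis Abs_windex_inverse Rep_windex_inverse UNIV_I)
  then show ?thesis by (auto simp: mem_box_cart to_windex_def of_windex_def)
qed

lemma windex_borel: "to_windex \<in> borel \<rightarrow>\<^sub>M borel" "of_windex \<in> borel \<rightarrow>\<^sub>M borel"
  using windex_linear by (auto intro!: borel_measurable_continuous_onI linear_continuous_on simp: linear_conv_bounded_linear)

lemma prod_of_windex: "(\<Prod>i\<in>UNIV. of_windex (x :: real ^ ('n::finite windex)) $ i) = (\<Prod>i\<in>UNIV. x $ i)"
proof -
  have "(\<Prod>i\<in>UNIV. of_windex x $ Rep_windex i) = (\<Prod>i\<in>UNIV. of_windex x $ i)"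
    by (rule prod.reindex_bij_betw[OF bij_Rep_windex])
  then show ?thesis by (simp add: of_windex_def Rep_windex_inverse)
qed

text \<open>Lebesgue measure is determined by its values on boxes, and relabelling the coordinates
  leaves the product of the side lengths unchanged.\<close>

lemma windex_distr: "distr lborel borel (to_windex :: real ^ 'n::finite \<Rightarrow> _) = lborel"
  "distr lborel borel (of_windex :: _ \<Rightarrow> real ^ 'n::finite) = lborel"
proof -
  show "distr lborel borel (to_windex :: real ^ 'n \<Rightarrow> _) = lborel"
  proof (rule lborel_eqI[symmetric])
    fix l u :: "real ^ ('n windex)" assume le: "\<And>b. b \<in> Basis \<Longrightarrow> l \<bullet> b \<le> u \<bullet> b"
    have "l $ i \<le> u $ i" for i
      using le[of "axis i 1"] by (simp add: inner_axis axis_in_Basis_iff)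
    then have le': "of_windex l \<bullet> b \<le> of_windex u \<bullet> b" if "b \<in> Basis" for b
      using that by (auto simp: Basis_vec_def inner_axis of_windex_def)
    have "emeasure (distr lborel borel to_windex) (box l u) = emeasure lborel (box (of_windex l) (of_windex u))"
      by (subst emeasure_distr) (auto simp: windex_borel box_windex)
    also have "\<dots> = (\<Prod>b\<in>Basis. (of_windex u - of_windex l) \<bullet> b)"
      by (rule emeasure_lborel_box[OF le'])
    also have "of_windex u - of_windex l = of_windex (u - l)"
      by (simp add: linear_diff[OF windex_linear(2)])
    also have "(\<Prod>b\<in>Basis. of_windex (u - l) \<bullet> b) = (\<Prod>b\<in>Basis. (u - l) \<bullet> b)"
      by (simp only: prod_Basis_cart prod_of_windex)
    finally show "emeasure (distr lborel borel to_windex) (box l u) = (\<Prod>b\<in>Basis. (u - l) \<bullet> b)" .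
  qed simp
  then have "distr lborel borel of_windex = distr (distr lborel borel to_windex) borel (of_windex :: _ \<Rightarrow> real ^ 'n)"
    by simp
  also have "\<dots> = distr lborel borel (of_windex \<circ> to_windex)"
    by (rule distr_distr) (auto simp: windex_borel)
  also have "of_windex \<circ> to_windex = (\<lambda>x :: real ^ 'n. x)" by auto
  also have "distr lborel borel (\<lambda>x :: real ^ 'n. x) = lborel" by (simp add: distr_id2)
  finally show "distr lborel borel (of_windex :: _ \<Rightarrow> real ^ 'n) = lborel" .
qed

text \<open>Preservation of the measure passes to the completion, because preimages of null sets are
  again null.\<close>

lemma lebesgue_distr_eq:
  fixes J :: "'a::euclidean_space \<Rightarrow> 'b::euclidean_space"
  assumes J: "J \<in> borel \<rightarrow>\<^sub>M borel" and d: "distr lborel borel J = lborel"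
  shows "J \<in> lebesgue \<rightarrow>\<^sub>M lebesgue" "distr lebesgue lebesgue J = lebesgue"
proof -
  have J': "J \<in> lebesgue \<rightarrow>\<^sub>M lborel" using J by (simp add: measurable_completion)
  have e: "distr lebesgue lborel J = lborel"
    using d distr_completion[of J lborel lborel] J by (simp cong: distr_cong)
  show "J \<in> lebesgue \<rightarrow>\<^sub>M lebesgue"
    by (rule completion.measurable_completion2[OF J']) (simp add: e)
  show "distr lebesgue lebesgue J = lebesgue"
    using completion.completion_distr_eq[OF J'] e by simp
qed

lemma windex_lebesgue: "(to_windex :: real ^ 'n::finite \<Rightarrow> _) \<in> lebesgue \<rightarrow>\<^sub>M lebesgue"
   "distr lebesgue lebesgue (to_windex :: real ^ 'n \<Rightarrow> _) = lebesgue"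
   "(of_windex :: _ \<Rightarrow> real ^ 'n) \<in> lebesgue \<rightarrow>\<^sub>M lebesgue"
  by (intro lebesgue_distr_eq windex_borel windex_distr)+

lemma windex_integral:
  fixes f :: "real ^ ('n::finite windex) \<Rightarrow> real"
  shows "integrable lebesgue f \<longleftrightarrow> integrable lebesgue (\<lambda>x. f (to_windex x))"
    and "(LINT x|lebesgue. f x) = (LINT x|lebesgue. f (to_windex x))"
proof -
  show iff: "integrable lebesgue f \<longleftrightarrow> integrable lebesgue (\<lambda>x. f (to_windex x))"
  proof
    assume f: "integrable lebesgue f"
    show "integrable lebesgue (\<lambda>x. f (to_windex x))"
      by (rule integrable_distr[OF windex_lebesgue(1)]) (simp add: windex_lebesgue(2) f)
  next
    assume f: "integrable lebesgue (\<lambda>x. f (to_windex x))"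
    have "(\<lambda>y. f (to_windex (of_windex y))) \<in> borel_measurable lebesgue"
      by (rule measurable_compose[OF windex_lebesgue(3) borel_measurable_integrable[OF f]])
    then have "f \<in> borel_measurable lebesgue" by simp
    then show "integrable lebesgue f"
      using integrable_distr_eq[OF windex_lebesgue(1), of f] f by (simp add: windex_lebesgue(2))
  qed
  show "(LINT x|lebesgue. f x) = (LINT x|lebesgue. f (to_windex x))"
  proof (cases "integrable lebesgue f")
    case True
    have "(LINT x|lebesgue. f x) = (LINT x|distr lebesgue lebesgue to_windex. f x)"
      by (simp add: windex_lebesgue(2))
    also have "\<dots> = (LINT x|lebesgue. f (to_windex x))"
      by (rule integral_distr[OF windex_lebesgue(1) borel_measurable_integrable[OF True]])
    finally show ?thesis .
  next
    case False
    then show ?thesis using iff by (simp add: not_integrable_integral_eq)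
  qed
qed

text \<open>The matrix determinant lemma. An orthogonal change of basis takes \<open>a\<close> to a
  multiple of one coordinate vector; then a single row differs from the identity, and Cramer's rule
  reads off its diagonal entry.\<close>

lemma det_rank_one:
  fixes a b :: "real ^ 'n::finite"
  shows "det (matrix (\<lambda>h. h + (h \<bullet> b) *\<^sub>R a)) = 1 + a \<bullet> b"
proof -
  define k :: 'n where "k = undefined"
  define c where "c = norm a"
  have "norm (axis k c) = sqrt (c * c)"
    by (simp only: norm_eq_sqrt_inner inner_axis_axis) simp
  then have "norm (axis k c) = norm a" by (simp add: c_def)
  then obtain Q where Q: "orthogonal_transformation Q" "Q (axis k c) = a"
    using orthogonal_transformation_exists by blast
  define R where "R = inv Q"
  have bijQ: "bij Q" using Q(1) by (rule orthogonal_transformation_bij)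
  have QR: "Q (R x) = x" "R (Q x) = x" for x
    using bijQ by (auto simp: R_def bij_def surj_f_inv_f)
  have R: "orthogonal_transformation R" unfolding R_def by (rule orthogonal_transformation_inv[OF Q(1)])
  have lin: "linear Q" "linear R" using Q(1) R by (auto simp: orthogonal_transformation_def)
  have inn: "Q x \<bullet> Q y = x \<bullet> y" "R x \<bullet> R y = x \<bullet> y" for x y
    using Q(1) R by (auto simp: orthogonal_transformation_def)
  let ?L = "\<lambda>h. h + (h \<bullet> R b) *\<^sub>R axis k c"
  have L: "linear ?L" by (intro linearI) (auto simp: inner_add_left algebra_simps)
  have "(\<lambda>h. h + (h \<bullet> b) *\<^sub>R a) = Q \<circ> (?L \<circ> R)"
    by (auto simp: linear_add[OF lin(1)] linear_scale[OF lin(1)] QR inn Q(2))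
  then have "matrix (\<lambda>h. h + (h \<bullet> b) *\<^sub>R a) = matrix Q ** (matrix ?L ** matrix R)"
    using matrix_compose[OF lin(2) L] matrix_compose[OF linear_compose[OF lin(2) L] lin(1)] by simp
  then have "det (matrix (\<lambda>h. h + (h \<bullet> b) *\<^sub>R a)) = (det (matrix Q) * det (matrix R)) * det (matrix ?L)"
    by (simp add: det_mul)
  also have "det (matrix Q) * det (matrix R) = det (matrix (Q \<circ> R))"
    by (simp add: matrix_compose[OF lin(2,1)] det_mul)
  also have "Q \<circ> R = id" by (auto simp: QR)
  also have "det (matrix (id :: real ^ 'n \<Rightarrow> _)) = 1" by (simp add: matrix_id_mat_1)
  finally have "det (matrix (\<lambda>h. h + (h \<bullet> b) *\<^sub>R a)) = det (matrix ?L)" by simp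
  also have "matrix ?L = (\<chi> i. if i = k then (\<Sum>i\<in>UNIV. (axis k 1 + c *\<^sub>R R b) $ i *s row i (mat 1)) else row i (mat 1))"
  proof -
    have "(\<Sum>i\<in>UNIV. (axis k 1 + c *\<^sub>R R b) $ i *s row i (mat 1)) = axis k 1 + c *\<^sub>R R b"
      by (simp add: vec_eq_iff row_def mat_def if_distrib cong: if_cong)
    moreover have "axis j 1 \<bullet> R b = R b $ j" for j by (simp add: inner_axis')
    then have "matrix ?L = (\<chi> i j. axis j 1 $ i + R b $ j * axis k c $ i)"
      by (simp add: matrix_def)
    ultimately show ?thesis
      by (auto simp: vec_eq_iff row_def mat_def axis_def)
  qed
  also have "det \<dots> = (axis k 1 + c *\<^sub>R R b) $ k * det (mat 1 :: real ^ 'n ^ 'n)"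
    by (rule cramer_lemma_transpose)
  also have "\<dots> = 1 + axis k c \<bullet> R b" by (simp add: inner_axis' )
  also have "axis k c \<bullet> R b = a \<bullet> b" using inn(1)[of "axis k c" "R b"] by (simp add: Q(2) QR)
  finally show ?thesis .
qed

text \<open>The derivative of \<open>T\<close> is the identity plus the rank-one map
  \<open>h \<mapsto> (h \<bullet> (G x - e)) e\<close>, so the Jacobian determinant is
  \<open>1 + e \<bullet> (G x - e) = G x \<bullet> e\<close>.\<close>

lemma hodograph_cv_wellorder:
  fixes U :: "real ^ 'n::{finite,wellorder} \<Rightarrow> real" and f :: "real ^ 'n::{finite,wellorder} \<Rightarrow> real"
  assumes S: "S \<in> sets lebesgue" and U: "\<And>x. x \<in> S \<Longrightarrow> GDERIV U x :> G x" and e: "norm e = 1"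
    and T: "\<And>x. T x = x + (U x - x \<bullet> e) *\<^sub>R e" and inj: "inj_on T S"
  shows "set_integrable lebesgue S (\<lambda>x. \<bar>G x \<bullet> e\<bar> * f (T x)) \<longleftrightarrow> set_integrable lebesgue (T ` S) f"
    and "(LINT x:S|lebesgue. \<bar>G x \<bullet> e\<bar> * f (T x)) = (LINT y:T ` S|lebesgue. f y)"
proof -
  let ?T' = "\<lambda>x h. h + (h \<bullet> (G x - e)) *\<^sub>R e"
  have T': "(T has_derivative ?T' x) (at x within S)" if "x \<in> S" for x
    unfolding T[abs_def]
    by (rule has_derivative_at_withinI)
       (auto intro!: derivative_eq_intros U[OF that, unfolded gderiv_def] simp: inner_diff_right)
  have det: "det (matrix (?T' x)) = G x \<bullet> e" for x
    unfolding det_rank_one using e by (simp add: inner_diff_right inner_commute[of e] flip: power2_norm_eq_inner)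
  \<comment> \<open>The change of variables formula concerns vector-valued integrands; scalars pass
    through one-dimensional vectors.\<close>
  have cv: "(\<lambda>x. \<bar>det (matrix (?T' x))\<bar> *\<^sub>R (vec (f (T x)) :: real ^ 1)) absolutely_integrable_on S \<and>
        integral S (\<lambda>x. \<bar>det (matrix (?T' x))\<bar> *\<^sub>R (vec (f (T x)) :: real ^ 1)) = vec b
     \<longleftrightarrow> (\<lambda>y. vec (f y) :: real ^ 1) absolutely_integrable_on (T ` S) \<and> integral (T ` S) (\<lambda>y. vec (f y) :: real ^ 1) = vec b" for b
    by (rule has_absolute_integral_change_of_variables[OF S T' inj])
  have cv': "(\<lambda>x. \<bar>G x \<bullet> e\<bar> * f (T x)) absolutely_integrable_on S \<and>
        integral S (\<lambda>x. \<bar>G x \<bullet> e\<bar> * f (T x)) = b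
     \<longleftrightarrow> f absolutely_integrable_on (T ` S) \<and> integral (T ` S) f = b" for b
    using cv[of b] unfolding det absolutely_integrable_on_1_iff integral_on_1_eq by simp
  show iff: "set_integrable lebesgue S (\<lambda>x. \<bar>G x \<bullet> e\<bar> * f (T x)) \<longleftrightarrow> set_integrable lebesgue (T ` S) f"
    using cv' by blast
  show "(LINT x:S|lebesgue. \<bar>G x \<bullet> e\<bar> * f (T x)) = (LINT y:T ` S|lebesgue. f y)"
  proof (cases "set_integrable lebesgue (T ` S) f")
    case True
    then show ?thesis
      using cv'[of "integral (T ` S) f"] set_lebesgue_integral_eq_integral(2)[of S "\<lambda>x. \<bar>G x \<bullet> e\<bar> * f (T x)"]
        set_lebesgue_integral_eq_integral(2)[OF True] by simp
  next
    \<comment> \<open>Integrability fails on both sides at once, and both integrals then take the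
      default value 0.\<close>
    case False
    then show ?thesis using iff
      by (simp add: set_integrable_def set_lebesgue_integral_def not_integrable_integral_eq)
  qed
qed

text \<open>Relabelling coordinates is a linear isometry preserving Lebesgue measure, so
  \<open>U\<close>, its gradient, \<open>e\<close> and \<open>T\<close> keep their relations under
  conjugation by it.\<close>

lemma hodograph_cv:
  fixes U :: "real ^ 'n::finite \<Rightarrow> real" and f :: "real ^ 'n \<Rightarrow> real"
  assumes S: "S \<in> sets lebesgue" and U: "\<And>x. x \<in> S \<Longrightarrow> GDERIV U x :> G x" and e: "norm e = 1"
    and T: "\<And>x. T x = x + (U x - x \<bullet> e) *\<^sub>R e" and inj: "inj_on T S"
  shows "set_integrable lebesgue S (\<lambda>x. \<bar>G x \<bullet> e\<bar> * f (T x)) \<longleftrightarrow> set_integrable lebesgue (T ` S) f"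
    and "(LINT x:S|lebesgue. \<bar>G x \<bullet> e\<bar> * f (T x)) = (LINT y:T ` S|lebesgue. f y)"
proof -
  let ?S = "of_windex -` S" and ?U = "\<lambda>x. U (of_windex x)" and ?G = "\<lambda>x. to_windex (G (of_windex x))"
  let ?e = "to_windex e" and ?T = "\<lambda>x. to_windex (T (of_windex x))" and ?f = "\<lambda>y. f (of_windex y)"
  have inn: "x \<bullet> to_windex y = of_windex x \<bullet> y" for x and y :: "real ^ 'n"
    using to_windex_inner[of "of_windex x" y] by simp
  have S': "?S \<in> sets lebesgue"
    using measurable_sets[OF windex_lebesgue(3) S] by simp
  have U': "GDERIV ?U x :> ?G x" if "x \<in> ?S" for x
  proof -
    have "(of_windex has_derivative of_windex) (at x)"
      using windex_linear(2) by (intro bounded_linear_imp_has_derivative) (simp add: linear_conv_bounded_linear)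
    from has_derivative_compose[OF this U[of "of_windex x", unfolded gderiv_def]] that
    show ?thesis by (simp add: gderiv_def inn)
  qed
  have e': "norm ?e = 1" using e by (simp add: norm_eq_sqrt_inner inn)
  have T': "?T x = x + (?U x - x \<bullet> ?e) *\<^sub>R ?e" for x
    by (simp add: T linear_add[OF windex_linear(1)] linear_scale[OF windex_linear(1)] inn)
  have inj': "inj_on ?T ?S"
    using inj by (auto simp: inj_on_def) (metis of_to_windex)
  have im: "?T ` ?S = of_windex -` (T ` S)"
  proof (intro set_eqI iffI)
    fix x assume "x \<in> of_windex -` (T ` S)"
    then obtain s where s: "s \<in> S" "of_windex x = T s" by auto
    then have "x = ?T (to_windex s)" "to_windex s \<in> ?S" using of_to_windex(2)[of x] by simp_all
    then show "x \<in> ?T ` ?S" by blast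
  qed auto
  have A: "integrable lebesgue (\<lambda>x. indicator ?S x *\<^sub>R (\<bar>?G x \<bullet> ?e\<bar> * ?f (?T x))) \<longleftrightarrow> integrable lebesgue (\<lambda>y. indicator (of_windex -` (T ` S)) y *\<^sub>R ?f y)"
    "(LINT x|lebesgue. indicator ?S x *\<^sub>R (\<bar>?G x \<bullet> ?e\<bar> * ?f (?T x))) = (LINT y|lebesgue. indicator (of_windex -` (T ` S)) y *\<^sub>R ?f y)"
    using hodograph_cv_wellorder[OF S' U' e' T' inj', of ?f] unfolding im set_integrable_def set_lebesgue_integral_def by auto
  have B: "indicator (of_windex -` X) (to_windex x) = (indicator X x :: real)" for X and x :: "real ^ 'n"
    by (simp add: indicator_def)
  show "set_integrable lebesgue S (\<lambda>x. \<bar>G x \<bullet> e\<bar> * f (T x)) \<longleftrightarrow> set_integrable lebesgue (T ` S) f"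
    "(LINT x:S|lebesgue. \<bar>G x \<bullet> e\<bar> * f (T x)) = (LINT y:T ` S|lebesgue. f y)"
    using A unfolding windex_integral B inn set_integrable_def set_lebesgue_integral_def by simp_all
qed

section \<open>The transform as a local diffeomorphism\<close>

lemma hodograph_height:
  fixes e :: "'a::real_inner"
  assumes "norm e = 1" "\<And>x. T x = x + (U x - x \<bullet> e) *\<^sub>R e"
  shows "T x \<bullet> e = U x"
  using assms by (simp add: inner_add_left flip: power2_norm_eq_inner)

text \<open>The derivative of \<open>T\<close> is a rank-one perturbation of the identity, inverted
  by the Sherman-Morrison formula as long as \<open>G x \<bullet> e \<noteq> 0\<close>. The
  component of that inverse along \<open>e\<close> is the gradient of
  \<open>S y \<bullet> e\<close>, the height of the level set of \<open>U\<close> at level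
  \<open>y \<bullet> e\<close> over the part of \<open>y\<close> orthogonal to
  \<open>e\<close>.\<close>

lemma hodograph_diffeo:
  fixes U :: "'a::euclidean_space \<Rightarrow> real"
  assumes \<Omega>: "open \<Omega>" "x0 \<in> \<Omega>" and U: "\<And>x. x \<in> \<Omega> \<Longrightarrow> GDERIV U x :> G x" and G: "continuous_on \<Omega> G"
    and e: "norm e = 1" and pos: "\<And>x. x \<in> \<Omega> \<Longrightarrow> G x \<bullet> e \<noteq> 0"
    and T: "\<And>x. T x = x + (U x - x \<bullet> e) *\<^sub>R e"
  shows "\<exists>A V S. open A \<and> A \<subseteq> \<Omega> \<and> x0 \<in> A \<and> open V \<and> T x0 \<in> V \<and> homeomorphism A V T S \<and>
    (\<forall>y\<in>V. GDERIV (\<lambda>y. S y \<bullet> e) y :> e + (1 / (G (S y) \<bullet> e)) *\<^sub>R (e - G (S y)))"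
proof -
  define T' where "T' x = id_blinfun + (blinfun_scaleR_left e o\<^sub>L blinfun_inner_left (G x - e))" for x
  have T'_app: "blinfun_apply (T' x) h = h + (h \<bullet> (G x - e)) *\<^sub>R e" for x h
    by (simp add: T'_def blinfun.add_left)
  define I where "I x h = h - ((h \<bullet> (G x - e)) / (G x \<bullet> e)) *\<^sub>R e" for x h
  have ee: "e \<bullet> e = 1" using e by (simp flip: power2_norm_eq_inner)
  have eG: "e \<bullet> (G x - e) = G x \<bullet> e - 1" for x
    by (simp add: inner_diff_right ee inner_commute)
  have I1: "I x (blinfun_apply (T' x) h) = h" if "x \<in> \<Omega>" for x h
  proof -
    have "(h + (h \<bullet> (G x - e)) *\<^sub>R e) \<bullet> (G x - e) = h \<bullet> (G x - e) + (h \<bullet> (G x - e)) * (G x \<bullet> e - 1)"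
      unfolding inner_add_left inner_scaleR_left eG ..
    also have "\<dots> = (h \<bullet> (G x - e)) * (G x \<bullet> e)" by (simp only: right_diff_distrib)
    finally show ?thesis using pos[OF that] unfolding I_def T'_app by simp
  qed
  have I2: "blinfun_apply (T' x) (I x h) = h" if "x \<in> \<Omega>" for x h
  proof -
    define c where "c = h \<bullet> (G x - e)"
    have "I x h \<bullet> (G x - e) = c - (c / (G x \<bullet> e)) * (G x \<bullet> e - 1)"
      unfolding I_def inner_diff_left inner_scaleR_left eG c_def ..
    also have "\<dots> = c / (G x \<bullet> e)" using pos[OF that] by (simp only: right_diff_distrib) simp
    finally show ?thesis unfolding T'_app by (simp add: I_def c_def)
  qed
  have Ieq: "I x = (\<lambda>h. h - (h \<bullet> ((1 / (G x \<bullet> e)) *\<^sub>R (G x - e))) *\<^sub>R e)" for x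
    by (rule ext) (simp add: I_def)
  have "bounded_linear (\<lambda>h. h - (h \<bullet> w) *\<^sub>R e)" for w
    by (intro bounded_linear_intros)
  then have Ilin: "bounded_linear (I x)" for x unfolding Ieq by blast
  have der: "(T has_derivative blinfun_apply (T' x)) (at x)" if "x \<in> \<Omega>" for x
  proof -
    have "(T has_derivative (\<lambda>h. h + (h \<bullet> (G x - e)) *\<^sub>R e)) (at x)"
      unfolding T[abs_def]
      by (auto intro!: derivative_eq_intros U[OF that, unfolded gderiv_def] simp: inner_diff_right)
    moreover have "blinfun_apply (T' x) = (\<lambda>h. h + (h \<bullet> (G x - e)) *\<^sub>R e)" by (rule ext) (rule T'_app)
    ultimately show ?thesis by simp
  qed
  have cont: "continuous_on \<Omega> T'"
    unfolding T'_def
    by (intro continuous_intros bounded_bilinear.continuous_on[OF bounded_bilinear_blinfun_compose]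
        bounded_linear.continuous_on[OF bounded_linear_blinfun_inner_left] G)
  have inv: "Blinfun (I x0) o\<^sub>L T' x0 = id_blinfun"
    by (rule blinfun_eqI) (simp add: bounded_linear_Blinfun_apply[OF Ilin] I1[OF \<Omega>(2)])
  obtain A V S S' where A: "open A" "A \<subseteq> \<Omega>" "x0 \<in> A" "open V" "T x0 \<in> V" "homeomorphism A V T S"
    and S': "\<And>y. y \<in> V \<Longrightarrow> (S has_derivative (S' y)) (at y)"
    "\<And>y. y \<in> V \<Longrightarrow> S' y = Hilbert_Choice.inv (blinfun_apply (T' (S y)))"
    using inverse_function_theorem[OF \<Omega>(1) der cont \<Omega>(2) inv] by metis
  have "GDERIV (\<lambda>y. S y \<bullet> e) y :> e + (1 / (G (S y) \<bullet> e)) *\<^sub>R (e - G (S y))" if y: "y \<in> V" for y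
  proof -
    have Sy: "S y \<in> \<Omega>" using A(2,6) y by (auto simp: homeomorphism_def)
    \<comment> \<open>The inverse function theorem names the derivative only as an inverse; the
      two-sided inverse \<open>I\<close> makes it explicit.\<close>
    have "S' y = I (S y)" unfolding S'(2)[OF y]
      by (rule inv_equality) (auto simp: I1[OF Sy] I2[OF Sy])
    then have "((\<lambda>y. S y \<bullet> e) has_derivative (\<lambda>h. I (S y) h \<bullet> e)) (at y)"
      using S'(1)[OF y] by (auto intro!: derivative_eq_intros)
    moreover have "I (S y) h \<bullet> e = h \<bullet> (e + (1 / (G (S y) \<bullet> e)) *\<^sub>R (e - G (S y)))" for h
      by (simp add: I_def inner_diff_left inner_diff_right inner_add_right ee diff_divide_distrib)
    ultimately show ?thesis by (simp add: gderiv_def)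
  qed
  with A show ?thesis by blast
qed

section \<open>Local integrability of \<open>f\<close> and of its compositions with linear
  functionals\<close>

lemma set_integrable_mult_continuous:
  fixes c :: "'a::euclidean_space \<Rightarrow> real"
  assumes K: "compact K" and c: "continuous_on K c" and F: "set_integrable lebesgue K F"
  shows "set_integrable lebesgue K (\<lambda>x. c x * F x)"
proof -
  obtain C where C: "C \<ge> 0" "\<And>x. x \<in> K \<Longrightarrow> norm (c x) \<le> C"
    using bounded_on_compact[OF K c] by blast
  have FK: "integrable lebesgue (\<lambda>x. indicator K x *\<^sub>R F x)" using F by (simp add: set_integrable_def)
  have "integrable lebesgue (\<lambda>x. (indicator K x *\<^sub>R c x) * (indicator K x *\<^sub>R F x))"
  proof (rule Bochner_Integration.integrable_bound)
    show "integrable lebesgue (\<lambda>x. C * (indicator K x *\<^sub>R F x))" by (rule integrable_mult_right[OF FK])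
    show "(\<lambda>x. (indicator K x *\<^sub>R c x) * (indicator K x *\<^sub>R F x)) \<in> borel_measurable lebesgue"
      by (intro borel_measurable_times borel_measurable_integrable[OF FK] lebesgue_measurable_on_compact K c)
    show "AE x in lebesgue. norm ((indicator K x *\<^sub>R c x) * (indicator K x *\<^sub>R F x)) \<le> norm (C * (indicat_real K x *\<^sub>R F x))"
    proof (intro always_eventually allI)
      fix x show "norm ((indicator K x *\<^sub>R c x) * (indicator K x *\<^sub>R F x)) \<le> norm (C * (indicat_real K x *\<^sub>R F x))"
        using mult_right_mono[OF C(2)[of x], of "\<bar>F x\<bar>"] C(1)
        by (cases "x \<in> K") (auto simp: abs_mult)
    qed
  qed
  moreover have "(\<lambda>x. (indicator K x *\<^sub>R c x) * (indicator K x *\<^sub>R F x)) = (\<lambda>x. indicator K x *\<^sub>R (c x * F x))"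
    by (auto simp: indicator_def)
  ultimately show ?thesis by (simp add: set_integrable_def)
qed

text \<open>\<open>|t| \<le> 1 + |t|^p\<close>, and compact sets have finite measure.\<close>

lemma Lp_loc_imp_L1_loc:
  assumes f: "f \<in> Lp_loc p" and p: "p > 1" and K: "compact K"
  shows "set_integrable lebesgue K f"
proof -
  have fm: "f \<in> borel_measurable lebesgue" and fp: "set_integrable lebesgue K (\<lambda>t. \<bar>f t\<bar> powr p)"
    using f K by (auto simp: Lp_loc_def)
  have Km: "K \<in> sets lebesgue" "emeasure lebesgue K < \<infinity>"
    using emeasure_compact_finite[OF K] borel_compact[OF K] by auto
  have 1: "set_integrable lebesgue K (\<lambda>x. 1::real)"
    unfolding set_integrable_def using Km by (simp add: integrable_indicator_iff less_top)
  have I: "integrable lebesgue (\<lambda>x. indicator K x *\<^sub>R (1 + \<bar>f x\<bar> powr p))"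
    using set_integral_add(1)[OF 1 fp] by (simp add: set_integrable_def)
  show ?thesis unfolding set_integrable_def
  proof (rule Bochner_Integration.integrable_bound[OF I])
    show "(\<lambda>x. indicator K x *\<^sub>R f x) \<in> borel_measurable lebesgue"
      using fm Km by (intro borel_measurable_scaleR borel_measurable_indicator) auto
    have "\<bar>t\<bar> \<le> 1 + \<bar>t\<bar> powr p" for t :: real
    proof (cases "\<bar>t\<bar> \<le> 1")
      case False
      then have "\<bar>t\<bar> powr 1 \<le> \<bar>t\<bar> powr p" using p by (intro powr_mono) auto
      then show ?thesis using False by simp
    qed (use powr_ge_zero[of "\<bar>t\<bar>" p] in linarith)
    then show "AE x in lebesgue. norm (indicator K x *\<^sub>R f x) \<le> norm (indicator K x *\<^sub>R (1 + \<bar>f x\<bar> powr p))"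
      by (intro always_eventually allI) (auto simp: indicator_def)
  qed
qed

text \<open>Tonelli for a product integrand on a box containing \<open>K\<close>. As
  \<open>f\<close> is only Lebesgue measurable, a Borel representative \<open>f'\<close> is
  integrated instead; preimages of null sets under the coordinate are null, which justifies both the
  exchange and the measurability of \<open>f (z \<bullet> b)\<close>.\<close>

lemma set_integrable_coordinate:
  fixes f :: "real \<Rightarrow> real" and b :: "'a::euclidean_space"
  assumes fm: "f \<in> borel_measurable lebesgue" and f: "\<And>K. compact K \<Longrightarrow> set_integrable lebesgue K f"
    and b: "b \<in> Basis" and K: "compact K"
  shows "set_integrable lebesgue K (\<lambda>z. f (z \<bullet> b))"
proof -
  obtain f' where f': "f' \<in> borel_measurable lborel" "AE t in lborel. f t = f' t"
    using completion_ex_borel_measurable_real[OF fm] by blast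
  have f'm[measurable]: "f' \<in> borel_measurable borel" using f'(1) by simp
  obtain N where N: "N \<in> null_sets lborel" "{t. f t \<noteq> f' t} \<subseteq> N"
    using f'(2) by (auto elim!: AE_E simp: null_sets_def)
  have Nm[measurable]: "N \<in> sets borel" using N(1) by auto
  have N0: "(\<integral>\<^sup>+z. indicator N (z \<bullet> b) \<partial>(lborel :: 'a measure)) = 0"
    if N: "N \<in> null_sets lborel" for N
  proof -
    have [measurable]: "N \<in> sets borel" using N by auto
    define hN :: "'a \<Rightarrow> real \<Rightarrow> ennreal" where "hN i t = (if i = b then indicator N t else 1)" for i t
    have "(\<integral>\<^sup>+z. (\<Prod>i\<in>Basis. hN i (z \<bullet> i)) \<partial>(lborel :: 'a measure)) = (\<Prod>i\<in>Basis. (\<integral>\<^sup>+t. hN i t \<partial>lborel))"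
      by (rule nn_integral_lborel_prod) (auto simp: hN_def[abs_def])
    \<comment> \<open>The factors for the other directions, if there are any, are infinite; in the
      extended nonnegative reals the product with 0 is still 0.\<close>
    also have "\<dots> = 0"
      by (rule prod_zero) (use b N in \<open>auto intro!: bexI[of _ b] simp: hN_def null_sets_def\<close>)
    also have "(\<lambda>z::'a. \<Prod>i\<in>Basis. hN i (z \<bullet> i)) = (\<lambda>z. indicator N (z \<bullet> b))"
      unfolding hN_def using b by (auto simp: prod.delta')
    finally show ?thesis .
  qed
  have proj: "(\<lambda>z::'a. z \<bullet> b) \<in> lebesgue \<rightarrow>\<^sub>M lebesgue"
  proof (rule completion.measurable_completion2)
    show m: "(\<lambda>z::'a. z \<bullet> b) \<in> lebesgue \<rightarrow>\<^sub>M lborel" by (rule measurable_completion) measurable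
    show "null_sets lborel \<subseteq> null_sets (distr lebesgue lborel (\<lambda>z::'a. z \<bullet> b))"
    proof
      fix M :: "real set" assume M: "M \<in> null_sets lborel"
      then have [measurable]: "M \<in> sets borel" by auto
      have s: "(\<lambda>z::'a. z \<bullet> b) -` M \<in> sets borel" by (rule measurable_sets_borel[of _ borel]) auto
      have "emeasure (distr lebesgue lborel (\<lambda>z::'a. z \<bullet> b)) M = emeasure lborel ((\<lambda>z::'a. z \<bullet> b) -` M)"
        using m s by (subst emeasure_distr) auto
      also have "\<dots> = (\<integral>\<^sup>+z. indicator ((\<lambda>z::'a. z \<bullet> b) -` M) z \<partial>lborel)"
        using s by simp
      also have "\<dots> = 0" using N0[OF M] by (simp add: indicator_def)
      finally show "M \<in> null_sets (distr lebesgue lborel (\<lambda>z::'a. z \<bullet> b))" by auto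
    qed
  qed
  have "AE z in (lborel :: 'a measure). (indicator N (z \<bullet> b) :: ennreal) = 0"
    using N0[OF N(1)] by (subst (asm) nn_integral_0_iff_AE) auto
  then have AEN: "AE z in (lborel :: 'a measure). f (z \<bullet> b) = f' (z \<bullet> b)"
    by eventually_elim (use N(2) in \<open>auto simp: indicator_def split: if_splits\<close>)
  obtain a where a: "K \<subseteq> cbox (-a) a"
    using bounded_subset_cbox_symmetric[OF compact_imp_bounded[OF K]] by blast
  define h :: "'a \<Rightarrow> real \<Rightarrow> ennreal" where
    "h i t = (if i = b then ennreal \<bar>f' t\<bar> else 1) * indicator {- (a \<bullet> i)..a \<bullet> i} t" for i t
  have hm: "h i \<in> borel_measurable borel" for i by (auto simp: h_def[abs_def])
  have hfin: "(\<integral>\<^sup>+t. h i t \<partial>lborel) < top" for i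
  proof (cases "i = b")
    case True
    have "(\<integral>\<^sup>+t. h i t \<partial>lborel) = (\<integral>\<^sup>+t. ennreal (norm (indicator {- (a \<bullet> b)..a \<bullet> b} t *\<^sub>R f t)) \<partial>lborel)"
      by (rule nn_integral_cong_AE) (use f'(2) True in \<open>auto simp: h_def indicator_def elim!: eventually_mono\<close>)
    also have "\<dots> = (\<integral>\<^sup>+t. ennreal (norm (indicator {- (a \<bullet> b)..a \<bullet> b} t *\<^sub>R f t)) \<partial>lebesgue)"
      by (rule nn_integral_completion[symmetric])
    also have "\<dots> < top"
      using f[of "{- (a \<bullet> b)..a \<bullet> b}"] unfolding set_integrable_def integrable_iff_bounded by (simp add: less_top)
    finally show ?thesis .
  next
    case False
    then have "(\<integral>\<^sup>+t. h i t \<partial>lborel) = emeasure lborel {- (a \<bullet> i)..a \<bullet> i}"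
      by (simp add: h_def)
    also have "\<dots> < top" using emeasure_compact_finite[of "{- (a \<bullet> i)..a \<bullet> i}"] by simp
    finally show ?thesis .
  qed
  have "(\<integral>\<^sup>+z. (\<Prod>i\<in>Basis. h i (z \<bullet> i)) \<partial>(lborel :: 'a measure)) = (\<Prod>i\<in>Basis. (\<integral>\<^sup>+t. h i t \<partial>lborel))"
    by (rule nn_integral_lborel_prod) (auto simp: hm)
  also have "\<dots> < top"
  proof -
    have "(\<Prod>i\<in>B. (\<integral>\<^sup>+t. h i t \<partial>lborel)) < top" if "finite B" for B
      using that by induction (auto simp: ennreal_mult_less_top hfin)
    then show ?thesis by simp
  qed
  finally have fin: "(\<integral>\<^sup>+z. (\<Prod>i\<in>Basis. h i (z \<bullet> i)) \<partial>(lborel :: 'a measure)) < top" .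
  have Kb: "K \<in> sets borel" by (rule borel_compact[OF K])
  have meas: "(\<lambda>z::'a. indicator K z *\<^sub>R f' (z \<bullet> b)) \<in> borel_measurable lborel"
    using Kb by measurable
  have "integrable lborel (\<lambda>z::'a. indicator K z *\<^sub>R f' (z \<bullet> b))"
  proof (rule integrableI_bounded[OF meas])
    have "(\<integral>\<^sup>+z. ennreal (norm (indicator K z *\<^sub>R f' (z \<bullet> b))) \<partial>(lborel :: 'a measure)) \<le> (\<integral>\<^sup>+z. (\<Prod>i\<in>Basis. h i (z \<bullet> i)) \<partial>(lborel :: 'a measure))"
    proof (rule nn_integral_mono)
      fix z :: 'a
      show "ennreal (norm (indicator K z *\<^sub>R f' (z \<bullet> b))) \<le> (\<Prod>i\<in>Basis. h i (z \<bullet> i))"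
      proof (cases "z \<in> K")
        case True
        then have "- (a \<bullet> i) \<le> z \<bullet> i \<and> z \<bullet> i \<le> a \<bullet> i" if "i \<in> Basis" for i
          using a that by (auto simp: mem_box)
        then have "(\<Prod>i\<in>Basis. h i (z \<bullet> i)) = (\<Prod>i\<in>Basis. if i = b then ennreal \<bar>f' (z \<bullet> b)\<bar> else 1)"
          by (intro prod.cong) (auto simp: h_def)
        also have "\<dots> = ennreal \<bar>f' (z \<bullet> b)\<bar>" using b by (simp add: prod.delta)
        finally show ?thesis using True by simp
      qed simp
    qed
    also note fin
    finally show "(\<integral>\<^sup>+z. ennreal (norm (indicator K z *\<^sub>R f' (z \<bullet> b))) \<partial>(lborel :: 'a measure)) < \<infinity>" by simp
  qed
  then have I: "integrable lebesgue (\<lambda>z::'a. indicator K z *\<^sub>R f' (z \<bullet> b))"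
    using meas by (simp add: integrable_completion)
  have AEl: "AE z in (lebesgue :: 'a measure). indicat_real K z *\<^sub>R f' (z \<bullet> b) = indicat_real K z *\<^sub>R f (z \<bullet> b)"
    using AE_completion[OF AEN] by eventually_elim simp
  show ?thesis unfolding set_integrable_def
  proof (rule integrable_cong_AE_imp[OF I _ AEl])
    have "(\<lambda>z::'a. f (z \<bullet> b)) \<in> borel_measurable lebesgue"
      by (rule measurable_compose[OF proj fm])
    then show "(\<lambda>z. indicat_real K z *\<^sub>R f (z \<bullet> b)) \<in> borel_measurable lebesgue"
      using Kb by (intro borel_measurable_scaleR borel_measurable_indicator) auto
  qed
qed

text \<open>A linear instance of the transform: for \<open>U y = y \<bullet> a\<close> the map
  \<open>T\<close> turns the functional into the coordinate along \<open>e\<close>, where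
  \<open>e\<close> is a coordinate vector with \<open>a \<bullet> e \<noteq> 0\<close>, so that the
  constant Jacobian does not vanish.\<close>

lemma set_integrable_linear_functional:
  fixes f :: "real \<Rightarrow> real" and a :: "real ^ 'n"
  assumes fm: "f \<in> borel_measurable lebesgue" and f: "\<And>K. compact K \<Longrightarrow> set_integrable lebesgue K f"
    and a: "a \<noteq> 0" and K: "compact K"
  shows "set_integrable lebesgue K (\<lambda>y. f (y \<bullet> a))"
proof -
  obtain k where k: "a $ k \<noteq> 0" using a by (auto simp: vec_eq_iff)
  define e :: "real ^ 'n" where "e = axis k 1"
  have ae: "a \<bullet> e \<noteq> 0" using k by (simp add: e_def inner_axis)
  have e: "norm e = 1" by (simp add: e_def norm_axis_1)
  define T where "T y = y + (y \<bullet> a - y \<bullet> e) *\<^sub>R e" for y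
  have Te: "T y \<bullet> e = y \<bullet> a" for y by (rule hodograph_height[OF e T_def])
  have inj: "inj_on T K"
  proof (rule inj_onI)
    fix x y assume xy: "T x = T y"
    then have "x \<bullet> a = y \<bullet> a" using Te by metis
    moreover have "x - y = ((x \<bullet> e) - (y \<bullet> e)) *\<^sub>R e"
      using xy \<open>x \<bullet> a = y \<bullet> a\<close> by (simp add: T_def algebra_simps)
    ultimately have "((x \<bullet> e) - (y \<bullet> e)) * (e \<bullet> a) = 0"
      by (metis eq_iff_diff_eq_0 inner_diff_left inner_scaleR_left)
    then have "x \<bullet> e = y \<bullet> e" using ae by (simp add: inner_commute)
    then show "x = y" using \<open>x - y = ((x \<bullet> e) - (y \<bullet> e)) *\<^sub>R e\<close> by simp
  qed
  have "continuous_on K T" unfolding T_def[abs_def] by (intro continuous_intros)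
  then have "compact (T ` K)" using K by (rule compact_continuous_image)
  then have "set_integrable lebesgue (T ` K) (\<lambda>z. f (z \<bullet> e))"
    by (intro set_integrable_coordinate[OF fm f]) (auto simp: e_def axis_in_Basis_iff)
  moreover have "GDERIV (\<lambda>y. y \<bullet> a) y :> a" for y :: "real ^ 'n"
    unfolding gderiv_def by (auto intro!: derivative_eq_intros)
  ultimately have "set_integrable lebesgue K (\<lambda>y. \<bar>a \<bullet> e\<bar> * f (T y \<bullet> e))"
    using hodograph_cv(1)[of K "\<lambda>y. y \<bullet> a" "\<lambda>_. a" e T "\<lambda>z. f (z \<bullet> e)"] inj e T_def borel_compact[OF K] by auto
  from set_integrable_mult_continuous[OF K continuous_on_const this, of "1 / \<bar>a \<bullet> e\<bar>"]
  show ?thesis using ae by (simp add: Te)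
qed

section \<open>A strong minimum principle\<close>

lemma nonneg_integral_limit_bounded:
  fixes s :: "nat \<Rightarrow> 'a::euclidean_space \<Rightarrow> real"
  assumes K: "compact K" and meas: "\<And>n. s n \<in> borel_measurable lebesgue"
    and bound: "\<And>n x. x \<in> K \<Longrightarrow> \<bar>s n x\<bar> \<le> C" and zero: "\<And>n x. x \<notin> K \<Longrightarrow> s n x = 0"
    and lim: "\<And>x. (\<lambda>n. s n x) \<longlonglongrightarrow> t x"
    and nn: "\<And>n. 0 \<le> (LINT x|lebesgue. s n x)"
  shows "0 \<le> (LINT x|lebesgue. t x)"
proof (rule nonneg_integral_limit[OF K _ meas _ zero lim nn])
  show "set_integrable lebesgue K (\<lambda>_. 0 :: real)" by (simp add: set_integrable_def)
  show "\<bar>s n x\<bar> \<le> C * (1 + \<bar>0::real\<bar>)" if "x \<in> K" for n x using bound[OF that] by simp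
qed

text \<open>Difference quotients have integral 0 by translation invariance, and the sign passes to
  the limit. Equality will follow on replacing \<open>v\<close> by \<open>- v\<close>.\<close>

lemma integral_gradient_nonneg:
  assumes p: "C1_supp K p g" and v: "norm v = 1"
  shows "0 \<le> (LINT x|lebesgue. g x \<bullet> v)"
proof -
  have K: "compact K" and g: "\<And>x. GDERIV p x :> g x" "continuous_on UNIV g"
    and out: "\<And>x. x \<notin> K \<Longrightarrow> p x = 0"
    using p by (auto simp: C1_supp_def)
  note gout = C1_supp_grad_zero[OF p] and pc = C1_supp_continuous[OF p]
  obtain r K' where r: "r > 0" "compact K'" "K' \<subseteq> UNIV" "\<And>x y. x \<in> K \<Longrightarrow> norm y \<le> r \<Longrightarrow> x + y \<in> K'" "K \<subseteq> K'"
    using compact_thicken[OF K open_UNIV subset_UNIV] by blast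
  define h where "h n = r / real (Suc n)" for n
  have h: "h n > 0" "h n \<le> r" "h n \<noteq> 0" for n using r(1) by (auto simp: h_def field_simps)
  have h0: "h \<longlonglongrightarrow> 0" unfolding h_def
    using tendsto_mult_right_zero[OF LIMSEQ_inverse_real_of_nat, of r] by (simp add: divide_inverse)
  obtain C where C: "C \<ge> 0" "\<And>x. x \<in> K \<Longrightarrow> norm (g x) \<le> C"
    using bounded_on_compact[OF K continuous_on_subset[OF g(2)]] by blast
  have C': "norm (g x) \<le> C" for x using C gout[of x] by (cases "x \<in> K") auto
  have pi: "integrable lebesgue p" by (rule integrable_compact_support[OF pc K out])
  have pvc: "continuous_on UNIV (\<lambda>x. p (x + h n *\<^sub>R v))" for n
    by (rule continuous_on_compose2[OF pc[of UNIV]]) (auto intro!: continuous_intros)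
  have sh: "x + h n *\<^sub>R v \<notin> K" if "x \<notin> K'" for x n
    using r(4)[of "x + h n *\<^sub>R v" "- (h n *\<^sub>R v)"] h[of n] v that by auto
  have pvi: "integrable lebesgue (\<lambda>x. p (x + h n *\<^sub>R v))" for n
    by (rule integrable_compact_support[OF pvc r(2)]) (use sh out in auto)
  have zero: "(LINT x|lebesgue. (p (x + h n *\<^sub>R v) - p x) / h n) = 0" for n
    using lebesgue_integral_affine[OF borel_measurable_integrable[OF pi], of 1 "h n *\<^sub>R v"] pi pvi[of n]
    by (simp add: Bochner_Integration.integral_diff add.commute)
  show ?thesis
  proof (rule nonneg_integral_limit_bounded[where s="\<lambda>n x. (p (x + h n *\<^sub>R v) - p x) / h n" and C=C, OF r(2)])
    show "(\<lambda>x. (p (x + h n *\<^sub>R v) - p x) / h n) \<in> borel_measurable lebesgue" for n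
      by (intro borel_measurable_integrable integrable_divide_zero Bochner_Integration.integrable_diff pi pvi)
    show "\<bar>(p (x + h n *\<^sub>R v) - p x) / h n\<bar> \<le> C" for n x
      by (rule C1_supp_difference_quotient_bound[OF p C' v h(1)])
    show "(p (x + h n *\<^sub>R v) - p x) / h n = 0" if "x \<notin> K'" for n x
    proof -
      have "x \<notin> K" using that r(5) by auto
      then show ?thesis using out sh[OF that] by simp
    qed
    show "(\<lambda>n. (p (x + h n *\<^sub>R v) - p x) / h n) \<longlonglongrightarrow> g x \<bullet> v" for x
      by (rule difference_quotient_tendsto[OF g(1) h0 h(3)])
    show "0 \<le> (LINT x|lebesgue. (p (x + h n *\<^sub>R v) - p x) / h n)" for n unfolding zero by simp
  qed
qed

lemma integral_gradient_zero:
  assumes p: "C1_supp K p g" and v: "norm v = 1"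
  shows "(LINT x|lebesgue. g x \<bullet> v) = 0"
proof -
  have "0 \<le> (LINT x|lebesgue. g x \<bullet> (- v))"
    by (rule integral_gradient_nonneg[OF p]) (simp add: v)
  then show ?thesis using integral_gradient_nonneg[OF p v] by simp
qed

text \<open>Radial functions are written in the squared distance, which is smooth at the centre, so
  that the chain rule holds everywhere.\<close>

lemma radial_C1_supp:
  fixes y0 :: "'a::euclidean_space"
  assumes "\<And>s. s \<ge> 0 \<Longrightarrow> (H has_real_derivative H' s) (at s)" "continuous_on {0..} H'"
    "\<And>s. s \<ge> \<rho>\<^sup>2 \<Longrightarrow> H s = 0" "\<And>s. s \<ge> \<rho>\<^sup>2 \<Longrightarrow> H' s = 0" "\<rho> > 0"
  shows "C1_supp (cball y0 \<rho>) (\<lambda>y. H ((y - y0) \<bullet> (y - y0))) (\<lambda>y. (2 * H' ((y - y0) \<bullet> (y - y0))) *\<^sub>R (y - y0))"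
proof -
  have out: "(y - y0) \<bullet> (y - y0) \<ge> \<rho>\<^sup>2" if "y \<notin> cball y0 \<rho>" for y
  proof -
    have "\<rho> \<le> norm (y - y0)" using that by (simp add: dist_norm norm_minus_commute)
    then have "\<rho>\<^sup>2 \<le> (norm (y - y0))\<^sup>2" using assms(5) by (intro power_mono) auto
    then show ?thesis by (simp add: power2_norm_eq_inner)
  qed
  show ?thesis
  proof (rule C1_supp_extend[OF open_UNIV compact_cball subset_UNIV])
    fix y
    have "((\<lambda>y. (y - y0) \<bullet> (y - y0)) has_derivative (\<lambda>h. 2 * (h \<bullet> (y - y0)))) (at y)"
      by (auto intro!: derivative_eq_intros simp: inner_commute)
    from has_derivative_compose[OF this, of H "(*) (H' ((y - y0) \<bullet> (y - y0)))"] assms(1)[of "(y - y0) \<bullet> (y - y0)"]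
    show "GDERIV (\<lambda>y. H ((y - y0) \<bullet> (y - y0))) y :> (2 * H' ((y - y0) \<bullet> (y - y0))) *\<^sub>R (y - y0)"
      unfolding gderiv_def has_field_derivative_def by (simp add: mult_ac)
  next
    show "continuous_on UNIV (\<lambda>y. (2 * H' ((y - y0) \<bullet> (y - y0))) *\<^sub>R (y - y0))"
      by (intro continuous_intros continuous_on_compose2[OF assms(2)]) auto
  qed (use out assms in auto)
qed

text \<open>For \<open>\<psi>(y) = H(s)\<close> with \<open>s = |y - y0|^2\<close> the gradient is
  \<open>2 H' (y - y0)\<close> and the Laplacian \<open>4 s H'' + 2 n H'\<close>. The product of
  \<open>z\<close> with a partial derivative of \<open>\<psi>\<close> is C^1 with compact support,
  so its derivative in the same direction integrates to 0; the sum over the basis is the divergence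
  theorem for \<open>z \<nabla>\<psi>\<close>.\<close>

lemma radial_integration_by_parts:
  fixes y0 :: "'a::euclidean_space" and z :: "'a \<Rightarrow> real"
  assumes z: "\<And>y. y \<in> ball y0 R \<Longrightarrow> GDERIV z y :> q y" and q: "continuous_on (ball y0 R) q"
    and H': "\<And>s. s \<ge> 0 \<Longrightarrow> (H' has_real_derivative H'' s) (at s)" and H'': "continuous_on {0..} H''"
    and supp: "\<And>s. s \<ge> \<rho>\<^sup>2 \<Longrightarrow> H' s = 0" "\<And>s. s \<ge> \<rho>\<^sup>2 \<Longrightarrow> H'' s = 0" and \<rho>: "0 < \<rho>" "\<rho> < R"
  shows "(LINT y|lebesgue. q y \<bullet> ((2 * H' ((y - y0) \<bullet> (y - y0))) *\<^sub>R (y - y0))) =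
     - (LINT y|lebesgue. z y * (4 * ((y - y0) \<bullet> (y - y0)) * H'' ((y - y0) \<bullet> (y - y0)) + 2 * real DIM('a) * H' ((y - y0) \<bullet> (y - y0))))"
proof -
  define s where "s y = (y - y0) \<bullet> (y - y0)" for y
  have out: "s y \<ge> \<rho>\<^sup>2" if "y \<notin> cball y0 \<rho>" for y
  proof -
    have "\<rho> \<le> norm (y - y0)" using that by (simp add: dist_norm norm_minus_commute)
    then have "\<rho>\<^sup>2 \<le> (norm (y - y0))\<^sup>2" using \<rho> by (intro power_mono) auto
    then show ?thesis by (simp add: power2_norm_eq_inner s_def)
  qed
  have KB: "cball y0 \<rho> \<subseteq> ball y0 R" using \<rho> by auto
  have sc: "continuous_on A s" for A unfolding s_def by (intro continuous_intros)
  have H'c: "continuous_on {0..} H'" using H'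
    by (meson DERIV_continuous_on atLeast_iff has_field_derivative_at_within)
  have H'sc: "continuous_on A (\<lambda>y. H' (s y))" "continuous_on A (\<lambda>y. H'' (s y))" for A
    by (intro continuous_on_compose2[OF H'c sc] continuous_on_compose2[OF H'' sc]; force simp: s_def)+
  have zc: "continuous_on (ball y0 R) z"
    by (rule GDERIV_continuous_on[OF z])
  define gb where "gb b y = (2 * H' (s y) * ((y - y0) \<bullet> b)) *\<^sub>R q y
     + z y *\<^sub>R ((4 * H'' (s y) * ((y - y0) \<bullet> b)) *\<^sub>R (y - y0) + (2 * H' (s y)) *\<^sub>R b)" for b y
  have C: "C1_supp (cball y0 \<rho>) (\<lambda>y. z y * (2 * H' (s y) * ((y - y0) \<bullet> b))) (gb b)" for b
  proof (rule C1_supp_extend[OF open_ball compact_cball KB])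
    fix y assume y: "y \<in> ball y0 R"
    have "(s has_derivative (\<lambda>h. 2 * (h \<bullet> (y - y0)))) (at y)"
      unfolding s_def[abs_def] by (auto intro!: derivative_eq_intros simp: inner_commute)
    from has_derivative_compose[OF this, of H' "(*) (H'' (s y))"] H'[of "s y"]
    have 1: "((\<lambda>y. H' (s y)) has_derivative (\<lambda>h. H'' (s y) * (2 * (h \<bullet> (y - y0))))) (at y)"
      unfolding has_field_derivative_def by (simp add: s_def)
    show "GDERIV (\<lambda>y. z y * (2 * H' (s y) * ((y - y0) \<bullet> b))) y :> gb b y"
      unfolding gderiv_def
      by (rule has_derivative_eq_rhs, (rule derivative_intros 1 z[OF y, unfolded gderiv_def])+)
         (auto simp: gb_def inner_add_right algebra_simps)
  next
    show "continuous_on (ball y0 R) (gb b)"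
      unfolding gb_def by (intro continuous_intros H'sc zc q)
  qed (use out supp in \<open>auto simp: gb_def\<close>)
  have gi: "integrable lebesgue (\<lambda>y. gb b y \<bullet> b)" for b
    using C[of b] C1_supp_grad_zero[OF C[of b]]
    by (intro integrable_compact_support[of _ "cball y0 \<rho>"]) (auto simp: C1_supp_def intro!: continuous_intros)
  have sum: "(\<Sum>b\<in>Basis. gb b y \<bullet> b) = q y \<bullet> ((2 * H' (s y)) *\<^sub>R (y - y0)) + z y * (4 * s y * H'' (s y) + 2 * real DIM('a) * H' (s y))" for y
  proof -
    have "(\<Sum>b\<in>Basis. gb b y \<bullet> b) = (\<Sum>b\<in>Basis. 2 * H' (s y) * ((q y \<bullet> b) * ((y - y0) \<bullet> b))
        + (z y * 4 * H'' (s y)) * (((y - y0) \<bullet> b) * ((y - y0) \<bullet> b)) + z y * (2 * H' (s y)))"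
      by (intro sum.cong refl) (simp add: gb_def inner_add_left inner_Basis algebra_simps)
    also have "\<dots> = 2 * H' (s y) * (q y \<bullet> (y - y0)) + (z y * 4 * H'' (s y)) * ((y - y0) \<bullet> (y - y0)) + real DIM('a) * (z y * (2 * H' (s y)))"
      by (simp only: sum.distrib sum_distrib_left[symmetric] euclidean_inner[symmetric] sum_constant)
         (simp only: mult_ac)
    finally show ?thesis by (simp add: s_def algebra_simps)
  qed
  have "0 = (\<Sum>b\<in>Basis. (LINT y|lebesgue. gb b y \<bullet> b))"
    using integral_gradient_zero[OF C] by (simp add: norm_Basis)
  also have "\<dots> = (LINT y|lebesgue. (\<Sum>b\<in>Basis. gb b y \<bullet> b))"
    by (rule Bochner_Integration.integral_sum[symmetric]) (rule gi)
  also have "\<dots> = (LINT y|lebesgue. q y \<bullet> ((2 * H' (s y)) *\<^sub>R (y - y0))) + (LINT y|lebesgue. z y * (4 * s y * H'' (s y) + 2 * real DIM('a) * H' (s y)))"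
    unfolding sum
  proof (rule Bochner_Integration.integral_add)
    show "integrable lebesgue (\<lambda>y. q y \<bullet> ((2 * H' (s y)) *\<^sub>R (y - y0)))"
      by (rule integrable_extend_zero[OF open_ball _ compact_cball KB])
         (use out supp in \<open>auto intro!: continuous_intros H'sc q\<close>)
    show "integrable lebesgue (\<lambda>y. z y * (4 * s y * H'' (s y) + 2 * real DIM('a) * H' (s y)))"
      by (rule integrable_extend_zero[OF open_ball _ compact_cball KB])
         (use out supp in \<open>auto intro!: continuous_intros H'sc zc sc\<close>)
  qed
  finally show ?thesis by (simp add: s_def)
qed

text \<open>\<open>b\<close> plays the role of \<open>|\<nabla>\<psi>|\<^sup>2/\<psi>\<close>.\<close>

lemma supersolution_sqrt:
  fixes w :: "'a::euclidean_space \<Rightarrow> real"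
  assumes B: "open B" and w: "\<And>y. y \<in> B \<Longrightarrow> GDERIV w y :> q y" and q: "continuous_on B q"
    and w0: "\<And>y. y \<in> B \<Longrightarrow> w y \<ge> 0"
    and D: "continuous_on B D" "\<And>y. y \<in> B \<Longrightarrow> norm (D y - q y) \<le> \<delta> * norm (q y)" and \<delta>: "0 \<le> \<delta>" "\<delta> \<le> 1/2"
    and weak: "\<And>K \<Psi> g. K \<subseteq> B \<Longrightarrow> C1_supp K \<Psi> g \<Longrightarrow> (\<And>y. \<Psi> y \<ge> 0) \<Longrightarrow> 0 \<le> (LINT y|lebesgue. D y \<bullet> g y)"
    and \<psi>: "C1_supp K \<psi> g" "K \<subseteq> B" "\<And>y. \<psi> y \<ge> 0"
    and b: "continuous_on UNIV b" "\<And>y. b y \<ge> 0" "\<And>y. y \<notin> K \<Longrightarrow> b y = 0" "\<And>y. (norm (g y))\<^sup>2 \<le> b y * \<psi> y"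
    and \<epsilon>: "\<epsilon> > 0"
  shows "\<And>y. y \<in> B \<Longrightarrow> GDERIV (\<lambda>y. sqrt (w y + \<epsilon>)) y :> inverse (2 * sqrt (w y + \<epsilon>)) *\<^sub>R q y"
    and "0 \<le> (LINT y|lebesgue. inverse (2 * sqrt (w y + \<epsilon>)) *\<^sub>R q y \<bullet> g y) + (LINT y|lebesgue. sqrt (w y + \<epsilon>) * (\<delta>\<^sup>2 / 2 * b y))"
proof -
  define z where "z y = sqrt (w y + \<epsilon>)" for y
  have K: "compact K" and g: "\<And>x. GDERIV \<psi> x :> g x" "continuous_on UNIV g"
    and out: "\<And>x. x \<notin> K \<Longrightarrow> \<psi> x = 0"
    using \<psi> by (auto simp: C1_supp_def)
  note gout = C1_supp_grad_zero[OF \<psi>(1)] and \<psi>c = C1_supp_continuous[OF \<psi>(1)]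
  have wc: "continuous_on B w"
    by (rule GDERIV_continuous_on[OF w])
  have zpos: "z y > 0" if "y \<in> B" for y using w0[OF that] \<epsilon> by (simp add: z_def)
  have zc: "continuous_on B z" unfolding z_def by (intro continuous_intros wc)
  have gz: "GDERIV z y :> inverse (2 * z y) *\<^sub>R q y" if "y \<in> B" for y
  proof -
    have sq: "(sqrt has_derivative (*) (inverse (z y) / 2)) (at (w y + \<epsilon>))"
      unfolding has_field_derivative_def[symmetric] using w0[OF that] \<epsilon> unfolding z_def by (intro DERIV_real_sqrt) simp
    have "((\<lambda>y. w y + \<epsilon>) has_derivative (\<lambda>h. h \<bullet> q y)) (at y)"
      by (auto intro!: derivative_eq_intros w[OF that, unfolded gderiv_def])
    from has_derivative_compose[OF this sq] have "((\<lambda>y. sqrt (w y + \<epsilon>)) has_derivative (\<lambda>h. inverse (z y) / 2 * (h \<bullet> q y))) (at y)" .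
    moreover have "(\<lambda>h. inverse (z y) / 2 * (h \<bullet> q y)) = (\<lambda>h. h \<bullet> inverse (2 * z y) *\<^sub>R q y)"
      by (rule ext) simp
    ultimately show ?thesis unfolding gderiv_def z_def[abs_def] by simp
  qed
  then show "GDERIV (\<lambda>y. sqrt (w y + \<epsilon>)) y :> inverse (2 * sqrt (w y + \<epsilon>)) *\<^sub>R q y" if "y \<in> B" for y
    using that unfolding z_def[abs_def] by blast
  \<comment> \<open>The weight is the derivative of the square root at
    \<open>w + \<epsilon>\<close>, so that paired with \<open>q\<close> it gives the gradient of
    \<open>z\<close>; the shift keeps it finite where \<open>w\<close> vanishes.\<close>
  define \<Psi> where "\<Psi> y = \<psi> y * inverse (2 * z y)" for y
  define G where "G y = inverse (2 * z y) *\<^sub>R g y - (\<psi> y * (2 * inverse (2 * z y) ^ 3)) *\<^sub>R q y" for y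
  have C: "C1_supp K \<Psi> G"
  proof (rule C1_supp_extend[OF B K \<psi>(2)])
    fix y assume y: "y \<in> B"
    have nz: "2 * z y \<noteq> 0" using zpos[OF y] by simp
    have "((\<lambda>y. inverse (2 * z y)) has_derivative (\<lambda>h. - (inverse (2 * z y) * (2 * (h \<bullet> inverse (2 * z y) *\<^sub>R q y)) * inverse (2 * z y)))) (at y)"
      by (rule Deriv.has_derivative_inverse[where f="\<lambda>y. 2 * z y" and x=y, OF nz]) (intro has_derivative_mult_right gz[OF y, unfolded gderiv_def])
    then have "(\<Psi> has_derivative (\<lambda>h. \<psi> y * - (inverse (2 * z y) * (2 * (h \<bullet> inverse (2 * z y) *\<^sub>R q y)) * inverse (2 * z y)) + (h \<bullet> g y) * inverse (2 * z y))) (at y)"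
      unfolding \<Psi>_def[abs_def] by (intro has_derivative_mult g(1)[unfolded gderiv_def])
    moreover have "\<psi> y * - (inverse (2 * z y) * (2 * (h \<bullet> inverse (2 * z y) *\<^sub>R q y)) * inverse (2 * z y)) + (h \<bullet> g y) * inverse (2 * z y) = h \<bullet> G y" for h
    proof -
      have "p * - (i * (2 * (i * u)) * i) + v * i = i * v - p * (2 * i ^ 3) * u" for p i u v :: real
        by (simp add: power3_eq_cube)
      then show ?thesis unfolding G_def inner_diff_right inner_scaleR_right by blast
    qed
    ultimately show "GDERIV \<Psi> y :> G y" by (simp add: gderiv_def)
  next
    show "continuous_on B G" unfolding G_def
      by (intro continuous_intros continuous_on_subset[OF g(2)] q \<psi>c zc) (auto dest!: zpos)
  qed (auto simp: \<Psi>_def G_def out gout)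
  have \<Psi>0: "\<Psi> y \<ge> 0" for y
    using \<psi>(3)[of y] zpos[of y] out[of y] \<psi>(2) by (cases "y \<in> K") (auto simp: \<Psi>_def)
  have "0 \<le> (LINT y|lebesgue. D y \<bullet> G y)" by (rule weak[OF \<psi>(2) C \<Psi>0])
  also have "\<dots> \<le> (LINT y|lebesgue. inverse (2 * z y) *\<^sub>R q y \<bullet> g y + z y * (\<delta>\<^sup>2 / 2 * b y))"
  proof (rule integral_mono)
    show "integrable lebesgue (\<lambda>y. D y \<bullet> G y)"
    proof (rule integrable_extend_zero[OF B _ K \<psi>(2)])
      show "continuous_on B (\<lambda>y. D y \<bullet> G y)"
        using C by (intro continuous_intros D) (auto simp: C1_supp_def intro: continuous_on_subset)
    qed (simp add: C1_supp_grad_zero[OF C])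
    show "integrable lebesgue (\<lambda>y. inverse (2 * z y) *\<^sub>R q y \<bullet> g y + z y * (\<delta>\<^sup>2 / 2 * b y))"
    proof (rule integrable_extend_zero[OF B _ K \<psi>(2)])
      show "continuous_on B (\<lambda>y. inverse (2 * z y) *\<^sub>R q y \<bullet> g y + z y * (\<delta>\<^sup>2 / 2 * b y))"
        by (intro continuous_intros q zc continuous_on_subset[OF g(2)] continuous_on_subset[OF b(1)]) (auto dest!: zpos)
    qed (simp add: gout b(3))
    fix y
    show "D y \<bullet> G y \<le> inverse (2 * z y) *\<^sub>R q y \<bullet> g y + z y * (\<delta>\<^sup>2 / 2 * b y)"
    proof (cases "y \<in> K")
      case False
      then show ?thesis using C1_supp_grad_zero[OF C False] gout[OF False] b(3)[OF False] by simp
    next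
      case True
      then have y: "y \<in> B" using \<psi>(2) by auto
      have z: "z y > 0" by (rule zpos[OF y])
      define E where "E = D y - q y"
      define X where "X = norm (q y)"
      define Y where "Y = norm (g y)"
      have nE: "norm E \<le> \<delta> * X" using D(2)[OF y] by (simp add: E_def X_def)
      have Eg: "E \<bullet> g y \<le> \<delta> * X * Y"
        using order_trans[OF norm_cauchy_schwarz mult_right_mono[OF nE norm_ge_zero]] by (simp add: Y_def)
      have Eq: "- (E \<bullet> q y) \<le> \<delta> * X * X"
        using order_trans[OF norm_cauchy_schwarz[of "- E" "q y"] mult_right_mono[of "norm (- E)" _ "norm (q y)"]] nE by (simp add: X_def)
      have X0: "X \<ge> 0" "Y \<ge> 0" by (auto simp: X_def Y_def)
      \<comment> \<open>\<open>P\<close> is half of the good term coming from the concavity of the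
        square root, \<open>R\<close> is the error charged to the test function.\<close>
      define P where "P = \<psi> y * X\<^sup>2 * inverse (2 * z y) ^ 3"
      define R where "R = z y * (\<delta>\<^sup>2 / 2 * b y)"
      have "0 \<le> inverse (2 * z y)" using z by simp
      then have PR: "P \<ge> 0" "R \<ge> 0" unfolding P_def R_def
        by (intro mult_nonneg_nonneg zero_le_power divide_nonneg_nonneg zero_le_power2 \<psi>(3) b(2) less_imp_le[OF z] zero_le_numeral; assumption)+
      \<comment> \<open>Arithmetic-geometric mean in the form \<open>4 P R \<le> (P + R)^2\<close>.
        The bound of \<open>|g|^2\<close> by \<open>b \<psi>\<close> supplies the factor
        \<open>\<psi>\<close> of \<open>P\<close> without any division by
        \<open>\<psi>\<close>.\<close>
      have "(\<delta> * X * Y * inverse (2 * z y))\<^sup>2 \<le> (P + R)\<^sup>2"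
      proof -
        have "(\<delta> * X * Y * inverse (2 * z y))\<^sup>2 = (\<delta>\<^sup>2 * X\<^sup>2 * (inverse (2 * z y))\<^sup>2) * Y\<^sup>2"
          by (simp only: power_mult_distrib mult_ac)
        also have "\<dots> \<le> (\<delta>\<^sup>2 * X\<^sup>2 * (inverse (2 * z y))\<^sup>2) * (b y * \<psi> y)"
          unfolding Y_def by (intro mult_left_mono b(4) mult_nonneg_nonneg zero_le_power2)
        also have "\<dots> = 4 * P * R"
        proof -
          have iz: "2 * (inverse (2 * z y) * z y) = 1" using z by simp
          have gen: "4 * (p * x * i ^ 3) * (t * (d / 2 * c)) = (d * x * i\<^sup>2) * (c * p) * (2 * (i * t))" for p x i t d c :: real
            by (simp add: power3_eq_cube power2_eq_square)
          show ?thesis unfolding P_def R_def gen iz by simp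
        qed
        also have "\<dots> \<le> (P + R)\<^sup>2"
          using zero_le_power2[of "P - R"] by (simp add: power2_eq_square algebra_simps)
        finally show ?thesis .
      qed
      then have am: "\<delta> * X * Y * inverse (2 * z y) \<le> P + R"
        by (rule power2_le_imp_le[OF _ add_nonneg_nonneg[OF PR]])
      have "D y \<bullet> G y = inverse (2 * z y) * (q y \<bullet> g y) + inverse (2 * z y) * (E \<bullet> g y)
          - (\<psi> y * (2 * inverse (2 * z y) ^ 3)) * X\<^sup>2 + (\<psi> y * (2 * inverse (2 * z y) ^ 3)) * (- (E \<bullet> q y))"
      proof -
        have "D y = q y + E" by (simp add: E_def)
        then have "D y \<bullet> g y = q y \<bullet> g y + E \<bullet> g y" "D y \<bullet> q y = X\<^sup>2 + E \<bullet> q y"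
          by (simp_all add: inner_add_left X_def power2_norm_eq_inner)
        moreover have "D y \<bullet> G y = inverse (2 * z y) * (D y \<bullet> g y) - (\<psi> y * (2 * inverse (2 * z y) ^ 3)) * (D y \<bullet> q y)"
          by (simp only: G_def inner_diff_right inner_scaleR_right)
        ultimately show ?thesis by (simp only: distrib_left)
      qed
      also have "\<dots> \<le> inverse (2 * z y) * (q y \<bullet> g y) + inverse (2 * z y) * (\<delta> * X * Y)
          - (\<psi> y * (2 * inverse (2 * z y) ^ 3)) * X\<^sup>2 + (\<psi> y * (2 * inverse (2 * z y) ^ 3)) * (1/2 * X * X)"
      proof -
        \<comment> \<open>By \<open>\<delta> \<le> 1/2\<close> this error consumes at most half of
          the good term; the other half is \<open>P\<close>.\<close>
        have "\<delta> * X * X \<le> 1/2 * X * X" by (intro mult_right_mono \<delta> X0)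
        then have "- (E \<bullet> q y) \<le> 1/2 * X * X" using Eq by linarith
        then have "(\<psi> y * (2 * inverse (2 * z y) ^ 3)) * (- (E \<bullet> q y)) \<le> (\<psi> y * (2 * inverse (2 * z y) ^ 3)) * (1/2 * X * X)"
          using \<open>0 \<le> inverse (2 * z y)\<close> by (intro mult_left_mono mult_nonneg_nonneg zero_le_power \<psi>(3) zero_le_numeral)
        moreover have "inverse (2 * z y) * (E \<bullet> g y) \<le> inverse (2 * z y) * (\<delta> * X * Y)"
          using \<open>0 \<le> inverse (2 * z y)\<close> by (intro mult_left_mono Eg)
        ultimately show ?thesis by linarith
      qed
      also have "\<dots> = inverse (2 * z y) * (q y \<bullet> g y) + \<delta> * X * Y * inverse (2 * z y) - P"
      proof -
        have "(p * (2 * i ^ 3)) * X\<^sup>2 - (p * (2 * i ^ 3)) * (1/2 * X * X) = p * X\<^sup>2 * i ^ 3" for p i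
          by (simp add: power2_eq_square)
        from this[of "\<psi> y" "inverse (2 * z y)"] show ?thesis unfolding P_def
          by (simp only: mult.commute[of "inverse (2 * z y)"])
      qed
      also have "\<dots> \<le> inverse (2 * z y) * (q y \<bullet> g y) + R" using am by linarith
      finally show ?thesis by (simp add: R_def)
    qed
  qed
  also have "\<dots> = (LINT y|lebesgue. inverse (2 * z y) *\<^sub>R q y \<bullet> g y) + (LINT y|lebesgue. z y * (\<delta>\<^sup>2 / 2 * b y))"
  proof (rule Bochner_Integration.integral_add)
    show "integrable lebesgue (\<lambda>y. inverse (2 * z y) *\<^sub>R q y \<bullet> g y)"
      by (rule integrable_extend_zero[OF B _ K \<psi>(2)])
         (auto simp: gout dest!: zpos intro!: continuous_intros q zc continuous_on_subset[OF g(2)])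
    show "integrable lebesgue (\<lambda>y. z y * (\<delta>\<^sup>2 / 2 * b y))"
      by (rule integrable_extend_zero[OF B _ K \<psi>(2)])
         (auto simp: b(3) intro!: continuous_intros zc continuous_on_subset[OF b(1)])
  qed
  finally show "0 \<le> (LINT y|lebesgue. inverse (2 * sqrt (w y + \<epsilon>)) *\<^sub>R q y \<bullet> g y) + (LINT y|lebesgue. sqrt (w y + \<epsilon>) * (\<delta>\<^sup>2 / 2 * b y))"
    by (simp add: z_def)
qed

section \<open>The radial barrier and its differential inequality\<close>

lemma DERIV_max0_power:
  "((\<lambda>t::real. (max 0 t) ^ (n + 2)) has_real_derivative real (n + 2) * (max 0 t) ^ (n + 1)) (at t)"
proof -
  consider "t > 0" | "t < 0" | "t = 0" by linarith
  then show ?thesis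
  proof cases
    case 1
    have "((\<lambda>t. t ^ (n + 2)) has_real_derivative real (n + 2) * t ^ (n + 1)) (at t)"
      using DERIV_pow[of "n + 2" t] by simp
    then have "((\<lambda>t. (max 0 t) ^ (n + 2)) has_real_derivative real (n + 2) * t ^ (n + 1)) (at t)"
      by (rule has_field_derivative_transform_within_open[where S="{0<..}"]) (use 1 in auto)
    then show ?thesis using 1 by simp
  next
    case 2
    have "((\<lambda>t. 0) has_real_derivative 0) (at t)" by simp
    then have "((\<lambda>t. (max 0 t) ^ (n + 2)) has_real_derivative 0) (at t)"
      by (rule has_field_derivative_transform_within_open[where S="{..<0}"]) (use 2 in auto)
    then show ?thesis using 2 by simp
  next
    case 3
    have "((\<lambda>y. (max 0 y) ^ (n + 2) / y) \<longlongrightarrow> 0) (at (0::real))"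
    proof (rule Lim_null_comparison)
      show "\<forall>\<^sub>F y in at 0. norm ((max 0 y) ^ (n + 2) / y) \<le> \<bar>y\<bar> ^ (n + 1)"
      proof (rule eventually_mono[OF eventually_neq_at_within[of 0]])
        fix y :: real assume "y \<noteq> 0"
        then show "norm ((max 0 y) ^ (n + 2) / y) \<le> \<bar>y\<bar> ^ (n + 1)"
          using zero_le_power[of "\<bar>y\<bar>" "n + 1"] by (cases "y > 0") (simp_all add: max_def)
      qed
      show "((\<lambda>y::real. \<bar>y\<bar> ^ (n + 1)) \<longlongrightarrow> 0) (at 0)"
        by (auto intro!: tendsto_eq_intros)
    qed
    then show ?thesis using 3 by (simp add: DERIV_def)
  qed
qed

text \<open>The test function of the strong minimum principle is \<open>\<psi>(y) = (cutoff b (\<rho>\<^sup>2) \<sigma> s)\<^sup>3\<close> with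
  \<open>s = |y - y\<^sub>0|\<^sup>2\<close> and \<open>6 b = n - 2 + 1/4\<close>; \<open>barrier1\<close> and \<open>barrier2\<close> are its first two
  derivatives in \<open>s\<close>. The cube makes it of class \<open>C\<^sup>2\<close> across the sphere \<open>s = \<rho>\<^sup>2\<close>.\<close>

definition cutoff :: "real \<Rightarrow> real \<Rightarrow> real \<Rightarrow> real \<Rightarrow> real" where
  "cutoff b c \<sigma> s = max 0 ((s + \<sigma>) powr (- b) - c powr (- b))"

definition barrier1 :: "real \<Rightarrow> real \<Rightarrow> real \<Rightarrow> real \<Rightarrow> real" where
  "barrier1 b c \<sigma> s = 3 * (cutoff b c \<sigma> s)\<^sup>2 * (- b * (s + \<sigma>) powr (- b - 1))"

definition barrier2 :: "real \<Rightarrow> real \<Rightarrow> real \<Rightarrow> real \<Rightarrow> real" where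
  "barrier2 b c \<sigma> s = 6 * cutoff b c \<sigma> s * (b * (s + \<sigma>) powr (- b - 1))\<^sup>2
     + 3 * (cutoff b c \<sigma> s)\<^sup>2 * (b * (b + 1) * (s + \<sigma>) powr (- b - 2))"

lemma barrier_derivs:
  assumes "\<sigma> > 0" "s \<ge> 0"
  shows "((\<lambda>s. (cutoff b c \<sigma> s) ^ 3) has_real_derivative barrier1 b c \<sigma> s) (at s)"
    and "(barrier1 b c \<sigma> has_real_derivative barrier2 b c \<sigma> s) (at s)"
proof -
  have k: "((\<lambda>s. (s + \<sigma>) powr a - C) has_real_derivative a * (s + \<sigma>) powr (a - 1)) (at s)" for a C
    using assms by (auto intro!: derivative_eq_intros)
  note k1 = k[of "- b" "c powr (- b)"]
  have c3: "((\<lambda>s. (cutoff b c \<sigma> s) ^ 3) has_real_derivative 3 * (cutoff b c \<sigma> s)\<^sup>2 * (- b * (s + \<sigma>) powr (- b - 1))) (at s)"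
    using DERIV_chain2[OF DERIV_max0_power[of 1] k1] unfolding cutoff_def[abs_def] by (simp add: numeral_eq_Suc)
  show "((\<lambda>s. (cutoff b c \<sigma> s) ^ 3) has_real_derivative barrier1 b c \<sigma> s) (at s)"
    using c3 by (simp add: barrier1_def)
  have c2: "((\<lambda>s. (cutoff b c \<sigma> s)\<^sup>2) has_real_derivative 2 * (cutoff b c \<sigma> s) * (- b * (s + \<sigma>) powr (- b - 1))) (at s)"
    using DERIV_chain2[OF DERIV_max0_power[of 0] k1] unfolding cutoff_def[abs_def] by (simp add: numeral_eq_Suc)
  have d2: "((\<lambda>s. - b * (s + \<sigma>) powr (- b - 1)) has_real_derivative - b * ((- b - 1) * (s + \<sigma>) powr (- b - 2))) (at s)"
  proof (rule DERIV_cmult)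
    have e: "- b - 1 - 1 = - b - (2::real)" by simp
    show "((\<lambda>s. (s + \<sigma>) powr (- b - 1)) has_real_derivative (- b - 1) * (s + \<sigma>) powr (- b - 2)) (at s)"
      using k[of "- b - 1" 0] unfolding e diff_zero .
  qed
  have "((\<lambda>s. 3 * (cutoff b c \<sigma> s)\<^sup>2 * (- b * (s + \<sigma>) powr (- b - 1))) has_real_derivative
     3 * (2 * (cutoff b c \<sigma> s) * (- b * (s + \<sigma>) powr (- b - 1))) * (- b * (s + \<sigma>) powr (- b - 1))
      + (- b * ((- b - 1) * (s + \<sigma>) powr (- b - 2))) * (3 * (cutoff b c \<sigma> s)\<^sup>2)) (at s)"
    by (rule DERIV_mult[OF DERIV_cmult[OF c2] d2])
  then show "(barrier1 b c \<sigma> has_real_derivative barrier2 b c \<sigma> s) (at s)"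
    unfolding barrier1_def[abs_def] barrier2_def
    by (rule DERIV_cong) (simp add: power2_eq_square algebra_simps)
qed

lemma cutoff_continuous: "\<sigma> > 0 \<Longrightarrow> continuous_on {0..} (cutoff b c \<sigma>)"
  unfolding cutoff_def[abs_def] by (intro continuous_intros) auto

lemma barrier2_continuous: "\<sigma> > 0 \<Longrightarrow> continuous_on {0..} (barrier2 b c \<sigma>)"
  unfolding barrier2_def[abs_def] by (intro continuous_intros cutoff_continuous) auto

lemma cutoff_zero: "b \<ge> 0 \<Longrightarrow> c > 0 \<Longrightarrow> \<sigma> \<ge> 0 \<Longrightarrow> s \<ge> c \<Longrightarrow> cutoff b c \<sigma> s = 0"
  unfolding cutoff_def using powr_mono2'[of "- b" c "s + \<sigma>"] by simp

text \<open>\<open>T\<close>, \<open>r\<close> and \<open>m\<close> stand for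
  \<open>(s + \<sigma>) powr (- b)\<close>, \<open>1 / (s + \<sigma>)\<close> and the value of the
  cutoff. Once the common factor \<open>3 m b T r^2\<close> is taken out, the remaining inequality
  \<open>key\<close> is affine in \<open>m\<close>, so only the ends of
  \<open>0 \<le> m \<le> T\<close> matter.\<close>

lemma barrier_algebra:
  fixes n s \<sigma> m T r b \<kappa> :: real
  assumes n: "n \<ge> 2" and b: "b = (n - 2 + 1/4) / 6" and \<kappa>: "0 \<le> \<kappa>" "\<kappa> \<le> 1 / (8 * n\<^sup>2)"
    and s: "s \<ge> 0" and \<sigma>: "\<sigma> \<ge> 0" and m: "0 \<le> m" "m \<le> T" and r: "r * (s + \<sigma>) = 1"
  shows "4 * s * (6 * m * (b * (T * r))\<^sup>2 + 3 * m\<^sup>2 * (b * (b + 1) * (T * r\<^sup>2)))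
       + 2 * n * (3 * m\<^sup>2 * (- b * (T * r))) - \<kappa> * (36 * s * m * (b * (T * r))\<^sup>2)
     \<ge> 3 * m * (b * (T * r)\<^sup>2) * (s / 4 - 2 * n * \<sigma>)"
proof -
  define Y where "Y = 4 * s * (b + 1) - 2 * n * (s + \<sigma>)"
  have b0: "b \<ge> 1/24" using n b by simp
  have b12: "12 * b = 2 * n - 7/2" using b by simp
  have T: "T \<ge> 0" using m by linarith
  have "4 \<le> n\<^sup>2" using power_mono[OF n, of 2] by simp
  then have "1 / (8 * n\<^sup>2) \<le> 1 / (8 * 4)"
    by (intro divide_left_mono mult_left_mono mult_pos_pos) auto
  then have \<kappa>1: "\<kappa> \<le> 1/32" using \<kappa> by linarith
  have \<kappa>2: "12 * \<kappa> * b \<le> 1/4"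
  proof -
    have "12 * \<kappa> * b \<le> 12 * (1 / (8 * n\<^sup>2)) * (n / 6)"
      using \<kappa> b n b0 by (intro mult_mono) auto
    also have "\<dots> = 1 / (4 * n)" using n by (simp add: power2_eq_square)
    also have "\<dots> \<le> 1/4" using n by (simp add: field_simps)
    finally show ?thesis .
  qed
  \<comment> \<open>For \<open>Y \<ge> 0\<close> the worst case is \<open>m = 0\<close>, and
    \<open>b \<ge> 1/24\<close>, its value at \<open>n = 2\<close>, suffices. For
    \<open>Y < 0\<close> it is \<open>m = T\<close>: there \<open>12 b + 4 - 2 n = 1/2\<close>,
    twice the excess \<open>1/4\<close> in the exponent, and \<open>12 \<kappa> b\<close> takes away
    at most half of it.\<close>
  have key: "T * (s / 4 - 2 * n * \<sigma>) \<le> m * Y + (8 - 12 * \<kappa>) * s * b * T"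
  proof (cases "Y \<ge> 0")
    case True
    have "(8 - 12 * \<kappa>) * b \<ge> 7 * (1/24)" using \<kappa>1 b0 by (intro mult_mono) auto
    then have "1/4 \<le> (8 - 12 * \<kappa>) * b" by linarith
    then have "(1/4) * (s * T) \<le> ((8 - 12 * \<kappa>) * b) * (s * T)" using s T by (intro mult_right_mono) auto
    moreover have "0 \<le> m * Y" using m True by simp
    moreover have "T * (s / 4 - 2 * n * \<sigma>) \<le> T * (s / 4)"
      using T n \<sigma> by (intro mult_left_mono) auto
    moreover have "T * (s / 4) = (1/4) * (s * T)" "((8 - 12 * \<kappa>) * b) * (s * T) = (8 - 12 * \<kappa>) * s * b * T" by simp_all
    ultimately show ?thesis by linarith
  next
    case False
    then have "T * Y \<le> m * Y" using m by (intro mult_right_mono_neg) auto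
    moreover have "s / 4 - 2 * n * \<sigma> \<le> Y + (8 - 12 * \<kappa>) * s * b"
    proof -
      have "Y + (8 - 12 * \<kappa>) * s * b = s * (12 * b + 4 - 2 * n - 12 * \<kappa> * b) - 2 * n * \<sigma>"
        by (simp add: Y_def algebra_simps)
      moreover have "12 * b + 4 - 2 * n - 12 * \<kappa> * b \<ge> 1/4" using \<kappa>2 b12 by linarith
      then have "s * (12 * b + 4 - 2 * n - 12 * \<kappa> * b) \<ge> s * (1/4)" using s by (intro mult_left_mono) auto
      ultimately show ?thesis by linarith
    qed
    then have "T * (s / 4 - 2 * n * \<sigma>) \<le> T * (Y + (8 - 12 * \<kappa>) * s * b)" using T by (intro mult_left_mono) auto
    ultimately show ?thesis by (simp add: algebra_simps)
  qed
  have "3 * m * (b * (T * r)\<^sup>2) * (s / 4 - 2 * n * \<sigma>) = (3 * m * b * T * r\<^sup>2) * (T * (s / 4 - 2 * n * \<sigma>))"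
    by (simp add: power2_eq_square)
  also have "\<dots> \<le> (3 * m * b * T * r\<^sup>2) * (m * Y + (8 - 12 * \<kappa>) * s * b * T)"
    using m b0 T by (intro mult_left_mono key mult_nonneg_nonneg zero_le_power2) auto
  also have "\<dots> = 4 * s * (6 * m * (b * (T * r))\<^sup>2 + 3 * m\<^sup>2 * (b * (b + 1) * (T * r\<^sup>2)))
       + 2 * n * (3 * m\<^sup>2 * (- b * (T * (r * (r * (s + \<sigma>)))))) - \<kappa> * (36 * s * m * (b * (T * r))\<^sup>2)"
    unfolding Y_def by (simp add: power2_eq_square algebra_simps)
  also have "r * (r * (s + \<sigma>)) = r" using r by simp
  finally show ?thesis .
qed

text \<open>\<open>\<Delta>\<psi> - \<kappa> |\<nabla>\<psi>|\<^sup>2/\<psi>\<close> for this \<open>\<psi>\<close>, where \<open>\<kappa> = \<delta>\<^sup>2/2\<close> and \<open>\<delta> = 1/(2n)\<close>.\<close>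

definition barrierQ :: "real \<Rightarrow> real \<Rightarrow> real \<Rightarrow> real \<Rightarrow> real \<Rightarrow> real" where
  "barrierQ n b c \<sigma> s = 4 * s * barrier2 b c \<sigma> s + 2 * n * barrier1 b c \<sigma> s
     - 1 / (8 * n\<^sup>2) * (36 * s * cutoff b c \<sigma> s * (b * (s + \<sigma>) powr (- b - 1))\<^sup>2)"

lemma cutoff_bounds:
  "0 \<le> cutoff b c \<sigma> s" "cutoff b c \<sigma> s \<le> (s + \<sigma>) powr (- b)"
  by (auto simp: cutoff_def)

text \<open>The last factor isolates the sign: \<open>s / 4 - 2 n \<sigma>\<close> is nonnegative
  once \<open>s \<ge> 8 n \<sigma>\<close>, so the smoothing can spoil the barrier only in a core
  whose radius is of order \<open>sqrt \<sigma>\<close>.\<close>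

lemma barrierQ_ge:
  assumes n: "n \<ge> 2" and b: "b = (n - 2 + 1/4) / 6" and s: "s \<ge> 0" and \<sigma>: "\<sigma> > 0"
  shows "barrierQ n b c \<sigma> s \<ge> 3 * cutoff b c \<sigma> s * (b * ((s + \<sigma>) powr (- b) / (s + \<sigma>))\<^sup>2) * (s / 4 - 2 * n * \<sigma>)"
proof -
  define T where "T = (s + \<sigma>) powr (- b)"
  define r where "r = 1 / (s + \<sigma>)"
  have pos: "s + \<sigma> > 0" using s \<sigma> by simp
  have 1: "(s + \<sigma>) powr (- b - 1) = T * r"
    using pos powr_diff[of "s + \<sigma>" "- b" 1] by (simp add: T_def r_def)
  have 2: "(s + \<sigma>) powr (- b - 2) = T * r\<^sup>2"
    using pos powr_diff[of "s + \<sigma>" "- b" 2] by (simp add: T_def r_def power_divide)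
  have m: "0 \<le> cutoff b c \<sigma> s" "cutoff b c \<sigma> s \<le> T" unfolding T_def by (rule cutoff_bounds)+
  have "r * (s + \<sigma>) = 1" using pos by (simp add: r_def)
  from barrier_algebra[OF n b _ _ s less_imp_le[OF \<sigma>] m this, of "1 / (8 * n\<^sup>2)"]
  have "3 * cutoff b c \<sigma> s * (b * (T * r)\<^sup>2) * (s / 4 - 2 * n * \<sigma>) \<le> barrierQ n b c \<sigma> s"
    unfolding barrierQ_def barrier1_def barrier2_def 1 2 by simp
  then show ?thesis by (simp add: T_def r_def)
qed

lemma barrierQ_nonneg:
  assumes n: "n \<ge> 2" and b: "b = (n - 2 + 1/4) / 6" and \<sigma>: "\<sigma> > 0" and s: "s \<ge> 8 * n * \<sigma>"
  shows "barrierQ n b c \<sigma> s \<ge> 0"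
proof -
  have "0 \<le> 8 * n * \<sigma>" using n \<sigma> by simp
  then have s0: "s \<ge> 0" using s by linarith
  have "0 \<le> s / 4 - 2 * n * \<sigma>" using s by simp
  moreover have "0 \<le> b" using b n by simp
  ultimately have "0 \<le> 3 * cutoff b c \<sigma> s * (b * ((s + \<sigma>) powr (- b) / (s + \<sigma>))\<^sup>2) * (s / 4 - 2 * n * \<sigma>)"
    by (intro mult_nonneg_nonneg cutoff_bounds zero_le_power2) auto
  then show ?thesis using barrierQ_ge[OF n b s0 \<sigma>, of c] by linarith
qed

text \<open>Only the summand \<open>- 2 n \<sigma>\<close> is negative. It is multiplied by three
  factors bounded by \<open>(s + \<sigma>) powr (- b)\<close> and by
  \<open>(s + \<sigma>)^(-2)\<close>; all are largest at \<open>s = 0\<close>, whence the exponent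
  \<open>- 3 b - 1\<close>.\<close>

lemma barrierQ_lower:
  assumes n: "n \<ge> 2" and b: "b = (n - 2 + 1/4) / 6" and \<sigma>: "\<sigma> > 0" and s: "s \<ge> 0"
  shows "barrierQ n b c \<sigma> s \<ge> - (6 * n * b * \<sigma> powr (- 3 * b - 1))"
proof -
  have b0: "0 \<le> b" using b n by simp
  define T where "T = (s + \<sigma>) powr (- b)"
  have T: "0 \<le> T" "T \<le> \<sigma> powr (- b)" using b0 s \<sigma> by (auto simp: T_def intro!: powr_mono2')
  have m: "0 \<le> cutoff b c \<sigma> s" "cutoff b c \<sigma> s \<le> \<sigma> powr (- b)"
    using cutoff_bounds[of b c \<sigma> s] T by (auto simp: T_def)
  have "T / (s + \<sigma>) \<le> \<sigma> powr (- b) / \<sigma>" using T s \<sigma> by (intro frac_le) auto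
  moreover have "0 \<le> T / (s + \<sigma>)" using T s \<sigma> by simp
  ultimately have q: "(T / (s + \<sigma>))\<^sup>2 \<le> (\<sigma> powr (- b) / \<sigma>)\<^sup>2" by (rule power_mono)
  have "3 * cutoff b c \<sigma> s * (b * (T / (s + \<sigma>))\<^sup>2) * (2 * n * \<sigma>) \<le> 3 * \<sigma> powr (- b) * (b * (\<sigma> powr (- b) / \<sigma>)\<^sup>2) * (2 * n * \<sigma>)"
    using b0 n \<sigma> by (intro mult_mono mult_left_mono m q mult_nonneg_nonneg zero_le_power2) auto
  also have "\<dots> = 6 * n * b * \<sigma> powr (- 3 * b - 1)"
  proof -
    have "\<sigma> powr (- 3 * b - 1) = \<sigma> powr (- b) * \<sigma> powr (- b) * \<sigma> powr (- b) / \<sigma>"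
      using \<sigma> by (simp add: powr_diff flip: powr_add)
    then show ?thesis using \<sigma> by (simp add: power2_eq_square)
  qed
  finally have A: "3 * cutoff b c \<sigma> s * (b * (T / (s + \<sigma>))\<^sup>2) * (2 * n * \<sigma>) \<le> 6 * n * b * \<sigma> powr (- 3 * b - 1)" .
  have "0 \<le> 3 * cutoff b c \<sigma> s * (b * (T / (s + \<sigma>))\<^sup>2) * (s / 4)"
    using b0 s m by (intro mult_nonneg_nonneg zero_le_power2) auto
  moreover have "3 * cutoff b c \<sigma> s * (b * (T / (s + \<sigma>))\<^sup>2) * (s / 4 - 2 * n * \<sigma>) =
     3 * cutoff b c \<sigma> s * (b * (T / (s + \<sigma>))\<^sup>2) * (s / 4) - 3 * cutoff b c \<sigma> s * (b * (T / (s + \<sigma>))\<^sup>2) * (2 * n * \<sigma>)"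
    by (rule right_diff_distrib)
  ultimately show ?thesis using barrierQ_ge[OF n b s \<sigma>, of c] A unfolding T_def by linarith
qed

text \<open>Uniformity in \<open>\<sigma>\<close> is the point. The midpoint \<open>\<tau>\<close>
  leaves room between \<open>s2\<close> and \<open>c\<close>, so the cutoff stays above
  \<open>m0\<close> for all small \<open>\<sigma>\<close>, and
  \<open>\<sigma> \<le> s1 / (16 n)\<close> preserves half of \<open>s1 / 4\<close> after the loss
  \<open>2 n \<sigma>\<close>.\<close>

lemma barrierQ_positive:
  assumes n: "n \<ge> 2" and b: "b = (n - 2 + 1/4) / 6" and s: "0 < s1" "s1 \<le> s2" "s2 < c"
  shows "\<exists>\<eta>>0. \<exists>\<sigma>0>0. \<forall>\<sigma> s. 0 < \<sigma> \<longrightarrow> \<sigma> \<le> \<sigma>0 \<longrightarrow> s1 \<le> s \<longrightarrow> s \<le> s2 \<longrightarrow> barrierQ n b c \<sigma> s \<ge> \<eta>"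
proof -
  have b0: "0 < b" using b n by simp
  define \<tau> where "\<tau> = (s2 + c) / 2"
  have \<tau>: "s2 < \<tau>" "\<tau> < c" "0 < \<tau>" using s by (auto simp: \<tau>_def)
  define m0 where "m0 = \<tau> powr (- b) - c powr (- b)"
  have m0: "m0 > 0" using powr_less_mono2_neg[of "- b" \<tau> c] b0 \<tau> by (simp add: m0_def)
  define \<eta> where "\<eta> = 3 * m0 * (b * (\<tau> powr (- b) / \<tau>)\<^sup>2) * (s1 / 8)"
  have \<eta>: "\<eta> > 0" unfolding \<eta>_def using m0 b0 s \<tau> by (intro mult_pos_pos zero_less_power) auto
  define \<sigma>0 where "\<sigma>0 = min (\<tau> - s2) (s1 / (16 * n))"
  have "\<sigma>0 > 0" using \<tau> s n by (simp add: \<sigma>0_def)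
  moreover have "barrierQ n b c \<sigma> s \<ge> \<eta>" if h: "0 < \<sigma>" "\<sigma> \<le> \<sigma>0" "s1 \<le> s" "s \<le> s2" for \<sigma> s
  proof -
    have t: "0 < s + \<sigma>" "s + \<sigma> \<le> \<tau>" using h s by (auto simp: \<sigma>0_def)
    have T: "\<tau> powr (- b) \<le> (s + \<sigma>) powr (- b)" using t b0 by (intro powr_mono2') auto
    then have m: "m0 \<le> cutoff b c \<sigma> s" by (simp add: m0_def cutoff_def)
    have "\<tau> powr (- b) / \<tau> \<le> (s + \<sigma>) powr (- b) / (s + \<sigma>)" using T t by (intro frac_le) auto
    then have q: "(\<tau> powr (- b) / \<tau>)\<^sup>2 \<le> ((s + \<sigma>) powr (- b) / (s + \<sigma>))\<^sup>2" using \<tau> by (intro power_mono) auto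
    have "\<sigma> \<le> s1 / (16 * n)" using h by (simp add: \<sigma>0_def)
    then have "2 * n * \<sigma> \<le> 2 * n * (s1 / (16 * n))" using n by (intro mult_left_mono) auto
    also have "\<dots> = s1 / 8" using n by simp
    finally have d: "s1 / 8 \<le> s / 4 - 2 * n * \<sigma>" using h(3) by linarith
    have "\<eta> \<le> 3 * cutoff b c \<sigma> s * (b * ((s + \<sigma>) powr (- b) / (s + \<sigma>))\<^sup>2) * (s / 4 - 2 * n * \<sigma>)"
      unfolding \<eta>_def using s m0 b0
      by (intro mult_mono d m q mult_nonneg_nonneg zero_le_power2 cutoff_bounds) auto
    then show ?thesis using barrierQ_ge[OF n b _ h(1), of s c] h(3) s(1) by linarith
  qed
  ultimately show ?thesis using \<eta> by blast
qed

lemma barrierQ_continuous: "\<sigma> > 0 \<Longrightarrow> continuous_on {0..} (barrierQ n b c \<sigma>)"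
  unfolding barrierQ_def[abs_def] barrier1_def[abs_def]
  by (intro continuous_intros cutoff_continuous barrier2_continuous) auto

lemma barrier_zero:
  assumes "b \<ge> 0" "c > 0" "\<sigma> \<ge> 0" "s \<ge> c"
  shows "barrier1 b c \<sigma> s = 0" "barrier2 b c \<sigma> s = 0" "barrierQ n b c \<sigma> s = 0"
  using cutoff_zero[OF assms] by (simp_all add: barrier1_def barrier2_def barrierQ_def)

text \<open>The inequality for the square root with \<open>\<delta> = 1 / (2 n)\<close> and the
  cubed cutoff is integrated by parts, so that all derivatives fall on explicit radial functions;
  then the shift \<open>\<epsilon>\<close> is sent to 0.\<close>

lemma weighted_barrier_integral:
  fixes w :: "'a::euclidean_space \<Rightarrow> real"
  defines "n \<equiv> real DIM('a)"
  assumes w: "\<And>y. y \<in> ball y0 R \<Longrightarrow> GDERIV w y :> q y" and q: "continuous_on (ball y0 R) q"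
    and w0: "\<And>y. y \<in> ball y0 R \<Longrightarrow> w y \<ge> 0"
    and D: "continuous_on (ball y0 R) D" "\<And>y. y \<in> ball y0 R \<Longrightarrow> norm (D y - q y) \<le> 1 / (2 * n) * norm (q y)"
    and weak: "\<And>K \<Psi> g. K \<subseteq> ball y0 R \<Longrightarrow> C1_supp K \<Psi> g \<Longrightarrow> (\<And>y. \<Psi> y \<ge> 0) \<Longrightarrow> 0 \<le> (LINT y|lebesgue. D y \<bullet> g y)"
    and b: "b > 0" and \<rho>: "0 < \<rho>" "\<rho> < R" and \<sigma>: "\<sigma> > 0"
  shows "0 \<le> (LINT y|lebesgue. - (sqrt (w y) * barrierQ n b (\<rho>\<^sup>2) \<sigma> ((y - y0) \<bullet> (y - y0))))"
proof -
  define s where "s y = (y - y0) \<bullet> (y - y0)" for y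
  define H' where "H' = barrier1 b (\<rho>\<^sup>2) \<sigma>"
  define H'' where "H'' = barrier2 b (\<rho>\<^sup>2) \<sigma>"
  define m where "m = cutoff b (\<rho>\<^sup>2) \<sigma>"
  define Bf where "Bf y = 36 * s y * m (s y) * (b * (s y + \<sigma>) powr (- b - 1))\<^sup>2" for y
  have c0: "\<rho>\<^sup>2 > 0" using \<rho> by simp
  have n1: "n \<ge> 1" using DIM_positive[where 'a='a] by (simp add: n_def Suc_le_eq)
  have s0: "s y \<ge> 0" for y by (simp add: s_def)
  have out: "s y \<ge> \<rho>\<^sup>2" if "y \<notin> cball y0 \<rho>" for y
  proof -
    have "\<rho> \<le> norm (y - y0)" using that by (simp add: dist_norm norm_minus_commute)
    then have "\<rho>\<^sup>2 \<le> (norm (y - y0))\<^sup>2" using \<rho> by (intro power_mono) auto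
    then show ?thesis by (simp add: power2_norm_eq_inner s_def)
  qed
  have KB: "cball y0 \<rho> \<subseteq> ball y0 R" using \<rho> by auto
  have zero: "m t = 0" "H' t = 0" "H'' t = 0" if "t \<ge> \<rho>\<^sup>2" for t
    unfolding m_def H'_def H''_def
    using cutoff_zero[of b "\<rho>\<^sup>2" \<sigma> t] barrier_zero(1,2)[of b "\<rho>\<^sup>2" \<sigma> t] that b c0 \<sigma> by simp_all
  have H: "((\<lambda>t. (m t) ^ 3) has_real_derivative H' t) (at t)" "(H' has_real_derivative H'' t) (at t)" if "t \<ge> 0" for t
    using barrier_derivs[OF \<sigma> that] by (simp_all add: m_def H'_def H''_def)
  have H''c: "continuous_on {0..} H''" unfolding H''_def by (rule barrier2_continuous[OF \<sigma>])
  have H'c: "continuous_on {0..} H'"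
    by (rule DERIV_continuous_on[OF has_field_derivative_at_within[OF H(2)]]) simp
  have mc: "continuous_on {0..} m" unfolding m_def by (rule cutoff_continuous[OF \<sigma>])
  have sc: "continuous_on A s" for A unfolding s_def by (intro continuous_intros)
  have comp: "continuous_on A (\<lambda>y. h (s y))" if "continuous_on {0..} h" for A and h :: "real \<Rightarrow> real"
    by (rule continuous_on_compose2[OF that sc]) (use s0 in auto)
  have s\<sigma>: "s y + \<sigma> \<noteq> 0" for y using s0[of y] \<sigma> by linarith
  have Bc: "continuous_on UNIV Bf" unfolding Bf_def
    by (intro continuous_intros sc comp mc ballI s\<sigma>)
  have \<psi>: "C1_supp (cball y0 \<rho>) (\<lambda>y. (m (s y)) ^ 3) (\<lambda>y. (2 * H' (s y)) *\<^sub>R (y - y0))"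
    unfolding s_def by (rule radial_C1_supp[OF H(1) H'c]) (use zero \<rho> in auto)
  have m0: "m t \<ge> 0" for t unfolding m_def by (rule cutoff_bounds)
  have wc: "continuous_on (ball y0 R) w"
    by (rule GDERIV_continuous_on[OF w])
  have Qeq: "barrierQ n b (\<rho>\<^sup>2) \<sigma> (s y) = 4 * s y * H'' (s y) + 2 * n * H' (s y) - 1 / (8 * n\<^sup>2) * Bf y" for y
    by (simp add: barrierQ_def H'_def H''_def m_def Bf_def)
  have Qc: "continuous_on A (\<lambda>y. barrierQ n b (\<rho>\<^sup>2) \<sigma> (s y))" for A
    by (rule comp[OF barrierQ_continuous[OF \<sigma>]])
  have Qout: "barrierQ n b (\<rho>\<^sup>2) \<sigma> (s y) = 0" if "y \<notin> cball y0 \<rho>" for y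
    using barrier_zero(3)[of b "\<rho>\<^sup>2" \<sigma> "s y" n] out[OF that] b c0 \<sigma> by simp
  have step: "0 \<le> (LINT y|lebesgue. - (sqrt (w y + \<epsilon>) * barrierQ n b (\<rho>\<^sup>2) \<sigma> (s y)))" if \<epsilon>: "\<epsilon> > 0" for \<epsilon>
  proof -
    define z where "z y = sqrt (w y + \<epsilon>)" for y
    have zc: "continuous_on (ball y0 R) z" unfolding z_def by (intro continuous_intros wc)
    have \<delta>: "0 \<le> 1 / (2 * n)" "1 / (2 * n) \<le> 1/2" using n1 by (auto simp: field_simps)
    \<comment> \<open>The cube pays off here: where the cutoff is positive,
      \<open>|\<nabla>\<psi>|^2 / \<psi>\<close> equals \<open>Bf\<close>, which carries one
      remaining factor of the cutoff and so extends continuously by 0.\<close>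
    have gb: "(norm ((2 * H' (s y)) *\<^sub>R (y - y0)))\<^sup>2 \<le> Bf y * (m (s y)) ^ 3" for y
    proof -
      have "(norm ((2 * H' (s y)) *\<^sub>R (y - y0)))\<^sup>2 = (2 * H' (s y))\<^sup>2 * s y"
        by (simp add: power_mult_distrib power2_norm_eq_inner s_def)
      also have "\<dots> = Bf y * (m (s y)) ^ 3"
        by (simp add: Bf_def H'_def barrier1_def m_def power_mult_distrib power2_eq_square power3_eq_cube)
      finally show ?thesis by simp
    qed
    have B0: "Bf y \<ge> 0" "y \<notin> cball y0 \<rho> \<Longrightarrow> Bf y = 0" for y
      unfolding Bf_def using zero(1)[OF out] by (auto intro!: mult_nonneg_nonneg s0 m0)
    note sup = supersolution_sqrt[OF open_ball w q w0 D \<delta> weak \<psi> KB zero_le_power[OF m0] Bc B0 gb \<epsilon>]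
    have gz: "GDERIV z y :> inverse (2 * sqrt (w y + \<epsilon>)) *\<^sub>R q y" if "y \<in> ball y0 R" for y
      unfolding z_def[abs_def] by (rule sup(1)) (use that in auto)
    have ineq: "0 \<le> (LINT y|lebesgue. inverse (2 * sqrt (w y + \<epsilon>)) *\<^sub>R q y \<bullet> ((2 * H' (s y)) *\<^sub>R (y - y0)))
        + (LINT y|lebesgue. sqrt (w y + \<epsilon>) * ((1 / (2 * n))\<^sup>2 / 2 * Bf y))"
      by (rule sup(2)) auto
    have qc: "continuous_on (ball y0 R) (\<lambda>y. inverse (2 * sqrt (w y + \<epsilon>)) *\<^sub>R q y)"
    proof (intro continuous_intros wc q ballI)
      fix y assume "y \<in> ball y0 R"
      then show "2 * sqrt (w y + \<epsilon>) \<noteq> 0" using w0[of y] \<epsilon> by simp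
    qed
    have ibp: "(LINT y|lebesgue. inverse (2 * sqrt (w y + \<epsilon>)) *\<^sub>R q y \<bullet> ((2 * H' (s y)) *\<^sub>R (y - y0))) =
      - (LINT y|lebesgue. z y * (4 * s y * H'' (s y) + 2 * n * H' (s y)))"
      unfolding s_def n_def
      by (rule radial_integration_by_parts[OF gz qc H(2) H''c zero(2,3) \<rho>]) auto
    have i1: "integrable lebesgue (\<lambda>y. z y * (4 * s y * H'' (s y) + 2 * n * H' (s y)))"
      by (rule integrable_extend_zero[OF open_ball _ compact_cball KB])
         (use zero out in \<open>auto intro!: continuous_intros zc sc comp H'c H''c\<close>)
    have i2: "integrable lebesgue (\<lambda>y. z y * ((1 / (2 * n))\<^sup>2 / 2 * Bf y))"
      by (rule integrable_extend_zero[OF open_ball _ compact_cball KB])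
         (use B0 in \<open>auto intro!: continuous_intros zc continuous_on_subset[OF Bc]\<close>)
    have "0 \<le> - (LINT y|lebesgue. z y * (4 * s y * H'' (s y) + 2 * n * H' (s y))) + (LINT y|lebesgue. z y * ((1 / (2 * n))\<^sup>2 / 2 * Bf y))"
      using ineq unfolding ibp by (simp add: z_def)
    also have "\<dots> = (LINT y|lebesgue. - (z y * (4 * s y * H'' (s y) + 2 * n * H' (s y))) + z y * ((1 / (2 * n))\<^sup>2 / 2 * Bf y))"
      using Bochner_Integration.integral_add[OF Bochner_Integration.integrable_minus[OF i1] i2] by simp
    also have "(\<lambda>y. - (z y * (4 * s y * H'' (s y) + 2 * n * H' (s y))) + z y * ((1 / (2 * n))\<^sup>2 / 2 * Bf y)) =
        (\<lambda>y. - (sqrt (w y + \<epsilon>) * barrierQ n b (\<rho>\<^sup>2) \<sigma> (s y)))"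
    proof
      fix y
      have "(1 / (2 * n))\<^sup>2 / 2 = 1 / (8 * n\<^sup>2)" by (simp add: power_divide power_mult_distrib)
      then show "- (z y * (4 * s y * H'' (s y) + 2 * n * H' (s y))) + z y * ((1 / (2 * n))\<^sup>2 / 2 * Bf y) =
        - (sqrt (w y + \<epsilon>) * barrierQ n b (\<rho>\<^sup>2) \<sigma> (s y))"
        unfolding Qeq z_def by (simp only: right_diff_distrib)
    qed
    finally show ?thesis .
  qed
  obtain Cw where Cw: "Cw \<ge> 0" "\<And>y. y \<in> cball y0 \<rho> \<Longrightarrow> norm (w y) \<le> Cw"
    using bounded_on_compact[OF compact_cball continuous_on_subset[OF wc KB]] by blast
  obtain CQ where CQ: "CQ \<ge> 0" "\<And>y. y \<in> cball y0 \<rho> \<Longrightarrow> norm (barrierQ n b (\<rho>\<^sup>2) \<sigma> (s y)) \<le> CQ"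
    using bounded_on_compact[OF compact_cball Qc] by blast
  have "0 \<le> (LINT y|lebesgue. - (sqrt (w y) * barrierQ n b (\<rho>\<^sup>2) \<sigma> (s y)))"
  proof (rule nonneg_integral_limit_bounded[where s="\<lambda>k y. - (sqrt (w y + inverse (real (Suc k))) * barrierQ n b (\<rho>\<^sup>2) \<sigma> (s y))", OF compact_cball])
    show "(\<lambda>y. - (sqrt (w y + inverse (real (Suc k))) * barrierQ n b (\<rho>\<^sup>2) \<sigma> (s y))) \<in> borel_measurable lebesgue" for k
      by (rule borel_measurable_integrable[OF integrable_extend_zero[OF open_ball _ compact_cball KB]])
         (use Qout in \<open>auto intro!: continuous_intros wc Qc\<close>)
    show "\<bar>- (sqrt (w y + inverse (real (Suc k))) * barrierQ n b (\<rho>\<^sup>2) \<sigma> (s y))\<bar> \<le> sqrt (Cw + 1) * CQ" if "y \<in> cball y0 \<rho>" for k y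
    proof -
      have "w y \<ge> 0" using w0 that KB by blast
      moreover have "inverse (real (Suc k)) \<le> 1" by (simp add: inverse_le_1_iff)
      ultimately have "\<bar>sqrt (w y + inverse (real (Suc k)))\<bar> \<le> sqrt (Cw + 1)"
        using Cw(2)[OF that] by simp
      then show ?thesis using CQ that Cw(1) unfolding abs_minus_cancel abs_mult by (intro mult_mono) auto
    qed
    show "- (sqrt (w y + inverse (real (Suc k))) * barrierQ n b (\<rho>\<^sup>2) \<sigma> (s y)) = 0" if "y \<notin> cball y0 \<rho>" for k y
      using Qout[OF that] by simp
    show "(\<lambda>k. - (sqrt (w y + inverse (real (Suc k))) * barrierQ n b (\<rho>\<^sup>2) \<sigma> (s y))) \<longlonglongrightarrow> - (sqrt (w y) * barrierQ n b (\<rho>\<^sup>2) \<sigma> (s y))" for y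
    proof -
      have "(\<lambda>k. - (sqrt (w y + inverse (real (Suc k))) * barrierQ n b (\<rho>\<^sup>2) \<sigma> (s y))) \<longlonglongrightarrow> - (sqrt (w y + 0) * barrierQ n b (\<rho>\<^sup>2) \<sigma> (s y))"
        by (intro tendsto_intros LIMSEQ_inverse_real_of_nat)
      then show ?thesis by simp
    qed
    show "0 \<le> (LINT y|lebesgue. - (sqrt (w y + inverse (real (Suc k))) * barrierQ n b (\<rho>\<^sup>2) \<sigma> (s y)))" for k
      by (rule step) simp
  qed
  then show ?thesis by (simp add: s_def)
qed

text \<open>If \<open>w y1 > 0\<close>, the weighted integral gains at least
  \<open>\<eta>' V\<close> near \<open>y1\<close>, independently of \<open>\<sigma>\<close>, while
  the core costs at most \<open>C \<sigma> powr (1/8)\<close>. As the whole integral cannot be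
  positive, this is absurd for small \<open>\<sigma>\<close>.\<close>

lemma strong_minimum_principle:
  fixes w :: "'a::euclidean_space \<Rightarrow> real"
  defines "n \<equiv> real DIM('a)"
  assumes dim: "DIM('a) \<ge> 2"
    and w: "\<And>y. y \<in> ball y0 R \<Longrightarrow> GDERIV w y :> q y" and q: "continuous_on (ball y0 R) q"
    and w0: "\<And>y. y \<in> ball y0 R \<Longrightarrow> w y \<ge> 0" and wy0: "w y0 = 0"
    and D: "continuous_on (ball y0 R) D" "\<And>y. y \<in> ball y0 R \<Longrightarrow> norm (D y - q y) \<le> 1 / (2 * n) * norm (q y)"
    and weak: "\<And>K \<Psi> g. K \<subseteq> ball y0 R \<Longrightarrow> C1_supp K \<Psi> g \<Longrightarrow> (\<And>y. \<Psi> y \<ge> 0) \<Longrightarrow> 0 \<le> (LINT y|lebesgue. D y \<bullet> g y)"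
    and y1: "y1 \<in> ball y0 R"
  shows "w y1 = 0"
proof (rule ccontr)
  assume "w y1 \<noteq> 0"
  then have wy1: "w y1 > 0" using w0[OF y1] by simp
  then have ne: "y1 \<noteq> y0" using wy0 by auto
  \<comment> \<open>The cutoff radius reaches beyond \<open>y1\<close> but stays inside the ball, so
    that the barrier does not vanish near \<open>y1\<close>.\<close>
  define \<rho> where "\<rho> = (R + dist y0 y1) / 2"
  have \<rho>: "dist y0 y1 < \<rho>" "\<rho> < R" "0 < \<rho>"
    using y1 ne by (auto simp: \<rho>_def add_pos_pos) (smt (verit) zero_le_dist)
  have KB: "cball y0 \<rho> \<subseteq> ball y0 R" using \<rho> by auto
  have n: "n \<ge> 2" using dim by (simp add: n_def)
  define b where "b = (n - 2 + 1/4) / 6"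
  have b: "b > 0" using n by (simp add: b_def)
  define s where "s y = (y - y0) \<bullet> (y - y0)" for y
  have s_norm: "s y = (norm (y - y0))\<^sup>2" for y by (simp add: s_def power2_norm_eq_inner)
  have s0: "s y \<ge> 0" for y by (simp add: s_def)
  have wc: "continuous_on (ball y0 R) w"
    by (rule GDERIV_continuous_on[OF w])
  obtain L where L: "L \<ge> 0" "\<And>y. y \<in> cball y0 \<rho> \<Longrightarrow> norm (q y) \<le> L"
    using bounded_on_compact[OF compact_cball continuous_on_subset[OF q KB]] by blast
  \<comment> \<open>A C^1 function vanishing at \<open>y0\<close> grows at most linearly there; this
    is the decay that makes the core negligible.\<close>
  have lip: "w y \<le> L * norm (y - y0)" if "y \<in> cball y0 \<rho>" for y
  proof -
    have "norm (w y - w y0) \<le> L * norm (y - y0)"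
    proof (rule differentiable_bound[OF convex_cball])
      show "(w has_derivative (\<lambda>h. h \<bullet> q x)) (at x within cball y0 \<rho>)" if "x \<in> cball y0 \<rho>" for x
        using w[of x] KB that unfolding gderiv_def by (blast intro: has_derivative_at_withinI)
      show "onorm (\<lambda>h. h \<bullet> q x) \<le> L" if "x \<in> cball y0 \<rho>" for x
      proof (rule onorm_le)
        show "norm (h \<bullet> q x) \<le> L * norm h" for h
          using order_trans[OF Cauchy_Schwarz_ineq2[of h "q x"] mult_left_mono[OF L(2)[OF that] norm_ge_zero[of h]]]
          by (simp add: mult.commute)
      qed
    qed (use that \<rho> in auto)
    then show ?thesis using wy0 by simp
  qed
  define s2 where "s2 = ((dist y0 y1)\<^sup>2 + \<rho>\<^sup>2) / 2"
  have sy1: "s y1 = (dist y0 y1)\<^sup>2" by (simp add: s_norm dist_norm norm_minus_commute)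
  have "0 < s y1" using ne by (simp add: sy1)
  have "(dist y0 y1)\<^sup>2 < \<rho>\<^sup>2" using \<rho> by (intro power_strict_mono) auto
  then have s2: "s y1 < s2" "s2 < \<rho>\<^sup>2" by (auto simp: s2_def sy1)
  obtain \<eta> \<sigma>0 where \<eta>: "\<eta> > 0" "\<sigma>0 > 0"
    "\<And>\<sigma> t. 0 < \<sigma> \<Longrightarrow> \<sigma> \<le> \<sigma>0 \<Longrightarrow> s y1 / 2 \<le> t \<Longrightarrow> t \<le> s2 \<Longrightarrow> barrierQ n b (\<rho>\<^sup>2) \<sigma> t \<ge> \<eta>"
    using barrierQ_positive[OF n b_def, of "s y1 / 2" s2 "\<rho>\<^sup>2"] \<open>0 < s y1\<close> s2 by fastforce
  have "\<exists>r>0. ball y1 r \<subseteq> {y \<in> ball y0 R. w y > w y1 / 2 \<and> s y > s y1 / 2 \<and> s y < s2}"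
  proof -
    have "open (ball y0 R \<inter> w -` {w y1 / 2<..})"
      by (rule continuous_open_preimage[OF wc open_ball open_greaterThan])
    moreover have "open {y. s y > s y1 / 2 \<and> s y < s2}"
      unfolding s_def by (intro open_Collect_conj open_Collect_less continuous_intros)
    ultimately have op: "open ((ball y0 R \<inter> w -` {w y1 / 2<..}) \<inter> {y. s y > s y1 / 2 \<and> s y < s2})" by (rule open_Int)
    moreover have "y1 \<in> (ball y0 R \<inter> w -` {w y1 / 2<..}) \<inter> {y. s y > s y1 / 2 \<and> s y < s2}"
      using y1 wy1 \<open>0 < s y1\<close> s2 by simp
    ultimately obtain r where "r > 0" "ball y1 r \<subseteq> (ball y0 R \<inter> w -` {w y1 / 2<..}) \<inter> {y. s y > s y1 / 2 \<and> s y < s2}"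
      unfolding open_contains_ball by blast
    then show ?thesis by blast
  qed
  then obtain r where r: "r > 0" "\<And>y. y \<in> ball y1 r \<Longrightarrow> w y > w y1 / 2 \<and> s y > s y1 / 2 \<and> s y < s2" by blast
  define V where "V = measure lebesgue (ball y1 r)"
  have V: "V > 0" using r(1) content_ball_pos[OF r(1), of y1] by (simp add: V_def)
  define \<eta>' where "\<eta>' = sqrt (w y1 / 2) * \<eta>"
  have \<eta>': "\<eta>' > 0" using wy1 \<eta> by (simp add: \<eta>'_def)
  define C where "C = sqrt (L * sqrt (8 * n)) * (6 * n * b) * (unit_ball_vol n * (8 * n) powr (n / 2))"
  have main: "\<eta>' * V \<le> C * \<sigma> powr (1/8)" if \<sigma>: "0 < \<sigma>" "\<sigma> \<le> \<sigma>0" "8 * n * \<sigma> \<le> s y1 / 2" for \<sigma>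
  proof -
    define Q where "Q y = barrierQ n b (\<rho>\<^sup>2) \<sigma> (s y)" for y
    \<comment> \<open>Radius of the core: outside it \<open>s \<ge> 8 n \<sigma>\<close>, hence the
      barrier is nonnegative.\<close>
    define \<rho>' where "\<rho>' = sqrt (8 * n * \<sigma>)"
    have n\<sigma>: "8 * n * \<sigma> > 0" using n \<sigma> by simp
    have \<rho>': "\<rho>' > 0" "\<rho>'\<^sup>2 = 8 * n * \<sigma>" using n\<sigma> by (auto simp: \<rho>'_def)
    define E where "E = sqrt (L * \<rho>') * (6 * n * b * \<sigma> powr (- 3 * b - 1))"
    have E0: "E \<ge> 0" unfolding E_def using L \<rho>' n b by (intro mult_nonneg_nonneg real_sqrt_ge_zero powr_ge_zero) auto
    have in_iff: "y \<in> cball y0 \<rho>' \<longleftrightarrow> s y \<le> 8 * n * \<sigma>" for y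
    proof -
      have "y \<in> cball y0 \<rho>' \<longleftrightarrow> norm (y - y0) \<le> \<rho>'" by (simp add: dist_norm norm_minus_commute)
      also have "\<dots> \<longleftrightarrow> s y \<le> \<rho>'\<^sup>2" unfolding s_norm
        using power_mono_iff[OF norm_ge_zero[of "y - y0"] less_imp_le[OF \<rho>'(1)], of 2] by simp
      finally show ?thesis by (simp only: \<rho>'(2))
    qed
    have in_\<rho>: "y \<in> cball y0 \<rho> \<longleftrightarrow> s y \<le> \<rho>\<^sup>2" for y
    proof -
      have "y \<in> cball y0 \<rho> \<longleftrightarrow> norm (y - y0) \<le> \<rho>" by (simp add: dist_norm norm_minus_commute)
      also have "\<dots> \<longleftrightarrow> s y \<le> \<rho>\<^sup>2" unfolding s_norm
        using power_mono_iff[OF norm_ge_zero[of "y - y0"] less_imp_le[OF \<rho>(3)], of 2] by simp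
      finally show ?thesis .
    qed
    have Qout: "Q y = 0" if "s y \<ge> \<rho>\<^sup>2" for y
      using barrier_zero(3)[of b "\<rho>\<^sup>2" \<sigma> "s y" n] b \<rho> \<sigma> that by (simp add: Q_def)
    \<comment> \<open>A pointwise minorant from three regions: gain near \<open>y1\<close>, loss in
      the core, nonnegativity elsewhere. The bound of \<open>8 n \<sigma>\<close> by
      \<open>s y1 / 2\<close> keeps the first two apart.\<close>
    have le: "\<eta>' * indicat_real (ball y1 r) y - E * indicat_real (cball y0 \<rho>') y \<le> sqrt (w y) * Q y" for y
    proof (cases "y \<in> ball y1 r")
      case True
      have "s y > 8 * n * \<sigma>" using r(2)[OF True] \<sigma>(3) by linarith
      then have nin: "y \<notin> cball y0 \<rho>'" using in_iff by simp
      have "\<eta> \<le> Q y" unfolding Q_def using r(2)[OF True] by (intro \<eta>(3) \<sigma>) auto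
      moreover have "sqrt (w y1 / 2) \<le> sqrt (w y)" using r(2)[OF True] by simp
      ultimately have "\<eta>' \<le> sqrt (w y) * Q y" unfolding \<eta>'_def
        using wy1 \<eta>(1) r(2)[OF True] by (intro mult_mono) auto
      then show ?thesis using True nin by simp
    next
      case nb: False
      show ?thesis
      proof (cases "y \<in> cball y0 \<rho>'")
        case True
        then have sy: "s y \<le> 8 * n * \<sigma>" using in_iff by simp
        also have "\<dots> \<le> \<rho>\<^sup>2" using \<sigma>(3) s2 \<open>0 < s y1\<close> by linarith
        finally have y\<rho>: "y \<in> cball y0 \<rho>" using in_\<rho> by simp
        have "norm (y - y0) \<le> \<rho>'" using True by (simp add: dist_norm norm_minus_commute)
        then have "w y \<le> L * \<rho>'" using order_trans[OF lip[OF y\<rho>] mult_left_mono[OF _ L(1)]] by blast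
        then have "sqrt (w y) \<le> sqrt (L * \<rho>')" by simp
        moreover have "0 \<le> sqrt (w y)" using w0 KB y\<rho> by auto
        moreover have Ql: "- Q y \<le> 6 * n * b * \<sigma> powr (- 3 * b - 1)"
          using barrierQ_lower[OF n b_def \<sigma>(1) s0, of "\<rho>\<^sup>2" y] by (simp add: Q_def)
        moreover have "0 \<le> 6 * n * b * \<sigma> powr (- 3 * b - 1)" using n b by simp
        ultimately have "sqrt (w y) * (- Q y) \<le> E"
          unfolding E_def by (meson mult_mono' mult_left_mono mult_right_mono order_trans)
        then show ?thesis using nb True by simp
      next
        case False
        then have sy: "8 * n * \<sigma> \<le> s y" using in_iff by simp
        have "0 \<le> sqrt (w y) * Q y"
        proof (cases "s y \<ge> \<rho>\<^sup>2")
          case False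
          then have "y \<in> cball y0 \<rho>" unfolding in_\<rho> by simp
          then have "y \<in> ball y0 R" using KB by blast
          then have "0 \<le> sqrt (w y)" using w0 by simp
          moreover have "0 \<le> Q y" unfolding Q_def by (rule barrierQ_nonneg[OF n b_def \<sigma>(1) sy])
          ultimately show ?thesis by simp
        qed (simp add: Qout)
        then show ?thesis using nb False by simp
      qed
    qed
    have Qi: "integrable lebesgue (\<lambda>y. sqrt (w y) * Q y)"
    proof (rule integrable_extend_zero[OF open_ball _ compact_cball KB])
      have "continuous_on (ball y0 R) Q" unfolding Q_def s_def
        by (rule continuous_on_compose2[OF barrierQ_continuous[OF \<sigma>(1)]]) (auto intro!: continuous_intros)
      then show "continuous_on (ball y0 R) (\<lambda>y. sqrt (w y) * Q y)" by (intro continuous_intros wc)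
      show "sqrt (w y) * Q y = 0" if "y \<notin> cball y0 \<rho>" for y
        using Qout[of y] in_\<rho>[of y] that by simp
    qed
    have I1: "integrable lebesgue (\<lambda>y. \<eta>' * indicat_real (ball y1 r) y)"
      "integrable lebesgue (\<lambda>y. E * indicat_real (cball y0 \<rho>') y)"
      using emeasure_bounded_finite[OF bounded_ball, of y1 r] emeasure_bounded_finite[OF bounded_cball, of y0 \<rho>']
      by (auto intro!: integrable_mult_right simp: integrable_indicator_iff)
    have "0 \<le> - (LINT y|lebesgue. sqrt (w y) * Q y)"
      using weighted_barrier_integral[OF w q w0 D[unfolded n_def] weak b \<rho>(3,2) \<sigma>(1)]
      unfolding Q_def s_def n_def by simp
    moreover have "(LINT y|lebesgue. \<eta>' * indicat_real (ball y1 r) y - E * indicat_real (cball y0 \<rho>') y) \<le> (LINT y|lebesgue. sqrt (w y) * Q y)"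
      by (rule integral_mono[OF _ Qi le]) (intro Bochner_Integration.integrable_diff I1)
    moreover have "(LINT y|lebesgue. \<eta>' * indicat_real (ball y1 r) y - E * indicat_real (cball y0 \<rho>') y) = \<eta>' * V - E * measure lebesgue (cball y0 \<rho>')"
      using I1 by (simp add: V_def Bochner_Integration.integral_diff)
    ultimately have "\<eta>' * V \<le> E * measure lebesgue (cball y0 \<rho>')" by linarith
    also have "measure lebesgue (cball y0 \<rho>') = unit_ball_vol n * \<rho>' ^ DIM('a)"
      using content_cball[of \<rho>' y0] \<rho>' by (simp add: n_def)
    also have "\<rho>' ^ DIM('a) = (8 * n) powr (n / 2) * \<sigma> powr (n / 2)"
    proof -
      have e: "\<rho>' = (8 * n * \<sigma>) powr (1/2)" unfolding \<rho>'_def using n\<sigma> by (simp add: powr_half_sqrt)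
      have "\<rho>' ^ DIM('a) = \<rho>' powr n" using \<rho>' by (simp add: n_def powr_realpow)
      also have "\<dots> = (8 * n * \<sigma>) powr (1/2 * n)" unfolding e by (rule powr_powr)
      also have "1/2 * n = n / 2" by simp
      also have "(8 * n * \<sigma>) powr (n / 2) = (8 * n) powr (n / 2) * \<sigma> powr (n / 2)"
        using powr_mult[of "8 * n" \<sigma> "n / 2"] n \<sigma> by simp
      finally show ?thesis .
    qed
    also have "E = sqrt (L * sqrt (8 * n)) * (6 * n * b) * (\<sigma> powr (1/4) * \<sigma> powr (- 3 * b - 1))"
    proof -
      have "sqrt (L * \<rho>') = sqrt (L * sqrt (8 * n)) * sqrt (sqrt \<sigma>)"
        by (simp add: \<rho>'_def real_sqrt_mult)
      also have "sqrt (sqrt \<sigma>) = \<sigma> powr (1/4)"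
        using \<sigma> by (simp add: powr_half_sqrt[symmetric] powr_powr)
      finally show ?thesis by (simp add: E_def)
    qed
    also have "sqrt (L * sqrt (8 * n)) * (6 * n * b) * (\<sigma> powr (1/4) * \<sigma> powr (- 3 * b - 1)) * (unit_ball_vol n * ((8 * n) powr (n / 2) * \<sigma> powr (n / 2)))
       = C * (\<sigma> powr (1/4) * \<sigma> powr (- 3 * b - 1) * \<sigma> powr (n / 2))"
      by (simp add: C_def)
    also have "\<sigma> powr (1/4) * \<sigma> powr (- 3 * b - 1) * \<sigma> powr (n / 2) = \<sigma> powr (1/8)"
    proof -
      \<comment> \<open>\<open>sqrt w\<close> on the core, the barrier and the volume contribute
        \<open>1/4\<close>, \<open>- 3 b - 1\<close> and \<open>n / 2\<close>; the choice of
        \<open>b\<close> leaves a positive exponent.\<close>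
      have "1/4 + (- 3 * b - 1) + n / 2 = 1/8" by (simp add: b_def field_simps)
      then show ?thesis by (simp only: powr_add[symmetric])
    qed
    finally show ?thesis .
  qed
  have lim: "(\<lambda>k. C * inverse (real (Suc k)) powr (1/8)) \<longlonglongrightarrow> C * 0"
    by (intro tendsto_mult tendsto_const tendsto_zero_powrI LIMSEQ_inverse_real_of_nat tendsto_const) (auto intro!: always_eventually)
  define \<sigma>1 where "\<sigma>1 = min \<sigma>0 (s y1 / (16 * n))"
  have "\<sigma>1 > 0" using \<eta> \<open>0 < s y1\<close> n by (simp add: \<sigma>1_def)
  then obtain N where N: "\<And>k. k \<ge> N \<Longrightarrow> inverse (real (Suc k)) < \<sigma>1"
    using order_tendstoD(2)[OF LIMSEQ_inverse_real_of_nat] by (auto simp: eventually_sequentially)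
  have "\<eta>' * V \<le> C * inverse (real (Suc k)) powr (1/8)" if "k \<ge> N" for k
  proof (rule main)
    show "inverse (real (Suc k)) \<le> \<sigma>0" using N[OF that] by (simp add: \<sigma>1_def)
    have "inverse (real (Suc k)) \<le> s y1 / (16 * n)" using N[OF that] by (simp add: \<sigma>1_def)
    then have "8 * n * inverse (real (Suc k)) \<le> 8 * n * (s y1 / (16 * n))" using n by (intro mult_left_mono) auto
    also have "\<dots> = s y1 / 2" using n by simp
    finally show "8 * n * inverse (real (Suc k)) \<le> s y1 / 2" .
  qed simp
  then have "\<eta>' * V \<le> C * 0" by (intro LIMSEQ_le_const[OF lim] exI[of _ N]) auto
  then show False using mult_pos_pos[OF \<eta>' V] by simp
qed

section \<open>Local and global comparison\<close>

text \<open>Test functions live on the whole space, so those of \<open>A\<close> are test functions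
  of \<open>\<Omega>\<close> as they stand, and the integrand vanishes off their support. The factor
  \<open>\<kappa>\<close> serves to normalise a gradient.\<close>

lemma weak_subsol_restrict:
  assumes W: "weak_subsol \<Omega> G F" and A: "A \<subseteq> \<Omega>" and \<kappa>: "\<kappa> \<ge> 0"
  shows "weak_subsol A (\<lambda>x. \<kappa> *\<^sub>R G x) (\<lambda>x. \<kappa> * F x)"
  unfolding weak_subsol_def
proof (intro ballI impI)
  fix \<phi> :: "'a \<Rightarrow> real" assume \<phi>: "\<phi> \<in> test_functions A" "\<forall>x. \<phi> x \<ge> 0"
  let ?K = "closure {x. \<phi> x \<noteq> 0}"
  have K: "?K \<subseteq> A" "compact ?K" using \<phi> by (auto simp: test_functions_def)
  have "\<phi> \<in> test_functions \<Omega>" using \<phi>(1) A by (auto simp: test_functions_def)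
  then have W': "0 \<le> (LINT x:\<Omega>|lebesgue. - (G x \<bullet> gradient \<phi> x) + F x * \<phi> x)"
    using W \<phi>(2) unfolding weak_subsol_def by blast
  have z: "\<phi> x = 0" if "x \<notin> ?K" for x using that closure_subset[of "{x. \<phi> x \<noteq> 0}"] by blast
  have gz: "gradient \<phi> x = 0" if "x \<notin> ?K" for x
  proof (rule gradient_eq)
    show "GDERIV \<phi> x :> 0"
    proof (rule GDERIV_zero_open[OF open_Compl[OF closed_closure]])
      show "x \<in> - ?K" using that by simp
      show "\<phi> y = 0" if "y \<in> - ?K" for y by (rule z[OF ComplD[OF that]])
    qed
  qed
  have "(LINT x:A|lebesgue. - ((\<kappa> *\<^sub>R G x) \<bullet> gradient \<phi> x) + \<kappa> * F x * \<phi> x) =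
      (LINT x|lebesgue. \<kappa> * (indicator \<Omega> x *\<^sub>R (- (G x \<bullet> gradient \<phi> x) + F x * \<phi> x)))"
    unfolding set_lebesgue_integral_def
  proof (rule Bochner_Integration.integral_cong[OF refl])
    fix x
    show "indicat_real A x *\<^sub>R (- ((\<kappa> *\<^sub>R G x) \<bullet> gradient \<phi> x) + \<kappa> * F x * \<phi> x) =
        \<kappa> * (indicator \<Omega> x *\<^sub>R (- (G x \<bullet> gradient \<phi> x) + F x * \<phi> x))"
    proof (cases "x \<in> ?K")
      case True
      then have "x \<in> A" "x \<in> \<Omega>" using K A by auto
      then show ?thesis by (simp add: right_diff_distrib mult.assoc)
    next
      case False
      show ?thesis by (simp add: z[OF False] gz[OF False])
    qed
  qed
  also have "\<dots> = \<kappa> * (LINT x:\<Omega>|lebesgue. - (G x \<bullet> gradient \<phi> x) + F x * \<phi> x)"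
    unfolding set_lebesgue_integral_def by (rule integral_mult_right_zero)
  finally show "0 \<le> (LINT x:A|lebesgue. - ((\<kappa> *\<^sub>R G x) \<bullet> gradient \<phi> x) + \<kappa> * F x * \<phi> x)"
    using W' \<kappa> by simp
qed

lemma Ck_1_gradient:
  assumes "Ck_on 1 \<Omega> u"
  shows "\<And>x. x \<in> \<Omega> \<Longrightarrow> GDERIV u x :> gradient u x" "continuous_on \<Omega> (gradient u)"
proof -
  have d: "\<And>x. x \<in> \<Omega> \<Longrightarrow> u differentiable (at x)" and c: "\<And>v. continuous_on \<Omega> (\<lambda>x. frechet_derivative u (at x) v)"
    using assms by (auto simp: One_nat_def simp del: One_nat_def[symmetric])
  define g where "g x = (\<Sum>b\<in>Basis. frechet_derivative u (at x) b *\<^sub>R b)" for x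
  have g: "GDERIV u x :> g x" if "x \<in> \<Omega>" for x
  proof -
    have D: "(u has_derivative frechet_derivative u (at x)) (at x)"
      using d[OF that] frechet_derivative_works by blast
    have lin: "linear (frechet_derivative u (at x))" using D has_derivative_linear by blast
    have "frechet_derivative u (at x) v = v \<bullet> g x" for v
    proof -
      have "frechet_derivative u (at x) (\<Sum>b\<in>Basis. (v \<bullet> b) *\<^sub>R b) = (\<Sum>b\<in>Basis. (v \<bullet> b) * frechet_derivative u (at x) b)"
        by (simp only: linear_sum[OF lin] linear_scale[OF lin] real_scaleR_def)
      then have "frechet_derivative u (at x) v = (\<Sum>b\<in>Basis. (v \<bullet> b) * frechet_derivative u (at x) b)"
        by (simp only: euclidean_representation)
      then show ?thesis by (simp add: g_def inner_sum_right mult.commute)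
    qed
    then have "frechet_derivative u (at x) = (\<lambda>v. v \<bullet> g x)" by (rule ext)
    then show ?thesis using D by (simp add: gderiv_def)
  qed
  have eq: "gradient u x = g x" if "x \<in> \<Omega>" for x by (rule gradient_eq[OF g[OF that]])
  show "GDERIV u x :> gradient u x" if "x \<in> \<Omega>" for x using g[OF that] eq[OF that] by simp
  have "continuous_on \<Omega> g" unfolding g_def by (intro continuous_intros c)
  then show "continuous_on \<Omega> (gradient u)" by (rule continuous_on_eq) (simp add: eq)
qed

text \<open>The flux \<open>M\<close> of the transformed problem, as a function of \<open>a = \<nabla>u\<close>: the contraction with \<open>e\<close>
  of the energy-momentum tensor, up to the Jacobian \<open>a \<bullet> e\<close>.\<close>

definition stress :: "'a::euclidean_space \<Rightarrow> 'a \<Rightarrow> 'a" where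
  "stress e a = (a \<bullet> e - (norm a)\<^sup>2 / 2) *\<^sub>R e - a"

lemma stress_continuous: "continuous_on A f \<Longrightarrow> continuous_on A (\<lambda>x. stress e (f x))"
  unfolding stress_def by (intro continuous_intros) auto

text \<open>The inequality obtained from translations is tested with \<open>\<Psi> \<circ> T\<close>
  and pushed forward by \<open>T\<close>. Every term then carries the factor
  \<open>G x \<bullet> e\<close>, which is exactly the Jacobian, and \<open>F\<close> becomes the
  function \<open>h\<close> of the new variable. The sign \<open>\<sigma>\<close> covers sub- and
  supersolutions at once.\<close>

lemma hodograph_inequality:
  fixes U :: "real ^ 'n \<Rightarrow> real"
  assumes A: "open A" and U: "\<And>x. x \<in> A \<Longrightarrow> GDERIV U x :> G x" and G: "continuous_on A G"
    and e: "norm e = 1" and pos: "\<And>x. x \<in> A \<Longrightarrow> G x \<bullet> e > 0"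
    and T: "\<And>x. T x = x + (U x - x \<bullet> e) *\<^sub>R e"
    and V: "open V" and hom: "homeomorphism A V T S"
    and h: "\<And>K. compact K \<Longrightarrow> set_integrable lebesgue K h" and F: "\<And>x. x \<in> A \<Longrightarrow> F x = h (T x)"
    and \<sigma>: "\<bar>\<sigma>\<bar> = 1" and W: "weak_subsol A (\<lambda>x. \<sigma> *\<^sub>R G x) (\<lambda>x. \<sigma> * F x)"
    and \<Psi>: "C1_supp K \<Psi> g" "K \<subseteq> V" "\<And>y. \<Psi> y \<ge> 0"
  shows "0 \<le> \<sigma> * (LINT y|lebesgue. stress e (G (S y)) \<bullet> g y + h y * \<Psi> y)"
    and "integrable lebesgue (\<lambda>y. stress e (G (S y)) \<bullet> g y)" "integrable lebesgue (\<lambda>y. h y * \<Psi> y)"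
proof -
  have K: "compact K" and g: "\<And>x. GDERIV \<Psi> x :> g x" "continuous_on UNIV g"
    and out: "\<And>x. x \<notin> K \<Longrightarrow> \<Psi> x = 0"
    using \<Psi> by (auto simp: C1_supp_def)
  note gout = C1_supp_grad_zero[OF \<Psi>(1)] and \<Psi>c = C1_supp_continuous[OF \<Psi>(1)]
  have ST: "\<And>x. x \<in> A \<Longrightarrow> S (T x) = x" "\<And>y. y \<in> V \<Longrightarrow> T (S y) = y" "T ` A = V" "S ` V = A"
    "continuous_on A T" "continuous_on V S"
    using hom by (auto simp: homeomorphism_def)
  have SyA: "S y \<in> A" if "y \<in> V" for y using ST(4) that by blast
  have ee: "e \<bullet> e = 1" using e by (simp flip: power2_norm_eq_inner)
  have \<sigma>2: "\<sigma> * \<sigma> = 1" using \<sigma> by (metis abs_mult_self_eq mult_1)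
  show I1: "integrable lebesgue (\<lambda>y. stress e (G (S y)) \<bullet> g y)"
  proof (rule integrable_extend_zero[OF V _ K \<Psi>(2)])
    have "continuous_on V (\<lambda>y. G (S y))"
      by (rule continuous_on_compose2[OF G ST(6)]) (use ST(4) in auto)
    then show "continuous_on V (\<lambda>y. stress e (G (S y)) \<bullet> g y)"
      by (intro continuous_on_inner stress_continuous continuous_on_subset[OF g(2)]) auto
  qed (simp add: gout)
  show I2: "integrable lebesgue (\<lambda>y. h y * \<Psi> y)"
    by (rule integrable_mult_compact_support[OF h[OF K] K \<Psi>c out])
  define L where "L = S ` K"
  have Lc: "compact L" unfolding L_def
    by (rule compact_continuous_image[OF continuous_on_subset[OF ST(6) \<Psi>(2)] K])
  have LA: "L \<subseteq> A" unfolding L_def using \<Psi>(2) SyA by blast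
  have TL: "T x \<notin> K" if "x \<in> A" "x \<notin> L" for x
    using ST(1)[OF that(1)] that(2) unfolding L_def by force
  define \<psi> where "\<psi> x = (if x \<in> A then \<Psi> (T x) else 0)" for x
  \<comment> \<open>Chain rule: the transpose of the derivative of \<open>T\<close>, applied to
    \<open>g (T x)\<close>.\<close>
  define p where "p x = (if x \<in> A then g (T x) + (g (T x) \<bullet> e) *\<^sub>R (G x - e) else 0)" for x
  have C: "C1_supp L \<psi> p"
  proof (rule C1_supp_extend[OF A Lc LA])
    fix x assume x: "x \<in> A"
    have "(T has_derivative (\<lambda>k. k + (k \<bullet> (G x - e)) *\<^sub>R e)) (at x)"
      unfolding T[abs_def]
      by (auto intro!: derivative_eq_intros U[OF x, unfolded gderiv_def] simp: inner_diff_right)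
    from has_derivative_compose[OF this g(1)[unfolded gderiv_def]]
    have "((\<lambda>x. \<Psi> (T x)) has_derivative (\<lambda>k. (k + (k \<bullet> (G x - e)) *\<^sub>R e) \<bullet> g (T x))) (at x)" .
    moreover have "(k + (k \<bullet> (G x - e)) *\<^sub>R e) \<bullet> g (T x) = k \<bullet> p x" for k
      using x by (simp add: p_def inner_add_left inner_add_right inner_commute)
    ultimately have "((\<lambda>x. \<Psi> (T x)) has_derivative (\<lambda>k. k \<bullet> p x)) (at x)" by simp
    then show "GDERIV \<psi> x :> p x" unfolding gderiv_def
      by (rule has_derivative_transform_within_open[OF _ A x]) (simp add: \<psi>_def)
  next
    have "continuous_on A (\<lambda>x. g (T x) + (g (T x) \<bullet> e) *\<^sub>R (G x - e))"
      by (intro continuous_intros G continuous_on_compose2[OF g(2) ST(5)]) auto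
    then show "continuous_on A p" by (rule continuous_on_eq) (simp add: p_def)
  next
    show "\<psi> x = 0" if "x \<notin> L" for x using TL[of x] that out by (simp add: \<psi>_def)
    show "p x = 0" if "x \<notin> L" for x using TL[of x] that gout by (simp add: p_def)
  qed
  have inj: "inj_on T B" if "B \<subseteq> A" for B
    by (rule inj_on_inverseI[of _ S]) (use that ST(1) in auto)
  have Fi: "set_integrable lebesgue B (\<lambda>x. \<sigma> * F x)" if B: "compact B" "B \<subseteq> A" for B
  proof -
    have "set_integrable lebesgue (T ` B) h"
      by (rule h[OF compact_continuous_image[OF continuous_on_subset[OF ST(5) B(2)] B(1)]])
    moreover have "B \<in> sets lebesgue" using borel_compact[OF B(1)] by simp
    ultimately have 1: "set_integrable lebesgue B (\<lambda>x. \<bar>G x \<bullet> e\<bar> * h (T x))"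
      using hodograph_cv(1)[OF _ U e T inj[OF B(2)], of h] B(2) by blast
    have "continuous_on B (\<lambda>x. \<sigma> / \<bar>G x \<bullet> e\<bar>)"
      using pos B(2) by (intro continuous_intros continuous_on_subset[OF G B(2)]) force
    from set_integrable_mult_continuous[OF B(1) this 1]
    have 2: "set_integrable lebesgue B (\<lambda>x. \<sigma> / \<bar>G x \<bullet> e\<bar> * (\<bar>G x \<bullet> e\<bar> * h (T x)))" .
    have "indicat_real B x *\<^sub>R (\<sigma> / \<bar>G x \<bullet> e\<bar> * (\<bar>G x \<bullet> e\<bar> * h (T x))) = indicat_real B x *\<^sub>R (\<sigma> * F x)" for x
    proof (cases "x \<in> B")
      case True
      then have "x \<in> A" using B by blast
      then show ?thesis using pos[of x] F[of x] True by simp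
    qed simp
    then show ?thesis using 2 unfolding set_integrable_def by (simp only:)
  qed
  define k where "k y = \<sigma> * (stress e (G (S y)) \<bullet> g y + h y * \<Psi> y)" for y
  have "0 \<le> (LINT x|lebesgue. - (((\<sigma> *\<^sub>R G x) \<bullet> (\<sigma> *\<^sub>R e)) * ((\<sigma> *\<^sub>R G x) \<bullet> p x)) + (norm (\<sigma> *\<^sub>R G x))\<^sup>2 / 2 * (p x \<bullet> (\<sigma> *\<^sub>R e))
            + \<sigma> * F x * (((\<sigma> *\<^sub>R G x) \<bullet> (\<sigma> *\<^sub>R e)) * \<psi> x))"
  \<comment> \<open>For \<open>\<sigma> = -1\<close> the direction is reversed together with the
    gradient, so that \<open>(\<sigma> G) \<bullet> (\<sigma> e) = G \<bullet> e\<close> stays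
    positive.\<close>
  proof (rule noether_inequality[OF A _ _ Fi W _ C LA])
    show "GDERIV (\<lambda>x. \<sigma> * U x) x :> \<sigma> *\<^sub>R G x" if "x \<in> A" for x
      using has_derivative_mult_right[OF U[OF that, unfolded gderiv_def], of \<sigma>] by (simp add: gderiv_def)
    show "continuous_on A (\<lambda>x. \<sigma> *\<^sub>R G x)" by (intro continuous_intros G)
    show "0 \<le> (\<sigma> *\<^sub>R G x) \<bullet> (\<sigma> *\<^sub>R e)" if "x \<in> A" for x
      using pos[OF that] \<sigma>2 by (simp flip: mult.assoc)
    show "0 \<le> \<psi> x" for x using \<Psi>(3) by (simp add: \<psi>_def)
    show "norm (\<sigma> *\<^sub>R e) = 1" using \<sigma> e by simp
  qed
  also have "(\<lambda>x. - (((\<sigma> *\<^sub>R G x) \<bullet> (\<sigma> *\<^sub>R e)) * ((\<sigma> *\<^sub>R G x) \<bullet> p x)) + (norm (\<sigma> *\<^sub>R G x))\<^sup>2 / 2 * (p x \<bullet> (\<sigma> *\<^sub>R e))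
            + \<sigma> * F x * (((\<sigma> *\<^sub>R G x) \<bullet> (\<sigma> *\<^sub>R e)) * \<psi> x)) = (\<lambda>x. indicat_real A x *\<^sub>R (\<bar>G x \<bullet> e\<bar> * k (T x)))"
  proof
    fix x
    show "- (((\<sigma> *\<^sub>R G x) \<bullet> (\<sigma> *\<^sub>R e)) * ((\<sigma> *\<^sub>R G x) \<bullet> p x)) + (norm (\<sigma> *\<^sub>R G x))\<^sup>2 / 2 * (p x \<bullet> (\<sigma> *\<^sub>R e))
            + \<sigma> * F x * (((\<sigma> *\<^sub>R G x) \<bullet> (\<sigma> *\<^sub>R e)) * \<psi> x) = indicat_real A x *\<^sub>R (\<bar>G x \<bullet> e\<bar> * k (T x))"
    proof (cases "x \<in> A")
      case False
      then show ?thesis by (simp add: p_def \<psi>_def)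
    next
      case True
      define c where "c = G x \<bullet> e"
      define a where "a = G x \<bullet> g (T x)"
      define m where "m = g (T x) \<bullet> e"
      define N where "N = (norm (G x))\<^sup>2"
      have c0: "\<bar>c\<bar> = c" using pos[OF True] by (simp add: c_def)
      have Gp: "G x \<bullet> p x = a + m * (N - c)"
        using True by (simp add: p_def inner_add_right inner_diff_right a_def m_def N_def c_def power2_norm_eq_inner)
      have pe: "p x \<bullet> e = m * c"
        using True by (simp add: p_def inner_add_left inner_diff_left ee m_def c_def algebra_simps)
      have st: "stress e (G x) \<bullet> g (T x) = (c - N / 2) * m - a"
        by (simp add: stress_def inner_diff_left a_def m_def N_def c_def inner_commute[of e])
      have nG: "(norm (\<sigma> *\<^sub>R G x))\<^sup>2 = N" using \<sigma> by (simp add: N_def)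
      have cc: "(\<sigma> *\<^sub>R G x) \<bullet> (\<sigma> *\<^sub>R e) = c" using \<sigma>2 by (simp add: c_def flip: mult.assoc)
      \<comment> \<open>Taking out the Jacobian \<open>c\<close> leaves the pairing of
        \<open>stress e (G x)\<close> with \<open>g (T x)\<close> and the zeroth order term.\<close>
      have "- (c * (\<sigma> * (a + m * (N - c)))) + N / 2 * (\<sigma> * (m * c)) + \<sigma> * h (T x) * (c * \<Psi> (T x))
          = c * (\<sigma> * ((c - N / 2) * m - a + h (T x) * \<Psi> (T x)))" by (simp add: algebra_simps)
      then show ?thesis
        unfolding nG cc unfolding inner_scaleR_left inner_scaleR_right Gp pe
        using True by (simp add: k_def ST(1)[OF True] st F \<psi>_def c0 c_def[symmetric])
    qed
  qed
  also have "(LINT x|lebesgue. indicat_real A x *\<^sub>R (\<bar>G x \<bullet> e\<bar> * k (T x))) = (LINT y:V|lebesgue. k y)"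
    using hodograph_cv(2)[OF _ U e T inj[OF order_refl], of k] A unfolding ST(3) set_lebesgue_integral_def by simp
  also have "\<dots> = (LINT y|lebesgue. k y)" unfolding set_lebesgue_integral_def
  proof (rule Bochner_Integration.integral_cong[OF refl])
    show "indicat_real V y *\<^sub>R k y = k y" for y
    proof (cases "y \<in> K")
      case True
      then show ?thesis using \<Psi>(2) by auto
    qed (simp add: k_def out gout)
  qed
  also have "\<dots> = \<sigma> * (LINT y|lebesgue. stress e (G (S y)) \<bullet> g y + h y * \<Psi> y)"
    unfolding k_def by (rule integral_mult_right_zero)
  finally show "0 \<le> \<sigma> * (LINT y|lebesgue. stress e (G (S y)) \<bullet> g y + h y * \<Psi> y)" .
qed

text \<open>Both \<open>stress e\<close> and the map
  \<open>a \<mapsto> e + (e - a) / (a \<bullet> e)\<close> have derivative \<open>- id\<close> at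
  \<open>a = e\<close>, so near \<open>e\<close> both differences are close to \<open>- d\<close>
  and hence to each other. The radius \<open>1 / (20 n)\<close> works because the total error is
  \<open>7 \<delta> norm d\<close>, \<open>norm q \<ge> (1 - 6 \<delta>) norm d\<close>, and
  \<open>7/10 \<le> 1 - 6/40\<close>.\<close>

lemma stress_estimate:
  fixes e a1 a2 :: "'a::euclidean_space"
  assumes e: "norm e = 1" and n: "n \<ge> 2" and a: "norm (a1 - e) \<le> 1 / (20 * n)" "norm (a2 - e) \<le> 1 / (20 * n)"
  defines "q \<equiv> (e + (1 / (a1 \<bullet> e)) *\<^sub>R (e - a1)) - (e + (1 / (a2 \<bullet> e)) *\<^sub>R (e - a2))"
  shows "norm (stress e a1 - stress e a2 - q) \<le> 1 / (2 * n) * norm q"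
proof -
  define \<delta> where "\<delta> = 1 / (20 * n)"
  define d where "d = a1 - a2"
  define c1 where "c1 = a1 \<bullet> e"
  define c2 where "c2 = a2 \<bullet> e"
  have \<delta>: "0 < \<delta>" "\<delta> \<le> 1/40" using n by (auto simp: \<delta>_def field_simps)
  have ee: "e \<bullet> e = 1" using e by (simp flip: power2_norm_eq_inner)
  have c: "\<bar>c1 - 1\<bar> \<le> \<delta>" "\<bar>c2 - 1\<bar> \<le> \<delta>"
    using Cauchy_Schwarz_ineq2[of "a1 - e" e] Cauchy_Schwarz_ineq2[of "a2 - e" e] a e
    by (simp_all add: c1_def c2_def inner_diff_left ee \<delta>_def)
  have cp: "c1 \<ge> 1/2" "c2 \<ge> 1/2" using c \<delta> by linarith+
  have A: "norm (stress e a1 - stress e a2 + d) \<le> \<delta> * norm d"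
  proof -
    \<comment> \<open>\<open>stress e\<close> is quadratic, so its difference is given exactly by
      the derivative at the midpoint; only the distance of the midpoint from \<open>e\<close>
      enters.\<close>
    have mid: "norm (e - (1/2) *\<^sub>R (a1 + a2)) \<le> \<delta>"
    proof -
      have "e - (1/2) *\<^sub>R (a1 + a2) = - ((1/2) *\<^sub>R ((a1 - e) + (a2 - e)))"
        by (simp add: algebra_simps flip: scaleR_add_left)
      then have "norm (e - (1/2) *\<^sub>R (a1 + a2)) = norm ((a1 - e) + (a2 - e)) / 2" by simp
      also have "\<dots> \<le> \<delta>" using norm_triangle_ineq[of "a1 - e" "a2 - e"] a by (simp add: \<delta>_def)
      finally show ?thesis .
    qed
    have "stress e a1 - stress e a2 + d = (d \<bullet> (e - (1/2) *\<^sub>R (a1 + a2))) *\<^sub>R e"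
      by (simp add: stress_def d_def power2_norm_eq_inner inner_diff_left inner_diff_right inner_add_right inner_commute algebra_simps)
    then have "norm (stress e a1 - stress e a2 + d) = \<bar>d \<bullet> (e - (1/2) *\<^sub>R (a1 + a2))\<bar>" using e by simp
    also have "\<dots> \<le> norm d * norm (e - (1/2) *\<^sub>R (a1 + a2))" by (rule Cauchy_Schwarz_ineq2)
    also have "\<dots> \<le> norm d * \<delta>" by (rule mult_left_mono[OF mid norm_ge_zero])
    finally show ?thesis by (simp add: mult.commute)
  qed
  have B: "norm (q + d) \<le> 6 * \<delta> * norm d"
  proof -
    \<comment> \<open>The splitting makes both summands small: a coefficient near 0 times
      \<open>d\<close>, and a coefficient of order \<open>norm d\<close> times
      \<open>e - a2\<close>.\<close>
    have "q + d = (1 - 1 / c1) *\<^sub>R d + ((c2 - c1) / (c1 * c2)) *\<^sub>R (e - a2)"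
    proof -
      have f: "(c2 - c1) / (c1 * c2) = 1 / c1 - 1 / c2" using cp by (simp add: field_simps)
      show ?thesis unfolding f q_def d_def c1_def[symmetric] c2_def[symmetric] by (simp add: algebra_simps)
    qed
    then have "norm (q + d) \<le> \<bar>1 - 1 / c1\<bar> * norm d + \<bar>(c2 - c1) / (c1 * c2)\<bar> * norm (e - a2)"
      using norm_triangle_ineq[of "(1 - 1 / c1) *\<^sub>R d" "((c2 - c1) / (c1 * c2)) *\<^sub>R (e - a2)"] by simp
    moreover have "\<bar>1 - 1 / c1\<bar> \<le> 2 * \<delta>"
    proof -
      have "1 - 1 / c1 = (c1 - 1) / c1" using cp by (simp add: field_simps)
      then have "\<bar>1 - 1 / c1\<bar> = \<bar>c1 - 1\<bar> / c1" using cp by simp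
      also have "\<dots> \<le> \<delta> / (1/2)" using c cp \<delta> by (intro frac_le) auto
      finally show ?thesis by simp
    qed
    then have "\<bar>1 - 1 / c1\<bar> * norm d \<le> 2 * \<delta> * norm d" by (intro mult_right_mono) auto
    moreover have "\<bar>(c2 - c1) / (c1 * c2)\<bar> * norm (e - a2) \<le> (norm d / (1/2 * (1/2))) * \<delta>"
    proof (rule mult_mono)
      have "\<bar>c2 - c1\<bar> \<le> norm d"
        using Cauchy_Schwarz_ineq2[of "a2 - a1" e] e by (simp add: c1_def c2_def inner_diff_left d_def norm_minus_commute)
      moreover have "1/2 * (1/2) \<le> c1 * c2" using cp by (intro mult_mono) auto
      ultimately have "\<bar>c2 - c1\<bar> / (c1 * c2) \<le> norm d / (1/2 * (1/2))" by (intro frac_le) auto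
      then show "\<bar>(c2 - c1) / (c1 * c2)\<bar> \<le> norm d / (1/2 * (1/2))" using cp by (simp add: abs_divide abs_mult)
    qed (use a in \<open>auto simp: norm_minus_commute \<delta>_def\<close>)
    ultimately show ?thesis by (simp add: algebra_simps)
  qed
  have "norm d \<le> norm q + norm (q + d)" using norm_triangle_ineq4[of "q + d" q] by simp
  then have lower: "(1 - 6 * \<delta>) * norm d \<le> norm q" using B by (simp add: algebra_simps)
  have "norm (stress e a1 - stress e a2 - q) \<le> norm (stress e a1 - stress e a2 + d) + norm (q + d)"
    using norm_triangle_ineq4[of "stress e a1 - stress e a2 + d" "q + d"] by simp
  also have "\<dots> \<le> 7 * \<delta> * norm d" using A B by (simp add: algebra_simps)
  also have "\<dots> \<le> 1 / (2 * n) * ((1 - 6 * \<delta>) * norm d)"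
  proof -
    have "7 * \<delta> = 1 / (2 * n) * (7/10)" using n by (simp add: \<delta>_def field_simps)
    also have "\<dots> \<le> 1 / (2 * n) * (1 - 6 * \<delta>)" using \<delta> n by (intro mult_left_mono) auto
    finally have "7 * \<delta> * norm d \<le> 1 / (2 * n) * (1 - 6 * \<delta>) * norm d" by (intro mult_right_mono) auto
    then show ?thesis by (simp only: mult.assoc)
  qed
  also have "\<dots> \<le> 1 / (2 * n) * norm q" using lower n by (intro mult_left_mono) auto
  finally show ?thesis .
qed

text \<open>\<open>T1 x1 = T2 x2\<close> puts both points on one line parallel to \<open>e\<close>,
  with \<open>U1 x1 = U2 x2\<close>. Were \<open>x2\<close> the higher one, monotonicity of
  \<open>U2\<close> along the line would give \<open>U2 x2 > U2 x1 \<ge> U1 x1\<close>; convexity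
  keeps the segment inside \<open>B\<close>.\<close>

lemma hodograph_monotone:
  fixes U1 U2 :: "'a::euclidean_space \<Rightarrow> real"
  assumes B: "convex B" and U2: "\<And>x. x \<in> B \<Longrightarrow> GDERIV U2 x :> G2 x" and pos: "\<And>x. x \<in> B \<Longrightarrow> G2 x \<bullet> e > 0"
    and le: "\<And>x. x \<in> B \<Longrightarrow> U1 x \<le> U2 x" and e: "norm e = 1"
    and T: "\<And>x. T1 x = x + (U1 x - x \<bullet> e) *\<^sub>R e" "\<And>x. T2 x = x + (U2 x - x \<bullet> e) *\<^sub>R e"
    and x: "x1 \<in> B" "x2 \<in> B" "T1 x1 = T2 x2"
  shows "x2 \<bullet> e \<le> x1 \<bullet> e"
proof (rule ccontr)
  assume "\<not> x2 \<bullet> e \<le> x1 \<bullet> e"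
  define t where "t = x2 \<bullet> e - x1 \<bullet> e"
  have t: "t > 0" using \<open>\<not> x2 \<bullet> e \<le> x1 \<bullet> e\<close> by (simp add: t_def)
  have U: "U1 x1 = U2 x2"
    using hodograph_height[OF e T(1), of x1] hodograph_height[OF e T(2), of x2] x(3) by simp
  have x2: "x2 = x1 + t *\<^sub>R e"
    using x(3) unfolding T U t_def by (simp add: algebra_simps)
  have "GDERIV U2 (x1 + r *\<^sub>R e) :> G2 (x1 + r *\<^sub>R e)" "x1 + r *\<^sub>R e \<in> B" if "0 \<le> r" "r \<le> t" for r
  proof -
    have "x1 + r *\<^sub>R e = (1 - r / t) *\<^sub>R x1 + (r / t) *\<^sub>R x2"
      using t by (simp add: x2 algebra_simps)
    then show "x1 + r *\<^sub>R e \<in> B" using that t by (simp add: convexD_alt[OF B x(1,2)])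
    then show "GDERIV U2 (x1 + r *\<^sub>R e) :> G2 (x1 + r *\<^sub>R e)" by (rule U2)
  qed
  note seg = this
  obtain r where r: "0 < r" "r < t" "(U2 (x1 + t *\<^sub>R e) - U2 x1) / t = e \<bullet> G2 (x1 + r *\<^sub>R e)"
    using difference_quotient[OF t seg(1)] by blast
  have "e \<bullet> G2 (x1 + r *\<^sub>R e) > 0" using pos[OF seg(2)] r by (simp add: inner_commute)
  then have "(U2 (x1 + t *\<^sub>R e) - U2 x1) / t > 0" unfolding r(3) .
  then have "U2 x2 > U2 x1" using t unfolding x2 by (simp add: zero_less_divide_iff)
  moreover have "U2 x1 \<ge> U1 x1" by (rule le[OF x(1)])
  ultimately show False using U by simp
qed

text \<open>Both nonlinearities are the same function \<open>h\<close> of the respective transformed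
  variable, and contact at \<open>x0\<close> means that the two transforms share the image
  \<open>y0\<close>. The heights can therefore be compared on one ball about \<open>y0\<close>,
  where the minimum principle applies to their difference.\<close>

lemma local_comparison:
  fixes U1 U2 :: "real ^ 'n \<Rightarrow> real"
  assumes dim: "CARD('n) \<ge> 2"
    and B: "open B" "convex B" "x0 \<in> B"
    and U: "\<And>x. x \<in> B \<Longrightarrow> GDERIV U1 x :> G1 x" "\<And>x. x \<in> B \<Longrightarrow> GDERIV U2 x :> G2 x"
    and G: "continuous_on B G1" "continuous_on B G2" and e: "norm e = 1"
    and close: "\<And>x. x \<in> B \<Longrightarrow> norm (G1 x - e) \<le> 1 / (20 * real CARD('n))" "\<And>x. x \<in> B \<Longrightarrow> norm (G2 x - e) \<le> 1 / (20 * real CARD('n))"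
    and h: "\<And>K. compact K \<Longrightarrow> set_integrable lebesgue K h"
    and F: "\<And>x. F1 x = h (x + (U1 x - x \<bullet> e) *\<^sub>R e)" "\<And>x. F2 x = h (x + (U2 x - x \<bullet> e) *\<^sub>R e)"
    and W: "weak_subsol B G1 F1" "weak_subsol B (\<lambda>x. - G2 x) (\<lambda>x. - F2 x)"
    and le: "\<And>x. x \<in> B \<Longrightarrow> U1 x \<le> U2 x" and eq: "U1 x0 = U2 x0"
  shows "\<exists>N. open N \<and> x0 \<in> N \<and> (\<forall>x\<in>N. U1 x = U2 x)"
proof -
  define T1 where "T1 x = x + (U1 x - x \<bullet> e) *\<^sub>R e" for x
  define T2 where "T2 x = x + (U2 x - x \<bullet> e) *\<^sub>R e" for x
  have n2: "real CARD('n) \<ge> 2" using dim by simp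
  have ee: "e \<bullet> e = 1" using e by (simp flip: power2_norm_eq_inner)
  have pos: "G x \<bullet> e > 0" if "norm (G x - e) \<le> 1 / (20 * real CARD('n))" for G and x :: "real ^ 'n"
  proof -
    have "1 / (20 * real CARD('n)) < 1" using n2 by simp
    moreover have "\<bar>(G x - e) \<bullet> e\<bar> \<le> norm (G x - e)" using Cauchy_Schwarz_ineq2[of "G x - e" e] e by simp
    ultimately have "\<bar>(G x - e) \<bullet> e\<bar> < 1" using that by linarith
    then show ?thesis by (simp add: inner_diff_left ee)
  qed
  have pos1: "G1 x \<bullet> e > 0" and pos2: "G2 x \<bullet> e > 0" if "x \<in> B" for x
    using pos close that by blast+
  have ne1: "G1 x \<bullet> e \<noteq> 0" and ne2: "G2 x \<bullet> e \<noteq> 0" if "x \<in> B" for x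
    using pos1[OF that] pos2[OF that] by simp_all
  obtain A1 V1 S1 where A1: "open A1" "A1 \<subseteq> B" "x0 \<in> A1" "open V1" "T1 x0 \<in> V1" "homeomorphism A1 V1 T1 S1"
    and D1: "\<forall>y\<in>V1. GDERIV (\<lambda>y. S1 y \<bullet> e) y :> e + (1 / (G1 (S1 y) \<bullet> e)) *\<^sub>R (e - G1 (S1 y))"
    using hodograph_diffeo[OF B(1,3) U(1) G(1) e ne1 T1_def] by blast
  obtain A2 V2 S2 where A2: "open A2" "A2 \<subseteq> B" "x0 \<in> A2" "open V2" "T2 x0 \<in> V2" "homeomorphism A2 V2 T2 S2"
    and D2: "\<forall>y\<in>V2. GDERIV (\<lambda>y. S2 y \<bullet> e) y :> e + (1 / (G2 (S2 y) \<bullet> e)) *\<^sub>R (e - G2 (S2 y))"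
    using hodograph_diffeo[OF B(1,3) U(2) G(2) e ne2 T2_def] by blast
  define y0 where "y0 = T1 x0"
  have y0: "y0 \<in> V1 \<inter> V2" using A1(5) A2(5) eq by (simp add: y0_def T1_def T2_def)
  have "open (V1 \<inter> V2)" using A1(4) A2(4) by (rule open_Int)
  then obtain R where R: "R > 0" "ball y0 R \<subseteq> V1 \<inter> V2" using y0 unfolding open_contains_ball by blast
  have R1: "ball y0 R \<subseteq> V1" and R2: "ball y0 R \<subseteq> V2" using R(2) by auto
  have S1: "\<And>x. x \<in> A1 \<Longrightarrow> S1 (T1 x) = x" "\<And>y. y \<in> V1 \<Longrightarrow> T1 (S1 y) = y" "\<And>y. y \<in> V1 \<Longrightarrow> S1 y \<in> A1" "continuous_on V1 S1" "continuous_on A1 T1"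
    using A1(6) by (auto simp: homeomorphism_def)
  have S2: "\<And>x. x \<in> A2 \<Longrightarrow> S2 (T2 x) = x" "\<And>y. y \<in> V2 \<Longrightarrow> T2 (S2 y) = y" "\<And>y. y \<in> V2 \<Longrightarrow> S2 y \<in> A2" "continuous_on V2 S2"
    using A2(6) by (auto simp: homeomorphism_def)
  have SB: "S1 y \<in> B" "S2 y \<in> B" if "y \<in> ball y0 R" for y
    using that R1 R2 S1(3) S2(3) A1(2) A2(2) by blast+
  define w where "w y = S1 y \<bullet> e - S2 y \<bullet> e" for y
  define q where "q y = (e + (1 / (G1 (S1 y) \<bullet> e)) *\<^sub>R (e - G1 (S1 y))) - (e + (1 / (G2 (S2 y) \<bullet> e)) *\<^sub>R (e - G2 (S2 y)))" for y
  define D where "D y = stress e (G1 (S1 y)) - stress e (G2 (S2 y))" for y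
  have Gc: "continuous_on (ball y0 R) (\<lambda>y. G1 (S1 y))" "continuous_on (ball y0 R) (\<lambda>y. G2 (S2 y))"
    by (rule continuous_on_compose2[OF G(1) continuous_on_subset[OF S1(4) R1]], use SB in blast)
       (rule continuous_on_compose2[OF G(2) continuous_on_subset[OF S2(4) R2]], use SB in blast)
  have wz: "w y' = 0" if y': "y' \<in> ball y0 R" for y'
  proof (rule strong_minimum_principle[where R=R and ?y0.0=y0 and q=q and D=D])
    show "2 \<le> DIM(real ^ 'n)" using dim by simp
    show "GDERIV w y :> q y" if y: "y \<in> ball y0 R" for y
    proof -
      have "y \<in> V1" "y \<in> V2" using y R(2) by blast+
      then show ?thesis
        using has_derivative_diff[OF D1[rule_format, unfolded gderiv_def] D2[rule_format, unfolded gderiv_def], of y]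
        unfolding w_def[abs_def] q_def gderiv_def by (simp only: inner_diff_right)
    qed
    show "continuous_on (ball y0 R) q" unfolding q_def
    proof (intro continuous_intros Gc ballI)
      fix y assume "y \<in> ball y0 R"
      then show "G1 (S1 y) \<bullet> e \<noteq> 0" "G2 (S2 y) \<bullet> e \<noteq> 0" using pos1[OF SB(1)] pos2[OF SB(2)] by (metis less_irrefl)+
    qed
    show "0 \<le> w y" if y: "y \<in> ball y0 R" for y
    proof -
      have "y \<in> V1" "y \<in> V2" using y R(2) by blast+
      then have "T1 (S1 y) = T2 (S2 y)" by (simp add: S1(2) S2(2))
      from hodograph_monotone[OF B(2) U(2) pos2 le e T1_def T2_def SB[OF y] this]
      show ?thesis by (simp add: w_def)
    qed
    show "w y0 = 0"
    proof -
      have "S1 y0 = x0" unfolding y0_def by (rule S1(1)[OF A1(3)])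
      moreover have "y0 = T2 x0" by (simp add: y0_def T1_def T2_def eq)
      then have "S2 y0 = x0" using S2(1)[OF A2(3)] by simp
      ultimately show ?thesis by (simp add: w_def)
    qed
    show "continuous_on (ball y0 R) D" unfolding D_def by (intro continuous_on_diff stress_continuous Gc)
    show "norm (D y - q y) \<le> 1 / (2 * real DIM(real ^ 'n)) * norm (q y)" if y: "y \<in> ball y0 R" for y
      using stress_estimate[OF e n2 close(1)[OF SB(1)[OF y]] close(2)[OF SB(2)[OF y]]] by (simp add: D_def q_def)
    show "0 \<le> (LINT y|lebesgue. D y \<bullet> g y)" if \<Psi>: "K \<subseteq> ball y0 R" "C1_supp K \<Psi> g" "\<And>y. \<Psi> y \<ge> 0" for K \<Psi> g
    proof -
      have W1: "weak_subsol A1 (\<lambda>x. 1 *\<^sub>R G1 x) (\<lambda>x. 1 * F1 x)" by (rule weak_subsol_restrict[OF W(1) A1(2)]) simp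
      have W2: "weak_subsol A2 (\<lambda>x. (-1) *\<^sub>R G2 x) (\<lambda>x. (-1) * F2 x)"
        using weak_subsol_restrict[OF W(2) A2(2), of 1] by simp
      have KV: "K \<subseteq> V1" "K \<subseteq> V2" using \<Psi>(1) R(2) by blast+
      have G1A: "continuous_on A1 G1" "continuous_on A2 G2"
        using G A1(2) A2(2) continuous_on_subset by blast+
      have F1T: "F1 x = h (T1 x)" and F2T: "F2 x = h (T2 x)" for x by (simp_all add: F T1_def T2_def)
      have p1: "G1 x \<bullet> e > 0" "GDERIV U1 x :> G1 x" if "x \<in> A1" for x using pos1 U(1) that A1(2) by blast+
      have p2: "G2 x \<bullet> e > 0" "GDERIV U2 x :> G2 x" if "x \<in> A2" for x using pos2 U(2) that A2(2) by blast+
      note H1 = hodograph_inequality[OF A1(1) p1(2) G1A(1) e p1(1) T1_def A1(4,6) h F1T _ W1 \<Psi>(2) KV(1) \<Psi>(3)]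
      note H2 = hodograph_inequality[OF A2(1) p2(2) G1A(2) e p2(1) T2_def A2(4,6) h F2T _ W2 \<Psi>(2) KV(2) \<Psi>(3)]
      have i: "integrable lebesgue (\<lambda>y. stress e (G1 (S1 y)) \<bullet> g y)" "integrable lebesgue (\<lambda>y. stress e (G2 (S2 y)) \<bullet> g y)"
        "integrable lebesgue (\<lambda>y. h y * \<Psi> y)"
        by (rule H1(2) H2(2) H1(3); simp)+
      have "0 \<le> 1 * (LINT y|lebesgue. stress e (G1 (S1 y)) \<bullet> g y + h y * \<Psi> y)" by (rule H1(1)) simp_all
      moreover have "0 \<le> (-1) * (LINT y|lebesgue. stress e (G2 (S2 y)) \<bullet> g y + h y * \<Psi> y)" by (rule H2(1)) simp_all
      \<comment> \<open>The term \<open>h y * \<Psi> y\<close> is integrable and common to both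
        inequalities, so it cancels.\<close>
      ultimately have "0 \<le> (LINT y|lebesgue. stress e (G1 (S1 y)) \<bullet> g y) - (LINT y|lebesgue. stress e (G2 (S2 y)) \<bullet> g y)"
        using Bochner_Integration.integral_add[OF i(1,3)] Bochner_Integration.integral_add[OF i(2,3)] by simp
      also have "\<dots> = (LINT y|lebesgue. D y \<bullet> g y)"
        using Bochner_Integration.integral_diff[OF i(1,2)] by (simp add: D_def inner_diff_left)
      finally show ?thesis .
    qed
  qed (rule y')
  have "open (A1 \<inter> T1 -` ball y0 R)" by (rule continuous_open_preimage[OF S1(5) A1(1) open_ball])
  moreover have "x0 \<in> A1 \<inter> T1 -` ball y0 R" using A1(3) R(1) by (simp add: y0_def)
  moreover have "U1 x = U2 x" if "x \<in> A1 \<inter> T1 -` ball y0 R" for x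
  proof -
    define y where "y = T1 x"
    have y: "y \<in> ball y0 R" "y \<in> V1" "y \<in> V2" using that R(2) by (auto simp: y_def)
    have x: "S1 y = x" using S1(1) that by (simp add: y_def)
    have s: "S1 y \<bullet> e = S2 y \<bullet> e" using wz[OF y(1)] by (simp add: w_def)
    have h1: "U1 (S1 y) = y \<bullet> e" using hodograph_height[OF e T1_def, of "S1 y"] S1(2)[OF y(2)] by simp
    have h2: "U2 (S2 y) = y \<bullet> e" using hodograph_height[OF e T2_def, of "S2 y"] S2(2)[OF y(3)] by simp
    \<comment> \<open>The transforms alter only the component along \<open>e\<close>, so equal
      heights over the same \<open>y\<close> force equal points.\<close>
    have "S1 y + (U1 (S1 y) - S1 y \<bullet> e) *\<^sub>R e = S2 y + (U2 (S2 y) - S2 y \<bullet> e) *\<^sub>R e"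
      using S1(2)[OF y(2)] S2(2)[OF y(3)] unfolding T1_def T2_def by simp
    then have "S1 y = S2 y" unfolding h1 h2 s by simp
    then show ?thesis using h1 h2 x by simp
  qed
  ultimately show ?thesis by blast
qed

theorem theorem1p1:
  fixes \<Omega> :: "(real ^ 'n) set" and f :: "real \<Rightarrow> real" and p :: real
    and u1 u2 :: "real ^ 'n \<Rightarrow> real" and x0 :: "real ^ 'n"
  assumes "CARD('n) \<ge> 2"
    and "open \<Omega>" and "connected \<Omega>" and "\<Omega> \<noteq> {}"
    and "p > 1" and "f \<in> Lp_loc p"
    and "Ck_on 1 \<Omega> u1" and "Ck_on 1 \<Omega> u2"
    and "\<forall>x\<in>\<Omega>. gradient u1 x \<noteq> 0" and "\<forall>x\<in>\<Omega>. gradient u2 x \<noteq> 0"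
    and "weak_ge \<Omega> f u1" and "weak_le \<Omega> f u2"
    and "\<forall>x\<in>\<Omega>. u1 x \<le> u2 x"
    and "x0 \<in> \<Omega>" and "u1 x0 = u2 x0"
  shows "\<forall>x\<in>\<Omega>. u1 x = u2 x"
proof -
  note g1 = Ck_1_gradient[OF assms(7)] and g2 = Ck_1_gradient[OF assms(8)]
  have fL: "set_integrable lebesgue K f" if "compact K" for K
    by (rule Lp_loc_imp_L1_loc[OF assms(6,5) that])
  have fm: "f \<in> borel_measurable lebesgue" using assms(6) by (simp add: Lp_loc_def)
  have W1: "weak_subsol \<Omega> (gradient u1) (\<lambda>x. f (u1 x))"
    using assms(11) unfolding weak_subsol_def weak_ge_def by simp
  have W2: "weak_subsol \<Omega> (\<lambda>x. - gradient u2 x) (\<lambda>x. - f (u2 x))"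
    unfolding weak_subsol_def
  proof (intro ballI impI)
    fix \<phi> :: "real ^ 'n \<Rightarrow> real" assume "\<phi> \<in> test_functions \<Omega>" "\<forall>x. \<phi> x \<ge> 0"
    then have "(LINT x:\<Omega>|lebesgue. - (gradient u2 x \<bullet> gradient \<phi> x) + f (u2 x) * \<phi> x) \<le> 0"
      using assms(12) unfolding weak_le_def by blast
    moreover have "(LINT x:\<Omega>|lebesgue. - ((- gradient u2 x) \<bullet> gradient \<phi> x) + - f (u2 x) * \<phi> x) =
      - (LINT x:\<Omega>|lebesgue. - (gradient u2 x \<bullet> gradient \<phi> x) + f (u2 x) * \<phi> x)"
      unfolding set_lebesgue_integral_def integral_minus[symmetric]
      by (intro Bochner_Integration.integral_cong refl) (simp add: indicator_def)
    ultimately show "0 \<le> (LINT x:\<Omega>|lebesgue. - ((- gradient u2 x) \<bullet> gradient \<phi> x) + - f (u2 x) * \<phi> x)"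
      by linarith
  qed
  have local: "\<exists>N. open N \<and> z \<in> N \<and> (\<forall>x\<in>N. u1 x = u2 x)" if z: "z \<in> \<Omega>" "u1 z = u2 z" for z
  proof -
    define a where "a = gradient u1 z"
    \<comment> \<open>Rescaling turns the gradient of \<open>u1\<close> at the contact point into
      the unit vector \<open>e\<close>, near which the flux estimate is available.\<close>
    define \<kappa> where "\<kappa> = 1 / norm a"
    define e where "e = \<kappa> *\<^sub>R a"
    have a0: "a \<noteq> 0" using assms(9) z by (simp add: a_def)
    have \<kappa>: "\<kappa> > 0" using a0 by (simp add: \<kappa>_def)
    have e: "norm e = 1" using a0 by (simp add: e_def \<kappa>_def)
    have ea: "norm a *\<^sub>R e = a" using a0 by (simp add: e_def \<kappa>_def)
    \<comment> \<open>The difference has its minimum 0 at the contact point, so the two gradients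
      agree there and a single direction \<open>e\<close> serves both transforms.\<close>
    have "GDERIV (\<lambda>x. u2 x - u1 x) z :> gradient u2 z - gradient u1 z"
      using has_derivative_diff[OF g2(1)[OF z(1), unfolded gderiv_def] g1(1)[OF z(1), unfolded gderiv_def]]
      unfolding gderiv_def by (simp only: inner_diff_right)
    then have "(\<lambda>h. h \<bullet> (gradient u2 z - gradient u1 z)) = (\<lambda>h. 0)"
      unfolding gderiv_def
      by (rule differential_zero_maxmin[OF z(1) assms(2)]) (use assms(13) z in auto)
    then have "(gradient u2 z - gradient u1 z) \<bullet> (gradient u2 z - gradient u1 z) = 0" by (rule fun_cong)
    then have a2: "gradient u2 z = a" by (simp add: a_def)
    define \<delta> where "\<delta> = 1 / (20 * real CARD('n))"
    have \<delta>: "\<delta> > 0" by (simp add: \<delta>_def)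
    have c: "continuous_on \<Omega> (\<lambda>x. norm (\<kappa> *\<^sub>R gradient u1 x - e))" "continuous_on \<Omega> (\<lambda>x. norm (\<kappa> *\<^sub>R gradient u2 x - e))"
      by (intro continuous_intros g1(2) g2(2))+
    have "open ((\<Omega> \<inter> (\<lambda>x. norm (\<kappa> *\<^sub>R gradient u1 x - e)) -` {..<\<delta>}) \<inter> (\<Omega> \<inter> (\<lambda>x. norm (\<kappa> *\<^sub>R gradient u2 x - e)) -` {..<\<delta>}))"
      by (rule open_Int[OF continuous_open_preimage[OF c(1) assms(2) open_lessThan] continuous_open_preimage[OF c(2) assms(2) open_lessThan]])
    moreover have "z \<in> (\<Omega> \<inter> (\<lambda>x. norm (\<kappa> *\<^sub>R gradient u1 x - e)) -` {..<\<delta>}) \<inter> (\<Omega> \<inter> (\<lambda>x. norm (\<kappa> *\<^sub>R gradient u2 x - e)) -` {..<\<delta>})"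
      using z \<delta> a2 by (simp add: e_def a_def)
    ultimately obtain r where r: "r > 0"
      "ball z r \<subseteq> (\<Omega> \<inter> (\<lambda>x. norm (\<kappa> *\<^sub>R gradient u1 x - e)) -` {..<\<delta>}) \<inter> (\<Omega> \<inter> (\<lambda>x. norm (\<kappa> *\<^sub>R gradient u2 x - e)) -` {..<\<delta>})"
      unfolding open_contains_ball by blast
    have B\<Omega>: "ball z r \<subseteq> \<Omega>" using r(2) by blast
    \<comment> \<open>The rescaled transform has \<open>y \<bullet> e = \<kappa> u\<close>, hence
      \<open>y \<bullet> a = u\<close>; this is why \<open>f\<close> is evaluated at the product
      with \<open>a\<close> and not with \<open>e\<close>.\<close>
    define h where "h y = \<kappa> * f (y \<bullet> a)" for y
    have hi: "set_integrable lebesgue K h" if "compact K" for K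
      unfolding h_def using set_integrable_linear_functional[OF fm fL a0 that]
      by (rule set_integrable_mult_right)
    have Te: "(x + (\<kappa> * u x - x \<bullet> e) *\<^sub>R e) \<bullet> a = u x" for u :: "real ^ 'n \<Rightarrow> real" and x
    proof -
      have "(x + (\<kappa> * u x - x \<bullet> e) *\<^sub>R e) \<bullet> (norm a *\<^sub>R e) = norm a * (\<kappa> * u x)"
        using hodograph_height[OF e, of "\<lambda>x. x + (\<kappa> * u x - x \<bullet> e) *\<^sub>R e" "\<lambda>x. \<kappa> * u x" x] by simp
      then show ?thesis using a0 unfolding ea by (simp add: \<kappa>_def)
    qed
    have "\<exists>N. open N \<and> z \<in> N \<and> (\<forall>x\<in>N. \<kappa> * u1 x = \<kappa> * u2 x)"
    proof (rule local_comparison[where B="ball z r" and e=e and h=h and ?G1.0="\<lambda>x. \<kappa> *\<^sub>R gradient u1 x" and ?G2.0="\<lambda>x. \<kappa> *\<^sub>R gradient u2 x"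
          and ?F1.0="\<lambda>x. \<kappa> * f (u1 x)" and ?F2.0="\<lambda>x. \<kappa> * f (u2 x)", OF assms(1) open_ball convex_ball])
      show "GDERIV (\<lambda>x. \<kappa> * u1 x) x :> \<kappa> *\<^sub>R gradient u1 x" if "x \<in> ball z r" for x
        using has_derivative_mult_right[OF g1(1)[unfolded gderiv_def], of x \<kappa>] that B\<Omega> by (auto simp: gderiv_def)
      show "GDERIV (\<lambda>x. \<kappa> * u2 x) x :> \<kappa> *\<^sub>R gradient u2 x" if "x \<in> ball z r" for x
        using has_derivative_mult_right[OF g2(1)[unfolded gderiv_def], of x \<kappa>] that B\<Omega> by (auto simp: gderiv_def)
      show "continuous_on (ball z r) (\<lambda>x. \<kappa> *\<^sub>R gradient u1 x)" "continuous_on (ball z r) (\<lambda>x. \<kappa> *\<^sub>R gradient u2 x)"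
        by (intro continuous_intros continuous_on_subset[OF g1(2) B\<Omega>] continuous_on_subset[OF g2(2) B\<Omega>])+
      show "norm (\<kappa> *\<^sub>R gradient u1 x - e) \<le> 1 / (20 * real CARD('n))" "norm (\<kappa> *\<^sub>R gradient u2 x - e) \<le> 1 / (20 * real CARD('n))"
        if "x \<in> ball z r" for x
        using subsetD[OF r(2) that] by (auto simp: \<delta>_def)
      show "\<kappa> * f (u1 x) = h (x + (\<kappa> * u1 x - x \<bullet> e) *\<^sub>R e)" "\<kappa> * f (u2 x) = h (x + (\<kappa> * u2 x - x \<bullet> e) *\<^sub>R e)" for x
        by (simp_all only: h_def Te)
      show "weak_subsol (ball z r) (\<lambda>x. \<kappa> *\<^sub>R gradient u1 x) (\<lambda>x. \<kappa> * f (u1 x))"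
        by (rule weak_subsol_restrict[OF W1 B\<Omega> less_imp_le[OF \<kappa>]])
      show "weak_subsol (ball z r) (\<lambda>x. - (\<kappa> *\<^sub>R gradient u2 x)) (\<lambda>x. - (\<kappa> * f (u2 x)))"
        using weak_subsol_restrict[OF W2 B\<Omega> less_imp_le[OF \<kappa>]] by simp
      show "\<kappa> * u1 x \<le> \<kappa> * u2 x" if "x \<in> ball z r" for x
        using assms(13) that B\<Omega> \<kappa> by (intro mult_left_mono) auto
    qed (use r(1) e z(2) hi in auto)
    then show ?thesis using \<kappa> by auto
  qed
  \<comment> \<open>The contact set is open by the local result and relatively closed by continuity;
    connectedness of \<open>\<Omega>\<close> makes it everything.\<close>
  define Z where "Z = {x \<in> \<Omega>. u1 x = u2 x}"
  have "openin (top_of_set \<Omega>) Z"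
  proof (subst openin_subopen, intro ballI)
    fix z assume "z \<in> Z"
    then obtain N where N: "open N" "z \<in> N" "\<forall>x\<in>N. u1 x = u2 x" using local by (auto simp: Z_def)
    show "\<exists>T. openin (top_of_set \<Omega>) T \<and> z \<in> T \<and> T \<subseteq> Z"
      using N \<open>z \<in> Z\<close> by (intro exI[of _ "\<Omega> \<inter> N"]) (auto simp: Z_def openin_open_Int)
  qed
  moreover have "closedin (top_of_set \<Omega>) Z"
  proof -
    have "continuous_on \<Omega> u1" "continuous_on \<Omega> u2"
      using g1(1) g2(1) unfolding gderiv_def by (blast intro: continuous_at_imp_continuous_on has_derivative_continuous)+
    then have "continuous_on \<Omega> (\<lambda>x. u1 x - u2 x)" by (rule continuous_on_diff)
    then have "closedin (top_of_set \<Omega>) (\<Omega> \<inter> (\<lambda>x. u1 x - u2 x) -` {0})"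
      by (rule continuous_closedin_preimage) simp
    moreover have "\<Omega> \<inter> (\<lambda>x. u1 x - u2 x) -` {0} = Z" by (auto simp: Z_def)
    ultimately show ?thesis by simp
  qed
  ultimately have "Z = {} \<or> Z = \<Omega>" using assms(3) unfolding connected_clopen by blast
  moreover have "x0 \<in> Z" using assms(14,15) by (simp add: Z_def)
  ultimately show ?thesis by (auto simp: Z_def)
qed

end
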